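(* Let $F$ be a non-discrete locally compact non-archimedean field of characteristic $\neq 2$, with residue field of characteristic $p$ and cardinality $q$. Let $R$ be an integral domain with $p\in R^\times$, containing a square root of $q$, and let $\chi:F\to R^\times$ be a non-trivial smooth character. Let $X$ be a finite-dimensional $F$-vector space, $W=X\times X^*$, and let $\mathrm{Mp}(W)$ be the metaplectic group attached to $R$ and $\chi$, containing $R^\times$ as the kernel of its projection to $\mathrm{Sp}(W)$. Let $\mathrm{char}(R)\neq 2$. Then there does not exist a character (group homomorphism) $\psi:\mathrm{Mp}(W)\to R^\times$ such that $\psi_{|R^\times}=\mathrm{id}$.
   Context: A smooth character of $F$ is a group homomorphism $F\to R^\times$ with open kernel. $X^*=\mathrm{Hom}_F(X,F)$; $[x,x^*]=x^*(x)$ and $\langle x,x^*\rangle=\chi([x,x^*])$. On $W=X\times X^*$ put $\mathcal B((x_1,x_1^* ),(x_2,x_2^* ))=[x_1,x_2^*]$ and $\mathcal F=\chi\circ\mathcal B$. $\mathrm{Sp}(W)$ is the group of $F$-linear automorphisms $\sigma$ of $W$ preserving the form $(w_1,w_2)\mapsto\mathcal B(w_1,w_2)-\mathcal B(w_2,w_1)$. For $\sigma\in\mathrm{Sp}(W)$ put $f_\sigma(w)=\frac12(\mathcal B(\sigma w,\sigma w)-\mathcal B(w,w))$. $A(W)$ is the set $W\times R^\times$ with group law $(w_1,t_1)(w_2,t_2)=(w_1+w_2,t_1t_2\mathcal F(w_1,w_2))$; its center is $Z=\{(0,t):t\in R^\times\}$. $B_0(W)$ is the group of group automorphisms of $A(W)$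 acting trivially on $Z$. $\mathcal S(X)$ is the $R$-module of locally constant compactly supported functions $X\to R$, and $\mathrm{Aut}(\mathcal S(X))$ its group of $R$-linear automorphisms. For $w=(v,v^* )\in W$ and $t\in R^\times$, $U(w,t)\in\mathrm{Aut}(\mathcal S(X))$ is $(U(w,t)\Phi)(x)=t\,\Phi(x+v)\langle x,v^*\rangle$; the map $U$ is an isomorphism from $A(W)$ onto a subgroup $\mathbb A(W)$ of $\mathrm{Aut}(\mathcal S(X))$. $\mathbb B_0(W)$ is the normalizer of $\mathbb A(W)$ in $\mathrm{Aut}(\mathcal S(X))$. The homomorphism $\pi_0:\mathbb B_0(W)\to B_0(W)$ sends $\mathbf s$ to conjugation by $\mathbf s$ on $\mathbb A(W)\cong A(W)$ (identified via $U$). The homomorphism $\mu:\mathrm{Sp}(W)\to B_0(W)$ sends $\sigma$ to the automorphism $(w,t)\mapsto(\sigma(w),\chi(f_\sigma(w))t)$. The metaplectic group is $\mathrm{Mp}(W)=\{(\sigma,\mathbf s)\in\mathrm{Sp}(W)\times\mathbb B_0(W):\mu(\sigma)=\pi_0(\mathbf s)\}$, with projection $(\sigma,\mathbf s)\mapsto\sigma$ to $\mathrm{Sp}(W)$. The group $R^\times$ is embedded in $\mathrm{Mp}(W)$ by $t\mapsto(\mathrm{id},t\cdot\mathrm{id}_{\mathcal S(X)})$.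
   Formalization: The space X is assumed nonzero: for X = 0 the group Sp(W) is trivial, Mp(W) = R^×, and the identity is a character restricting to the identity on R^×, so the claim fails there. *)

theory Defs
  imports "HOL-Analysis.Analysis" "HOL-Algebra.Bij" "HOL-Algebra.QuotRing"
    "HOL-Algebra.Group_Action" "HOL-Algebra.Multiplicative_Group"
begin

section \<open>Non-archimedean local fields\<close>

text \<open>The type class only says that the field carries a metric; the first assumption makes it
  the metric of the absolute value, so that the field operations are continuous.\<close>

locale nonarch_local_field =
  fixes absv :: "'f::{field,metric_space} \<Rightarrow> real"
  assumes dist_absv: "dist x y = absv (x - y)"
    and absv_mult: "absv (x * y) = absv x * absv y"
    and absv_ultrametric: "absv (x + y) \<le> max (absv x) (absv y)"
    and locally_compact: "locally_compact_space (euclidean :: 'f topology)"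
    and nondiscrete: "\<exists>S :: 'f set. \<not> open S"

definition valuation_ring :: "('f::field \<Rightarrow> real) \<Rightarrow> 'f ring" where
  "valuation_ring absv =
    \<lparr>carrier = {x. absv x \<le> 1}, mult = (*), one = 1, zero = 0, add = (+)\<rparr>"

definition residue_field :: "('f::field \<Rightarrow> real) \<Rightarrow> 'f set ring" where
  "residue_field absv = valuation_ring absv Quot {x. absv x < 1}"

text \<open>The additive order of the unit; \<open>group.ord\<close> is 0 for an element of infinite order.\<close>

definition ring_char :: "('a, 'b) ring_scheme \<Rightarrow> nat" where
  "ring_char K = group.ord (add_monoid K) \<one>\<^bsub>K\<^esub>"

section \<open>Characters\<close>

definition units_group :: "'r::comm_ring_1 monoid" where
  "units_group = \<lparr>carrier = {t. t dvd 1}, mult = (*), one = 1\<rparr>"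

definition additive_group :: "'f::ab_group_add monoid" where
  "additive_group = \<lparr>carrier = UNIV, mult = (+), one = 0\<rparr>"

definition smooth_character ::
    "('f::{field,topological_space} \<Rightarrow> 'r::comm_ring_1) \<Rightarrow> bool" where
  "smooth_character chi \<longleftrightarrow> chi \<in> hom additive_group units_group \<and> open {x. chi x = 1}"

section \<open>The symplectic space\<close>

text \<open>Throughout, \<open>sc\<close> is the scalar multiplication of the \<open>F\<close>-vector space \<open>X\<close>, whose
  underlying set is the whole type \<open>'x\<close>.\<close>

definition dual :: "('f::field \<Rightarrow> 'x::ab_group_add \<Rightarrow> 'x) \<Rightarrow> ('x \<Rightarrow> 'f) set" where
  "dual sc = {f. Vector_Spaces.linear sc (*) f}"

definition W_space :: "('f::field \<Rightarrow> 'x::ab_group_add \<Rightarrow> 'x) \<Rightarrow> ('x \<times> ('x \<Rightarrow> 'f)) set" where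
  "W_space sc = UNIV \<times> dual sc"

definition W_add ::
    "'x::ab_group_add \<times> ('x \<Rightarrow> 'f::field) \<Rightarrow> 'x \<times> ('x \<Rightarrow> 'f) \<Rightarrow> 'x \<times> ('x \<Rightarrow> 'f)" where
  "W_add w w' = (fst w + fst w', \<lambda>y. snd w y + snd w' y)"

definition W_scale ::
    "('f::field \<Rightarrow> 'x::ab_group_add \<Rightarrow> 'x) \<Rightarrow> 'f \<Rightarrow> 'x \<times> ('x \<Rightarrow> 'f) \<Rightarrow> 'x \<times> ('x \<Rightarrow> 'f)" where
  "W_scale sc c w = (sc c (fst w), \<lambda>y. c * snd w y)"

definition W_zero :: "'x::ab_group_add \<times> ('x \<Rightarrow> 'f::field)" where
  "W_zero = (0, \<lambda>_. 0)"

definition bform :: "'x \<times> ('x \<Rightarrow> 'f) \<Rightarrow> 'x \<times> ('x \<Rightarrow> 'f) \<Rightarrow> 'f" where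
  "bform w w' = snd w' (fst w)"

definition Sp :: "('f::field \<Rightarrow> 'x::ab_group_add \<Rightarrow> 'x)
    \<Rightarrow> ('x \<times> ('x \<Rightarrow> 'f) \<Rightarrow> 'x \<times> ('x \<Rightarrow> 'f)) monoid" where
  "Sp sc = BijGroup (W_space sc) \<lparr>carrier := {\<sigma> \<in> Bij (W_space sc).
     (\<forall>w\<in>W_space sc. \<forall>w'\<in>W_space sc. \<sigma> (W_add w w') = W_add (\<sigma> w) (\<sigma> w')) \<and>
     (\<forall>c. \<forall>w\<in>W_space sc. \<sigma> (W_scale sc c w) = W_scale sc c (\<sigma> w)) \<and>
     (\<forall>w\<in>W_space sc. \<forall>w'\<in>W_space sc.
        bform (\<sigma> w) (\<sigma> w') - bform (\<sigma> w') (\<sigma> w) = bform w w' - bform w' w)}\<rparr>"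

definition f_sp :: "('x \<times> ('x \<Rightarrow> 'f::field) \<Rightarrow> 'x \<times> ('x \<Rightarrow> 'f)) \<Rightarrow> 'x \<times> ('x \<Rightarrow> 'f) \<Rightarrow> 'f" where
  "f_sp \<sigma> w = (bform (\<sigma> w) (\<sigma> w) - bform w w) / 2"

section \<open>The Heisenberg group\<close>

definition A_group :: "('f::field \<Rightarrow> 'x::ab_group_add \<Rightarrow> 'x) \<Rightarrow> ('f \<Rightarrow> 'r::comm_ring_1)
    \<Rightarrow> (('x \<times> ('x \<Rightarrow> 'f)) \<times> 'r) monoid" where
  "A_group sc chi = \<lparr>carrier = W_space sc \<times> {t. t dvd 1},
     mult = (\<lambda>a b. (W_add (fst a) (fst b), snd a * snd b * chi (bform (fst a) (fst b)))),
     one = (W_zero, 1)\<rparr>"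

text \<open>Group automorphisms of \<open>A(W)\<close> are represented, as in \<open>AutoGroup\<close>, by functions
  that are extensional on the carrier, so that equality of \<open>mu\<close> and \<open>pi0\<close> below is equality
  of automorphisms. Both take values in the automorphisms fixing the centre pointwise, so this
  subgroup need not appear in the definition of \<open>Mp\<close>.\<close>

definition mu :: "('f::field \<Rightarrow> 'x::ab_group_add \<Rightarrow> 'x) \<Rightarrow> ('f \<Rightarrow> 'r::comm_ring_1)
    \<Rightarrow> ('x \<times> ('x \<Rightarrow> 'f) \<Rightarrow> 'x \<times> ('x \<Rightarrow> 'f))
    \<Rightarrow> ('x \<times> ('x \<Rightarrow> 'f)) \<times> 'r \<Rightarrow> ('x \<times> ('x \<Rightarrow> 'f)) \<times> 'r" where
  "mu sc chi \<sigma> = (\<lambda>a \<in> carrier (A_group sc chi). (\<sigma> (fst a), chi (f_sp \<sigma> (fst a)) * snd a))"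

section \<open>Locally constant compactly supported functions\<close>

text \<open>The coarsest topology making all linear functionals continuous. For finite-dimensional
  \<open>X\<close> this is the usual topology of \<open>X\<close>, i.e. the product topology of \<open>F\<^sup>n\<close> transported along
  any choice of basis.\<close>

definition vs_topology ::
    "('f::{field,topological_space} \<Rightarrow> 'x::ab_group_add \<Rightarrow> 'x) \<Rightarrow> 'x topology" where
  "vs_topology sc = topology_generated_by {f -` V | f V. f \<in> dual sc \<and> open V}"

definition locally_constant :: "'x topology \<Rightarrow> ('x \<Rightarrow> 'r) \<Rightarrow> bool" where
  "locally_constant T \<Phi> \<longleftrightarrow>
     (\<forall>x\<in>topspace T. \<exists>U. openin T U \<and> x \<in> U \<and> (\<forall>y\<in>U. \<Phi> y = \<Phi> x))"

definition compactly_supported :: "'x topology \<Rightarrow> ('x \<Rightarrow> 'r::zero) \<Rightarrow> bool" where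
  "compactly_supported T \<Phi> \<longleftrightarrow> compactin T (T closure_of {x. \<Phi> x \<noteq> 0})"

definition S_space ::
    "('f::{field,topological_space} \<Rightarrow> 'x::ab_group_add \<Rightarrow> 'x) \<Rightarrow> ('x \<Rightarrow> 'r::comm_ring_1) set" where
  "S_space sc =
     {\<Phi>. locally_constant (vs_topology sc) \<Phi> \<and> compactly_supported (vs_topology sc) \<Phi>}"

definition Aut_S :: "('f::{field,topological_space} \<Rightarrow> 'x::ab_group_add \<Rightarrow> 'x)
    \<Rightarrow> (('x \<Rightarrow> 'r::comm_ring_1) \<Rightarrow> ('x \<Rightarrow> 'r)) monoid" where
  "Aut_S sc = BijGroup (S_space sc) \<lparr>carrier := {s \<in> Bij (S_space sc).
     (\<forall>\<Phi>\<in>S_space sc. \<forall>\<Psi>\<in>S_space sc. s (\<lambda>x. \<Phi> x + \<Psi> x) = (\<lambda>x. s \<Phi> x + s \<Psi> x)) \<and>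
     (\<forall>c. \<forall>\<Phi>\<in>S_space sc. s (\<lambda>x. c * \<Phi> x) = (\<lambda>x. c * s \<Phi> x))}\<rparr>"

definition U_op :: "('f::{field,topological_space} \<Rightarrow> 'x::ab_group_add \<Rightarrow> 'x)
    \<Rightarrow> ('f \<Rightarrow> 'r::comm_ring_1) \<Rightarrow> ('x \<times> ('x \<Rightarrow> 'f)) \<times> 'r \<Rightarrow> ('x \<Rightarrow> 'r) \<Rightarrow> ('x \<Rightarrow> 'r)" where
  "U_op sc chi a = (\<lambda>\<Phi> \<in> S_space sc.
     \<lambda>x. snd a * \<Phi> (x + fst (fst a)) * chi (snd (fst a) x))"

section \<open>The metaplectic group\<close>

definition BB0_group :: "('f::{field,topological_space} \<Rightarrow> 'x::ab_group_add \<Rightarrow> 'x)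
    \<Rightarrow> ('f \<Rightarrow> 'r::comm_ring_1) \<Rightarrow> (('x \<Rightarrow> 'r) \<Rightarrow> ('x \<Rightarrow> 'r)) monoid" where
  "BB0_group sc chi = Aut_S sc
     \<lparr>carrier := normalizer (Aut_S sc) (U_op sc chi ` carrier (A_group sc chi))\<rparr>"

definition pi0 :: "('f::{field,topological_space} \<Rightarrow> 'x::ab_group_add \<Rightarrow> 'x)
    \<Rightarrow> ('f \<Rightarrow> 'r::comm_ring_1) \<Rightarrow> (('x \<Rightarrow> 'r) \<Rightarrow> ('x \<Rightarrow> 'r))
    \<Rightarrow> ('x \<times> ('x \<Rightarrow> 'f)) \<times> 'r \<Rightarrow> ('x \<times> ('x \<Rightarrow> 'f)) \<times> 'r" where
  "pi0 sc chi s = (\<lambda>a \<in> carrier (A_group sc chi).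
     inv_into (carrier (A_group sc chi)) (U_op sc chi)
       (s \<otimes>\<^bsub>Aut_S sc\<^esub> U_op sc chi a \<otimes>\<^bsub>Aut_S sc\<^esub> inv\<^bsub>Aut_S sc\<^esub> s))"

definition Mp :: "('f::{field,topological_space} \<Rightarrow> 'x::ab_group_add \<Rightarrow> 'x)
    \<Rightarrow> ('f \<Rightarrow> 'r::comm_ring_1)
    \<Rightarrow> (('x \<times> ('x \<Rightarrow> 'f) \<Rightarrow> 'x \<times> ('x \<Rightarrow> 'f)) \<times> (('x \<Rightarrow> 'r) \<Rightarrow> ('x \<Rightarrow> 'r))) monoid" where
  "Mp sc chi = (Sp sc \<times>\<times> BB0_group sc chi)
     \<lparr>carrier := {(\<sigma>, s). \<sigma> \<in> carrier (Sp sc) \<and> s \<in> carrier (BB0_group sc chi) \<and>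
        mu sc chi \<sigma> = pi0 sc chi s}\<rparr>"

definition Mp_scalar :: "('f::{field,topological_space} \<Rightarrow> 'x::ab_group_add \<Rightarrow> 'x)
    \<Rightarrow> 'r::comm_ring_1
    \<Rightarrow> ('x \<times> ('x \<Rightarrow> 'f) \<Rightarrow> 'x \<times> ('x \<Rightarrow> 'f)) \<times> (('x \<Rightarrow> 'r) \<Rightarrow> ('x \<Rightarrow> 'r))" where
  "Mp_scalar sc t = (\<lambda>w \<in> W_space sc. w, \<lambda>\<Phi> \<in> S_space sc. \<lambda>x. t * \<Phi> x)"

end

theory Submission
  imports Defs "HOL-Algebra.Sylow"
begin

text \<open>
  A character \<open>\<psi>\<close> of \<open>Mp(W)\<close> that is the identity on scalars assigns a unit to every operator
  \<open>s\<close> lifting a symplectic automorphism. Choose \<open>e0 \<in> X\<close> and a functional \<open>eps\<close> with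
  \<open>eps(e0) = 1\<close>, and let the following operators act along \<open>e0\<close>: multiplication
  \<open>N\<^sub>b\<close> by \<open>\<chi>(b eps\<^sup>2)\<close>, dilation \<open>M\<^sub>a\<close>, and the partial Fourier transform \<open>F\<close>. As
  \<open>M\<^sub>a N\<^sub>b = N\<^bsub>ba^2\<^esub> M\<^sub>a\<close>, the character is trivial on all \<open>N\<^sub>b\<close>, and
  \<open>F M\<^sub>a = |a|^(-1) M\<^bsub>1/a\<^esub> F\<close> shows that \<open>\<eta>(a) = \<psi>(M\<^sub>a)\<close> satisfies \<open>\<eta>(a)^2 = 1/|a|\<close>, where \<open>|a|\<close>
  is read as a power of \<open>q\<close> in \<open>R\<close>. Finally
  \<open>F N\<^sub>a F = G(a) N\<^bsub>-1/4a\<^esub> M\<^bsub>-1/2a\<^esub> F N\<^bsub>-1/4a\<^esub>\<close> with the Gauss integral \<open>G(a) = \<integral> \<chi>(a x^2) dx\<close>,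
  so \<open>G\<close> is proportional to the homomorphism \<open>\<eta>\<close>.

  This is impossible. Choose \<open>d\<close> such that \<open>t^2 + t - d\<close> is irreducible over the residue field,
  and let \<open>Q(x, y) = x^2 + xy - dy^2\<close>. Completing the square,
  \<open>\<integral>\<integral> \<chi>(a Q(x, y)) dx dy = G(a) G(-a(1 + 4d)/4)\<close> would be a constant multiple of \<open>1/|a|\<close>. Taking
  \<open>\<chi>\<close> trivial on the integers but not on the inverse of the maximal ideal, the integral is 1 for
  \<open>|a| = 1\<close>, hence it would be \<open>1/q\<close> for \<open>|a| = q\<close>. In that case it is \<open>q^(-2)\<close> times a character
  sum over the residue field, and Fourier inversion would give
  \<open>q^2 - q = q #{Q = 1}\<close>. But the conic \<open>Q = 1\<close> has \<open>q + 1\<close> points, so \<open>2q = 0\<close> in \<open>R\<close>.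
\<close>

section \<open>Absolute values\<close>

text \<open>Over an arbitrary domain R neither a real Haar measure nor an explicit value of a Gauss
  sum is at hand. Integrals are finite sums over quotients of balls, weighted by powers of the
  inverse of q, which exists in R because p is invertible; the Gauss integral is the value at which
  the integrals over growing balls become stationary.

  The form Q is the norm form of the unramified quadratic extension. Its discriminant 1 + 4d is a
  unit in every residue characteristic, 2 included, which lets the integral collapse to a sum over
  the residue field. For the chosen \<chi> the integral is really 1/|a| times the unramified
  quadratic character of a, hence -1/q at |a| = q. A Gauss integral proportional to a homomorphism
  with square 1/|a| would lose this sign, and 1 = -1 is what the characteristic of R excludes.

  Only the coordinate along e0 is ever moved. The other coordinates are parameters, so everything
  about X reduces to Fourier theory on F.\<close>

context nonarch_local_field
begin

lemma absv_nonneg [simp]: "0 \<le> absv x"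
  using dist_absv[of x 0] zero_le_dist[of x 0] by simp

lemma absv_zero [simp]: "absv 0 = 0"
  using dist_absv[of 0 0] by simp

lemma absv_eq_0_iff [simp]: "absv x = 0 \<longleftrightarrow> x = 0"
  using dist_absv[of x 0] zero_less_dist_iff[of x 0] by auto

lemma absv_one [simp]: "absv 1 = 1"
  using absv_mult[of 1 1] absv_eq_0_iff[of 1] by simp

lemma absv_minus [simp]: "absv (- x) = absv x"
  using dist_absv[of 0 x] dist_absv[of x 0] by (simp add: dist_commute)

lemma absv_inverse: "absv (inverse x) = inverse (absv x)"
  by (cases "x = 0") (use absv_mult[of x "inverse x"] in \<open>auto simp: field_simps\<close>)

lemma absv_divide: "absv (x / y) = absv x / absv y"
  by (simp add: divide_inverse absv_mult absv_inverse)

lemma absv_power: "absv (x ^ n) = absv x ^ n"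
  by (induction n) (auto simp: absv_mult)

lemma absv_powi: "absv (x powi n) = absv x powi n"
  by (auto simp: power_int_def absv_power absv_inverse)

lemma continuous_mult_left: "continuous_on UNIV (\<lambda>x::'f. c * x)"
proof (cases "c = 0")
  case False
  show ?thesis
    unfolding continuous_on_iff
  proof (intro ballI allI impI)
    fix x :: 'f and e :: real assume e: "e > 0"
    have c: "absv c > 0" using False absv_nonneg[of c] by (simp add: less_le)
    have "dist (c * x') (c * x) < e" if "dist x' x < e / absv c" for x'
      using that c by (simp add: dist_absv absv_mult pos_less_divide_eq mult.commute
          flip: right_diff_distrib)
    then show "\<exists>d>0. \<forall>x'\<in>UNIV. dist x' x < d \<longrightarrow> dist (c * x') (c * x) < e"
      using e c by (intro exI[of _ "e / absv c"]) auto
  qed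
qed auto

text \<open>If nonzero elements had absolute values bounded below, distinct points would be
  uniformly separated and every set would be open.\<close>

lemma ex_small: "\<exists>x. x \<noteq> 0 \<and> absv x < r" if "r > 0"
proof (rule ccontr)
  assume "\<not> ?thesis"
  then have *: "x = y" if "dist x y < r" for x y :: 'f
    using that dist_absv[of x y] by (metis eq_iff_diff_eq_0)
  then have "open S" for S :: "'f set"
    unfolding open_dist using \<open>r > 0\<close> by metis
  then show False using nondiscrete by blast
qed

text \<open>Local compactness yields one compact ball around 0. Multiplication by the inverse of a
  small \<open>y\<close> is continuous and expands it over any given ball.\<close>

lemma compact_ball: "compact {x. absv x \<le> r}"
proof -
  have clo: "closed {x. absv x \<le> r}" for r
  proof -
    have "{x. absv x \<le> r} = cball 0 r" by (auto simp: dist_absv)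
    then show ?thesis by simp
  qed
  obtain U K :: "'f set" where "open U" "compact K" "0 \<in> U" "U \<subseteq> K"
    using locally_compact unfolding locally_compact_space_def by simp metis
  then obtain r0 where r0: "r0 > 0" "cball 0 r0 \<subseteq> K"
    by (meson open_contains_cball subset_trans)
  then have "{x. absv x \<le> r0} \<subseteq> K" by (auto simp: dist_absv)
  then have c0: "compact {x. absv x \<le> r0}"
    using compact_Int_closed[OF \<open>compact K\<close> clo[of r0]] by (simp add: Int_absorb1)
  obtain y where y: "y \<noteq> 0" "absv y < r0 / (\<bar>r\<bar> + 1)"
    using ex_small[of "r0 / (\<bar>r\<bar> + 1)"] r0 by auto
  have "compact ((\<lambda>x. inverse y * x) ` {x. absv x \<le> r0})"
    by (rule compact_continuous_image[OF continuous_on_subset[OF continuous_mult_left] c0]) simp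
  moreover have "{x. absv x \<le> r} \<subseteq> (\<lambda>x. inverse y * x) ` {x. absv x \<le> r0}"
  proof
    fix x assume "x \<in> {x. absv x \<le> r}"
    then have "absv x \<le> \<bar>r\<bar> + 1" by auto
    then have "absv y * absv x \<le> r0 / (\<bar>r\<bar> + 1) * (\<bar>r\<bar> + 1)"
      using y r0 by (intro mult_mono) (auto intro!: divide_nonneg_pos)
    then show "x \<in> (\<lambda>x. inverse y * x) ` {x. absv x \<le> r0}"
      using y by (intro image_eqI[of _ _ "y * x"]) (auto simp: absv_mult)
  qed
  ultimately show ?thesis
    using compact_Int_closed[OF _ clo[of r]] by (metis inf.absorb2)
qed

text \<open>By the ultrametric inequality the open unit ball is also closed, hence compact, so
  \<open>absv\<close> attains a maximum on it; \<open>ex_small\<close> makes this maximum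
  nonzero.\<close>

lemma ex_uniformizer: "\<exists>\<pi>. \<pi> \<noteq> 0 \<and> absv \<pi> < 1 \<and> (\<forall>x. absv x < 1 \<longrightarrow> absv x \<le> absv \<pi>)"
proof -
  have "closed {x. absv x < 1}"
    unfolding closed_def open_dist
  proof (intro ballI exI[of _ 1] conjI allI impI)
    fix x y assume x: "x \<in> - {x. absv x < 1}" and d: "dist y x < 1"
    have "absv x \<le> max (absv y) (absv (x - y))" using absv_ultrametric[of y "x - y"] by simp
    moreover have "absv (x - y) < 1" using d dist_absv[of y x] absv_minus[of "x - y"] by simp
    ultimately show "y \<in> - {x. absv x < 1}" using x by auto
  qed simp
  moreover have "{x. absv x < 1} \<subseteq> {x. absv x \<le> 1}" by auto
  ultimately have "compact {x. absv x < 1}"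
    using compact_Int_closed[OF compact_ball[of 1]] by (metis inf.absorb2)
  moreover have "continuous_on {x. absv x < 1} absv"
  proof -
    have "absv = dist 0" by (auto simp: dist_absv)
    then show ?thesis by (simp add: continuous_on_dist)
  qed
  moreover have "{x. absv x < 1} \<noteq> {}" by (auto intro: exI[of _ 0])
  ultimately obtain \<pi> where \<pi>: "absv \<pi> < 1" "\<forall>x. absv x < 1 \<longrightarrow> absv x \<le> absv \<pi>"
    using continuous_attains_sup[of "{x. absv x < 1}" absv] by auto
  moreover obtain y where "y \<noteq> 0" "absv y < 1" using ex_small[of 1] by auto
  ultimately have "absv y \<le> absv \<pi>" "absv y \<noteq> 0" by auto
  then have "absv \<pi> \<noteq> 0" using absv_nonneg[of y] by linarith
  then show ?thesis using \<pi> by auto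
qed

lemma finite_residues:
  assumes "r > 0"
  shows "\<exists>D. finite D \<and> D \<subseteq> {x. absv x \<le> R} \<and> (\<forall>x. absv x \<le> R \<longrightarrow> (\<exists>d\<in>D. absv (x - d) < r))"
proof -
  have "\<exists>D\<subseteq>{x. absv x \<le> R}. finite D \<and> {x. absv x \<le> R} \<subseteq> (\<Union>d\<in>D. ball d r)"
  proof (rule compactE_image[OF compact_ball[of R], of "{x. absv x \<le> R}" "\<lambda>d. ball d r"])
    show "{x. absv x \<le> R} \<subseteq> (\<Union>d\<in>{x. absv x \<le> R}. ball d r)"
      using assms centre_in_ball by blast
  qed auto
  then obtain D where D: "D \<subseteq> {x. absv x \<le> R}" "finite D" "{x. absv x \<le> R} \<subseteq> (\<Union>d\<in>D. ball d r)"
    by blast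
  have "\<exists>d\<in>D. absv (x - d) < r" if "absv x \<le> R" for x
  proof -
    have "x \<in> (\<Union>d\<in>D. ball d r)" using D(3) that by blast
    then obtain d where "d \<in> D" "dist d x < r" by auto
    then show ?thesis by (metis dist_absv dist_commute)
  qed
  then show ?thesis using D by blast
qed

end

section \<open>Balls and systems of representatives\<close>

locale uniformized = nonarch_local_field absv
  for absv :: "'f::{field,metric_space} \<Rightarrow> real" +
  fixes \<pi> :: 'f
  assumes pi_nz [simp]: "\<pi> \<noteq> 0"
    and pi_lt: "absv \<pi> < 1"
    and pi_max: "absv x < 1 \<Longrightarrow> absv x \<le> absv \<pi>"
begin

text \<open>The fractional ideals: \<open>B 0\<close> is the ring of integers and \<open>B 1\<close>
  its maximal ideal.\<close>

definition B :: "int \<Rightarrow> 'f set" where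
  "B n = {x. absv x \<le> absv \<pi> powi n}"

lemma pi_pos: "0 < absv \<pi>"
  by (simp add: less_le)

lemma B_0 [simp]: "0 \<in> B n"
  by (simp add: B_def)

lemma B_minus [simp]: "- x \<in> B n \<longleftrightarrow> x \<in> B n"
  by (simp add: B_def)

lemma B_add: "x \<in> B n \<Longrightarrow> y \<in> B n \<Longrightarrow> x + y \<in> B n"
  unfolding B_def using absv_ultrametric[of x y] by auto

lemma B_diff: "x \<in> B n \<Longrightarrow> y \<in> B n \<Longrightarrow> x - y \<in> B n"
  using B_add[of x n "- y"] by simp

lemma B_add_iff: "y \<in> B n \<Longrightarrow> x + y \<in> B n \<longleftrightarrow> x \<in> B n"
  using B_add[of x n y] B_diff[of "x + y" n y] by auto

lemma B_diff_commute: "x - y \<in> B n \<longleftrightarrow> y - x \<in> B n"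
  using B_minus[of "x - y" n] by simp

lemma B_diff_trans: "x - y \<in> B n \<Longrightarrow> y - z \<in> B n \<Longrightarrow> x - z \<in> B n"
  using B_add[of "x - y" n "y - z"] by simp

lemma B_mono: "n \<le> m \<Longrightarrow> x \<in> B m \<Longrightarrow> x \<in> B n"
proof -
  assume *: "n \<le> m" "x \<in> B m"
  have "absv \<pi> powi m \<le> absv \<pi> powi n"
    using * pi_pos pi_lt by (intro power_int_decreasing) auto
  then show ?thesis using * by (auto simp: B_def)
qed

lemma B_mult: "x \<in> B n \<Longrightarrow> y \<in> B m \<Longrightarrow> x * y \<in> B (n + m)"
  using pi_pos by (auto simp: B_def absv_mult power_int_add intro!: mult_mono)

lemma B_scale:
  assumes "absv a = absv \<pi> powi k"
  shows "a * x \<in> B n \<longleftrightarrow> x \<in> B (n - k)"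
  using assms pi_pos by (auto simp: B_def absv_mult power_int_diff field_simps)

lemma one_in_B [simp]: "1 \<in> B 0"
  by (simp add: B_def)

lemma pi_in_B: "\<pi> powi n \<in> B n"
  by (simp add: B_def absv_powi)

lemma absv_pi_powi: "absv (\<pi> powi n) = absv \<pi> powi n"
  by (simp add: absv_powi)

text \<open>A strict inequality of absolute values improves by a whole factor
  \<open>absv \<pi>\<close>: the quotient \<open>\<pi> powi n / x\<close> lies in the open unit
  ball, where \<open>pi_max\<close> applies.\<close>

lemma not_B_imp: "x \<notin> B n \<Longrightarrow> absv \<pi> powi (n - 1) \<le> absv x"
proof -
  assume "x \<notin> B n"
  then have x: "absv x > absv \<pi> powi n" by (simp add: B_def)
  have pn: "absv \<pi> powi n > 0" using pi_pos by simp
  have "x \<noteq> 0" using x pn by auto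
  have "absv (\<pi> powi n / x) < 1"
    using x pn by (simp add: absv_divide absv_powi)
  then have "absv (\<pi> powi n / x) \<le> absv \<pi>" by (rule pi_max)
  moreover have "absv x > 0" using x pn by linarith
  ultimately have "absv \<pi> powi n \<le> absv \<pi> * absv x"
    by (simp add: absv_divide absv_powi field_simps)
  then show ?thesis using pi_pos by (simp add: power_int_diff field_simps)
qed

lemma B_inverse_unit: "x \<in> B 0 \<Longrightarrow> x \<notin> B 1 \<Longrightarrow> inverse x \<in> B 0"
  using not_B_imp[of x 1] by (auto simp: B_def absv_inverse)

lemma ex_B_small:
  assumes "r > 0" shows "\<exists>n. \<forall>x\<in>B n. absv x < r"
proof -
  obtain n where "absv \<pi> ^ n < r"
    using real_arch_pow_inv[OF assms pi_lt] by auto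
  then show ?thesis by (intro exI[of _ "int n"]) (auto simp: B_def)
qed

lemma ex_B_large: "\<exists>n. \<forall>x. absv x \<le> r \<longrightarrow> x \<in> B n"
proof -
  obtain n where n: "absv \<pi> ^ n < 1 / (\<bar>r\<bar> + 1)"
    using real_arch_pow_inv[OF _ pi_lt, of "1 / (\<bar>r\<bar> + 1)"] by (auto simp: add_nonneg_pos)
  have "absv \<pi> ^ n * (\<bar>r\<bar> + 1) < 1"
    using n by (subst (asm) pos_less_divide_eq) auto
  then have "\<bar>r\<bar> + 1 \<le> 1 / absv \<pi> ^ n"
    using pi_pos by (subst pos_le_divide_eq) (auto simp: mult.commute)
  then have "r \<le> absv \<pi> powi (- int n)"
    by (simp add: power_int_minus divide_inverse)
  then show ?thesis by (intro exI[of _ "- int n"]) (auto simp: B_def)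
qed

lemma ex_B: "\<exists>n. x \<in> B n"
  using ex_B_large[of "absv x"] by auto

text \<open>The balls shrink below \<open>absv x\<close>, so there is a last one that contains
  \<open>x\<close>; its index is the valuation.\<close>

lemma ex_val:
  assumes "x \<noteq> 0" shows "\<exists>n. absv x = absv \<pi> powi n"
proof -
  obtain m where m: "x \<in> B m" using ex_B by blast
  have "absv x > 0" using assms by (simp add: less_le)
  then obtain k where k: "\<forall>y\<in>B k. absv y < absv x" using ex_B_small by blast
  then have xk: "x \<notin> B k" by auto
  have "\<exists>n. x \<in> B n \<and> x \<notin> B (n + 1)"
  proof (rule ccontr)
    assume *: "\<not> ?thesis"
    have "x \<in> B (m + int i)" for i
    proof (induction i)
      case (Suc i)
      then have "x \<in> B (m + int i + 1)" using * by blast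
      then show ?case by (simp add: ac_simps)
    qed (use m in auto)
    from this[of "nat (k - m)"] have "x \<in> B k"
      by (rule B_mono[rotated]) linarith
    then show False using xk by blast
  qed
  then obtain n where n: "x \<in> B n" "x \<notin> B (n + 1)" by blast
  then have "absv x = absv \<pi> powi n"
    using not_B_imp[of x "n + 1"] by (auto simp: B_def)
  then show ?thesis by blast
qed

section \<open>Coset representatives and sums over quotients of balls\<close>

definition rep :: "int \<Rightarrow> 'f \<Rightarrow> 'f" where
  "rep n x = (SOME y. x - y \<in> B n)"

lemma rep_diff [simp]: "x - rep n x \<in> B n"
  unfolding rep_def by (rule someI[of _ x]) simp

lemma rep_diff' [simp]: "rep n x - x \<in> B n"
  using rep_diff by (simp add: B_diff_commute)

text \<open>The predicate under the choice operator depends only on the coset of \<open>x\<close>,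
  so congruent arguments get equal, not merely congruent, representatives.\<close>

lemma rep_eq_iff: "rep n x = rep n y \<longleftrightarrow> x - y \<in> B n"
proof
  assume "rep n x = rep n y"
  then show "x - y \<in> B n" by (metis B_diff_trans rep_diff rep_diff')
next
  assume "x - y \<in> B n"
  then have "(\<lambda>z. x - z \<in> B n) = (\<lambda>z. y - z \<in> B n)"
    using B_diff_trans B_diff_commute by blast
  then show "rep n x = rep n y" by (simp add: rep_def)
qed

lemma rep_rep [simp]: "rep n (rep n x) = rep n x"
  by (simp add: rep_eq_iff)

text \<open>Representatives of \<open>B m / B n\<close>, meaningful for \<open>m \<le> n\<close> only: larger indices give smaller
  balls.\<close>

definition T :: "int \<Rightarrow> int \<Rightarrow> 'f set" where
  "T n m = rep n ` B m"

lemma rep_in_T: "x \<in> B m \<Longrightarrow> rep n x \<in> T n m"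
  by (auto simp: T_def)

lemma T_in_B: "m \<le> n \<Longrightarrow> t \<in> T n m \<Longrightarrow> t \<in> B m"
proof -
  assume "m \<le> n" "t \<in> T n m"
  then obtain x where x: "x \<in> B m" "t = rep n x" by (auto simp: T_def)
  have "rep n x - x \<in> B m" using B_mono[OF \<open>m \<le> n\<close> rep_diff'] .
  from B_add[OF this x(1)] show ?thesis using x by simp
qed

lemma rep_T: "t \<in> T n m \<Longrightarrow> rep n t = t"
  by (auto simp: T_def)

lemma T_eq: "s \<in> T n m \<Longrightarrow> t \<in> T n m' \<Longrightarrow> s - t \<in> B n \<Longrightarrow> s = t"
  by (metis rep_T rep_eq_iff)

lemma finite_T [simp]: "finite (T n m)"
proof -
  have pn: "absv \<pi> powi n > 0" using pi_pos by simp
  obtain D where D: "finite D" "\<And>x. x \<in> B m \<Longrightarrow> \<exists>d\<in>D. absv (x - d) < absv \<pi> powi n"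
    using finite_residues[OF pn, of "absv \<pi> powi m"] unfolding B_def by blast
  have "T n m \<subseteq> rep n ` D"
  proof
    fix t assume "t \<in> T n m"
    then obtain x where x: "x \<in> B m" "t = rep n x" by (auto simp: T_def)
    then obtain d where "d \<in> D" "absv (x - d) < absv \<pi> powi n" using D by blast
    then have "rep n x = rep n d" by (simp add: rep_eq_iff B_def)
    then show "t \<in> rep n ` D" using x \<open>d \<in> D\<close> by auto
  qed
  then show ?thesis using D(1) finite_subset by blast
qed

text \<open>A bijection of quotients transports sums of functions on cosets. As \<open>h\<close>
  need not map representatives to representatives, the bijection is \<open>h\<close> followed by
  \<open>rep n'\<close>.\<close>

lemma sum_T_reindex:
  assumes "m \<le> n" "m' \<le> n'"
    and h: "\<And>x. x \<in> B m \<Longrightarrow> h x \<in> B m'"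
    and h_iff: "\<And>x y. x \<in> B m \<Longrightarrow> y \<in> B m \<Longrightarrow> h x - h y \<in> B n' \<longleftrightarrow> x - y \<in> B n"
    and surj: "\<And>y. y \<in> B m' \<Longrightarrow> \<exists>x\<in>B m. h x = y"
    and f: "\<And>x y. x \<in> B m' \<Longrightarrow> y \<in> B m' \<Longrightarrow> x - y \<in> B n' \<Longrightarrow> f x = f y"
  shows "(\<Sum>t\<in>T n m. f (h t)) = (\<Sum>t\<in>T n' m'. f t :: 'a::comm_monoid_add)"
proof -
  have hT: "h t \<in> B m'" "t \<in> B m" if "t \<in> T n m" for t
    using that h T_in_B[OF assms(1)] by auto
  have "bij_betw (\<lambda>t. rep n' (h t)) (T n m) (T n' m')"
  proof (rule bij_betwI')
    fix x y assume "x \<in> T n m" "y \<in> T n m"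
    then show "rep n' (h x) = rep n' (h y) \<longleftrightarrow> x = y"
      by (metis T_eq h_iff hT(2) rep_eq_iff)
  next
    fix x assume "x \<in> T n m"
    then show "rep n' (h x) \<in> T n' m'" using hT rep_in_T by blast
  next
    fix y assume y: "y \<in> T n' m'"
    then obtain x where x: "x \<in> B m" "h x = y" using surj T_in_B[OF assms(2)] by blast
    have r: "rep n x \<in> T n m" using x rep_in_T by blast
    have "h (rep n x) - h x \<in> B n'" using h_iff[of "rep n x" x] hT[OF r] x by simp
    then have "rep n' (h (rep n x)) = rep n' y" using x by (simp add: rep_eq_iff)
    then show "\<exists>x\<in>T n m. y = rep n' (h x)" using r rep_T[OF y] by auto
  qed
  then have "(\<Sum>t\<in>T n m. f (rep n' (h t))) = (\<Sum>t\<in>T n' m'. f t)"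
    by (rule sum.reindex_bij_betw)
  moreover have "f (rep n' (h t)) = f (h t)" if "t \<in> T n m" for t
    using hT[OF that] T_in_B[OF assms(2) rep_in_T] by (intro f) auto
  ultimately show ?thesis by simp
qed

lemma sum_T_translate:
  assumes "m \<le> n" "a \<in> B m"
    and "\<And>x y. x \<in> B m \<Longrightarrow> y \<in> B m \<Longrightarrow> x - y \<in> B n \<Longrightarrow> f x = f y"
  shows "(\<Sum>t\<in>T n m. f (t + a)) = (\<Sum>t\<in>T n m. f t :: 'a::comm_monoid_add)"
proof (rule sum_T_reindex[where h = "\<lambda>t. t + a"])
  show "\<exists>x\<in>B m. x + a = y" if "y \<in> B m" for y
    using assms that by (intro bexI[of _ "y - a"]) (auto intro: B_diff)
  show "x + a - (y + a) \<in> B n \<longleftrightarrow> x - y \<in> B n" for x y by simp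
  show "x + a \<in> B m" if "x \<in> B m" for x using B_add[OF that assms(2)] .
qed (fact assms)+

lemma sum_T_scale:
  assumes "m \<le> n" "absv a = absv \<pi> powi k"
    and "\<And>x y. x \<in> B m \<Longrightarrow> y \<in> B m \<Longrightarrow> x - y \<in> B n \<Longrightarrow> f x = f y"
  shows "(\<Sum>t\<in>T (n - k) (m - k). f (a * t)) = (\<Sum>t\<in>T n m. f t :: 'a::comm_monoid_add)"
proof (rule sum_T_reindex[where h = "\<lambda>t. a * t"])
  have "absv \<pi> powi k > 0" using pi_pos by simp
  then have a: "a \<noteq> 0" using assms(2) by auto
  show "\<exists>x\<in>B (m - k). a * x = y" if "y \<in> B m" for y
    using B_scale[OF assms(2), of "y / a" m] that a by (intro bexI[of _ "y / a"]) auto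
  show "a * x - a * y \<in> B n \<longleftrightarrow> x - y \<in> B (n - k)" for x y
    using B_scale[OF assms(2), of "x - y" n] by (simp only: right_diff_distrib)
  show "a * x \<in> B m" if "x \<in> B (m - k)" for x
    using B_scale[OF assms(2), of x m] that by blast
  show "m - k \<le> n - k" using assms(1) by simp
qed (fact assms)+

text \<open>The residue cardinality; \<open>card_residue_field\<close> links it to
  \<open>residue_field absv\<close>.\<close>

definition q :: nat where "q = card (T 1 0)"

text \<open>The coset of \<open>y\<close> modulo \<open>B n\<close> splits into \<open>q\<close>
  cosets modulo \<open>B (n + 1)\<close>, those of \<open>y + \<pi> powi n * u\<close> for
  \<open>u\<close> running through the residues.\<close>

lemma sum_T_refine:
  assumes "m \<le> n"
    and f: "\<And>x y. x \<in> B m \<Longrightarrow> y \<in> B m \<Longrightarrow> x - y \<in> B n \<Longrightarrow> f x = f y"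
  shows "(\<Sum>t\<in>T (n + 1) m. f t) = of_nat q * (\<Sum>t\<in>T n m. f t :: 'a::comm_semiring_1)"
proof -
  have pi: "absv (\<pi> powi n) = absv \<pi> powi n" by (rule absv_pi_powi)
  have B': "x \<in> B m" if "x \<in> T (n + 1) m" for x using that T_in_B[of m "n + 1"] assms(1) by auto
  have "(\<Sum>t\<in>T (n + 1) m. f t) = (\<Sum>y\<in>T n m. \<Sum>x | x \<in> T (n + 1) m \<and> rep n x = y. f x)"
    using rep_in_T B' by (intro sum.group[symmetric]) auto
  also have "\<dots> = (\<Sum>y\<in>T n m. of_nat q * f y)"
  proof (rule sum.cong)
    fix y assume y: "y \<in> T n m"
    then have yB: "y \<in> B m" using T_in_B assms(1) by auto
    let ?A = "{x. x \<in> T (n + 1) m \<and> rep n x = y}"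
    have "bij_betw (\<lambda>u. rep (n + 1) (y + \<pi> powi n * u)) (T 1 0) ?A"
    proof (rule bij_betwI')
      fix u v assume uv: "u \<in> T 1 0" "v \<in> T 1 0"
      have "rep (n + 1) (y + \<pi> powi n * u) = rep (n + 1) (y + \<pi> powi n * v)
          \<longleftrightarrow> \<pi> powi n * (u - v) \<in> B (n + 1)"
        by (simp add: rep_eq_iff right_diff_distrib)
      also have "\<dots> \<longleftrightarrow> u - v \<in> B 1" using B_scale[OF pi, of "u - v" "n + 1"] by simp
      also have "\<dots> \<longleftrightarrow> u = v" using T_eq[OF uv] by auto
      finally show "rep (n + 1) (y + \<pi> powi n * u) = rep (n + 1) (y + \<pi> powi n * v)
          \<longleftrightarrow> u = v" .
    next
      fix u assume u: "u \<in> T 1 0"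
      let ?x = "rep (n + 1) (y + \<pi> powi n * u)"
      have "u \<in> B 0" using u T_in_B[of 0 1] by auto
      then have un: "\<pi> powi n * u \<in> B n" using B_scale[OF pi, of u n] by simp
      then have "y + \<pi> powi n * u \<in> B m"
        using yB B_mono[OF assms(1) un] by (intro B_add)
      then have "?x \<in> T (n + 1) m" by (rule rep_in_T)
      moreover have "?x - (y + \<pi> powi n * u) \<in> B n"
        by (rule B_mono[of _ "n + 1"]) auto
      then have "?x - y \<in> B n" using B_add[OF _ un] by fastforce
      then have "rep n ?x = rep n y" by (simp only: rep_eq_iff)
      ultimately show "?x \<in> ?A" using rep_T[OF y] by auto
    next
      fix x assume x: "x \<in> ?A"
      then have "x - y \<in> B n" using rep_diff[of x n] by auto
      then have u: "(x - y) / \<pi> powi n \<in> B 0" (is "?u \<in> _")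
        using B_scale[OF pi, of ?u n] by simp
      have "?u - rep 1 ?u \<in> B 1" by simp
      then have "\<pi> powi n * (?u - rep 1 ?u) \<in> B (n + 1)"
        using B_scale[OF pi, of "?u - rep 1 ?u" "n + 1"] by simp
      moreover have "\<pi> powi n * (?u - rep 1 ?u) = x - (y + \<pi> powi n * rep 1 ?u)"
      proof -
        have "\<pi> powi n * ?u = x - y" by simp
        then show ?thesis unfolding right_diff_distrib by (simp only: diff_diff_eq)
      qed
      ultimately have "x - (y + \<pi> powi n * rep 1 ?u) \<in> B (n + 1)" by (simp only:)
      then have "rep (n + 1) x = rep (n + 1) (y + \<pi> powi n * rep 1 ?u)"
        by (simp only: rep_eq_iff)
      moreover have "rep (n + 1) x = x" using x rep_T by blast
      ultimately show "\<exists>u\<in>T 1 0. x = rep (n + 1) (y + \<pi> powi n * u)"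
        using rep_in_T[OF u, of 1] by auto
    qed
    then have "card ?A = q" unfolding q_def by (simp add: bij_betw_same_card)
    moreover have "f x = f y" if "x \<in> ?A" for x
      using that yB B' rep_diff[of x n] by (intro f) auto
    ultimately show "(\<Sum>x\<in>?A. f x) = of_nat q * f y" by simp
  qed simp
  also have "\<dots> = of_nat q * (\<Sum>t\<in>T n m. f t)" by (simp add: sum_distrib_left)
  finally show ?thesis .
qed

lemma T_same: "T n n = {rep n 0}"
proof -
  have "rep n ` B n = (\<lambda>_. rep n 0) ` B n"
  proof (rule image_cong)
    show "rep n x = rep n 0" if "x \<in> B n" for x using that by (simp add: rep_eq_iff)
  qed simp
  moreover have "B n \<noteq> {}" using B_0 by blast
  ultimately show ?thesis by (simp add: T_def image_constant_conv)
qed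

end

section \<open>Integration of locally constant functions\<close>

text \<open>Smoothness and nontriviality of \<open>chi\<close> enter through the conductor exponent
  \<open>c\<close>, invertibility of p through the inverse \<open>qi\<close> of
  \<open>q\<close>.\<close>

locale local_char = uniformized absv \<pi>
  for absv :: "'f::{field,metric_space} \<Rightarrow> real" and \<pi> :: 'f +
  fixes chi :: "'f \<Rightarrow> 'r::idom" and c :: int and qi :: 'r
  assumes chi_add: "chi (x + y) = chi x * chi y"
    and chi_triv: "x \<in> B c \<Longrightarrow> chi x = 1"
    and chi_nontriv: "\<exists>x\<in>B (c - 1). chi x \<noteq> 1"
    and qi: "qi * of_nat q = 1"
begin

lemma chi_0 [simp]: "chi 0 = 1"
  by (rule chi_triv) simp

lemma chi_minus: "chi x * chi (- x) = 1"
  using chi_add[of x "- x"] by simp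

lemma chi_nz [simp]: "chi x \<noteq> 0"
  using chi_minus[of x] by auto

lemma chi_unit: "chi x dvd 1"
  by (metis chi_minus dvd_triv_left)

lemma chi_eqI: "x - y \<in> B c \<Longrightarrow> chi x = chi y"
  using chi_add[of "x - y" y] chi_triv[of "x - y"] by simp

text \<open>Balls are dual to each other under \<open>chi (x * y)\<close>: the annihilator of
  \<open>B n\<close> is exactly \<open>B (c - n)\<close>. The witness is a point of
  \<open>B (c - 1)\<close> with nontrivial character value, divided by \<open>y\<close>.\<close>

lemma ex_chi_nontriv:
  assumes "y \<notin> B (c - n)"
  shows "\<exists>h\<in>B n. chi (y * h) \<noteq> 1"
proof -
  obtain x where x: "x \<in> B (c - 1)" "chi x \<noteq> 1" using chi_nontriv by blast
  have y: "absv y \<ge> absv \<pi> powi (c - n - 1)" using not_B_imp[OF assms] .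
  have pp: "absv \<pi> powi k > 0" for k using pi_pos by simp
  then have ypos: "absv y > 0" using y pp[of "c - n - 1"] by linarith
  have "absv x \<le> absv \<pi> powi (c - 1)" using x(1) by (simp add: B_def)
  also have "\<dots> = absv \<pi> powi n * absv \<pi> powi (c - n - 1)"
    using pi_pos by (simp flip: power_int_add)
  also have "\<dots> \<le> absv \<pi> powi n * absv y" using y pp[of n] by simp
  finally have "x / y \<in> B n" using ypos by (simp add: B_def absv_divide pos_divide_le_eq)
  moreover have "y * (x / y) = x" using ypos by auto
  ultimately show ?thesis using x(2) by (intro bexI[of _ "x / y"]) auto
qed

text \<open>The volume q^(-n) of \<open>B n\<close> for the R-valued Haar measure giving
  \<open>B 0\<close> volume 1. The two cases stand in for an integer power, which R does not
  have.\<close>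

definition vol :: "int \<Rightarrow> 'r" where
  "vol n = (if n \<ge> 0 then qi ^ nat n else of_nat q ^ nat (- n))"

lemma vol_0 [simp]: "vol 0 = 1"
  by (simp add: vol_def)

lemma vol_Suc: "of_nat q * vol (n + 1) = vol n"
proof (cases "n \<ge> 0")
  case True
  then have "nat (n + 1) = Suc (nat n)" by simp
  then show ?thesis using True qi by (simp add: vol_def mult.commute mult.left_commute)
next
  case False
  then have "nat (- n) = Suc (nat (- (n + 1)))" by simp
  then show ?thesis using False by (auto simp: vol_def)
qed

lemma vol_pred: "vol (n + 1) = qi * vol n"
  using vol_Suc[of n] qi by (metis mult.assoc mult_1)

lemma vol_add: "vol (n + m) = vol n * vol m"
proof (induction m rule: int_induct[where k = 0])
  case (step1 i)
  then show ?case using vol_pred[of "n + i"] vol_pred[of i]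
    by (simp add: add.assoc mult.left_commute)
next
  case (step2 i)
  then show ?case using vol_Suc[of "n + i - 1"] vol_Suc[of "i - 1"]
    by (simp add: add_diff_eq) (metis mult.left_commute)
qed simp

lemma vol_uminus: "vol n * vol (- n) = 1"
  using vol_add[of n "- n"] by simp

lemma vol_nz [simp]: "vol n \<noteq> 0"
  using vol_uminus[of n] by auto

lemma vol_unit: "vol n dvd 1"
  by (metis vol_uminus dvd_triv_left)

text \<open>Invariant under \<open>B n\<close> and supported in \<open>B m\<close>. The condition
  \<open>m \<le> n\<close> makes \<open>T n m\<close> a system of representatives of the support
  modulo \<open>B n\<close>.\<close>

definition LC :: "int \<Rightarrow> int \<Rightarrow> ('f \<Rightarrow> 'r) \<Rightarrow> bool" where
  "LC n m f \<longleftrightarrow> m \<le> n \<and> (\<forall>x y. x - y \<in> B n \<longrightarrow> f x = f y) \<and> (\<forall>x. x \<notin> B m \<longrightarrow> f x = 0)"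

text \<open>The pair \<open>(n, m)\<close> is an arbitrary choice; by \<open>I_eq\<close> the value does not depend on it.\<close>

definition I :: "('f \<Rightarrow> 'r) \<Rightarrow> 'r" where
  "I f = (let (n, m) = (SOME (n, m). LC n m f) in vol n * (\<Sum>t\<in>T n m. f t))"

lemma I_0 [simp]: "I (\<lambda>x. 0) = 0"
  by (simp add: I_def case_prod_beta Let_def)

lemma LC_mono: "LC n m f \<Longrightarrow> n \<le> N \<Longrightarrow> M \<le> m \<Longrightarrow> LC N M f"
  unfolding LC_def using B_mono by (meson order_trans)

lemma LC_inv: "LC n m f \<Longrightarrow> x - y \<in> B n \<Longrightarrow> f x = f y"
  by (auto simp: LC_def)

lemma LC_outside: "LC n m f \<Longrightarrow> x \<notin> B m \<Longrightarrow> f x = 0"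
  by (auto simp: LC_def)

lemma LC_le: "LC n m f \<Longrightarrow> m \<le> n"
  by (auto simp: LC_def)

lemma sum_T_enlarge:
  assumes "LC n m f" "M \<le> m"
  shows "(\<Sum>t\<in>T n M. f t) = (\<Sum>t\<in>T n m. f t)"
proof (rule sum.mono_neutral_right)
  show "T n m \<subseteq> T n M" using B_mono[OF assms(2)] by (auto simp: T_def)
  show "\<forall>t\<in>T n M - T n m. f t = 0"
    using LC_outside[OF assms(1)] rep_in_T rep_T by (metis Diff_iff)
qed simp

text \<open>Each refinement multiplies the sum by \<open>q\<close> and the volume of a coset by its
  inverse.\<close>

lemma sum_T_refine_LC:
  assumes "LC n m f" "n \<le> N"
  shows "vol N * (\<Sum>t\<in>T N m. f t) = vol n * (\<Sum>t\<in>T n m. f t)"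
  using assms(2)
proof (induction N rule: int_ge_induct)
  case (step i)
  have "LC i m f" using LC_mono[OF assms(1) step.hyps] by simp
  then have "(\<Sum>t\<in>T (i + 1) m. f t) = of_nat q * (\<Sum>t\<in>T i m. f t)"
    by (intro sum_T_refine) (auto simp: LC_def)
  then show ?case using step.IH vol_Suc[of i] by (metis mult.assoc mult.left_commute)
qed simp

lemma sum_T_mono:
  assumes "LC n m f" "n \<le> N" "M \<le> m"
  shows "vol N * (\<Sum>t\<in>T N M. f t) = vol n * (\<Sum>t\<in>T n m. f t)"
  using sum_T_enlarge[of N m f M] sum_T_refine_LC[OF assms(1,2)] LC_mono[OF assms(1,2), of m] assms
  by simp

lemma I_eq:
  assumes "LC n m f"
  shows "I f = vol n * (\<Sum>t\<in>T n m. f t)"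
proof -
  obtain n' m' where eq: "(SOME (n, m). LC n m f) = (n', m')" by fastforce
  have "(\<lambda>(n, m). LC n m f) (SOME (n, m). LC n m f)"
    by (rule someI[of _ "(n, m)"]) (use assms in simp)
  then have *: "LC n' m' f" by (simp add: eq)
  have "I f = vol n' * (\<Sum>t\<in>T n' m'. f t)" by (simp add: I_def eq)
  \<comment> \<open>Both pairs of levels are compared with their common refinement.\<close>
  also have "\<dots> = vol (max n n') * (\<Sum>t\<in>T (max n n') (min m m'). f t)"
    by (rule sum_T_mono[symmetric, OF *]) auto
  also have "\<dots> = vol n * (\<Sum>t\<in>T n m. f t)"
    by (rule sum_T_mono[OF assms]) auto
  finally show ?thesis .
qed

lemma LC_cmult: "LC n m f \<Longrightarrow> LC n m (\<lambda>x. a * f x)"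
  unfolding LC_def by (metis mult_zero_right)

lemma LC_mult:
  assumes "LC n m f" "\<And>x y. x - y \<in> B n \<Longrightarrow> x \<in> B m \<Longrightarrow> y \<in> B m \<Longrightarrow> g x = g y"
  shows "LC n m (\<lambda>x. f x * g x)" "LC n m (\<lambda>x. g x * f x)"
proof -
  have "f x * g x = f y * g y" if "x - y \<in> B n" for x y
  proof (cases "x \<in> B m \<and> y \<in> B m")
    case False
    then have "f x = 0" using LC_outside[OF assms(1)] LC_inv[OF assms(1) that] by auto
    then show ?thesis using LC_inv[OF assms(1) that] by simp
  qed (use assms that LC_inv[OF assms(1) that] in auto)
  then show "LC n m (\<lambda>x. f x * g x)" using assms(1) unfolding LC_def by simp
  then show "LC n m (\<lambda>x. g x * f x)" by (simp add: mult.commute)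
qed

lemma LC_add: "LC n m f \<Longrightarrow> LC n m g \<Longrightarrow> LC n m (\<lambda>x. f x + g x)"
  unfolding LC_def by (metis add_0)

lemma LC_translate:
  assumes "LC n m f" "h \<in> B m"
  shows "LC n m (\<lambda>x. f (x + h))"
  using assms B_add_iff[OF assms(2)] by (auto simp: LC_def)

lemma LC_scale:
  assumes "LC n m f" "absv a = absv \<pi> powi k"
  shows "LC (n - k) (m - k) (\<lambda>x. f (a * x))"
  unfolding LC_def
proof (intro conjI allI impI)
  show "m - k \<le> n - k" using LC_le[OF assms(1)] by simp
  show "f (a * x) = f (a * y)" if "x - y \<in> B (n - k)" for x y
    using LC_inv[OF assms(1), of "a * x" "a * y"] B_scale[OF assms(2), of "x - y" n] that
    by (simp only: right_diff_distrib)
  show "f (a * x) = 0" if "x \<notin> B (m - k)" for x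
    using LC_outside[OF assms(1), of "a * x"] B_scale[OF assms(2), of x m] that by blast
qed

lemma LC_ball: "m \<le> n \<Longrightarrow> LC n m (\<lambda>x. if x \<in> B m then 1 else 0)"
  unfolding LC_def using B_add_iff B_mono by (metis add.commute diff_add_cancel)

lemma LC_restrict:
  assumes "m \<le> n" "\<And>x y. x - y \<in> B n \<Longrightarrow> x \<in> B m \<Longrightarrow> y \<in> B m \<Longrightarrow> g x = g y"
  shows "LC n m (\<lambda>x. if x \<in> B m then g x else 0)"
proof -
  have "(\<lambda>x. if x \<in> B m then g x else 0) = (\<lambda>x. (if x \<in> B m then 1 else 0) * g x)" by auto
  then show ?thesis using LC_mult(1)[OF LC_ball[OF assms(1)] assms(2)] by simp
qed

lemma I_cmult: "LC n m f \<Longrightarrow> I (\<lambda>x. a * f x) = a * I f"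
  by (simp add: I_eq[OF LC_cmult] I_eq sum_distrib_left mult.left_commute)

lemma I_add:
  assumes "LC n m f" "LC n' m' g"
  shows "I (\<lambda>x. f x + g x) = I f + I g"
proof -
  have f: "LC (max n n') (min m m') f" by (rule LC_mono[OF assms(1)]) auto
  have g: "LC (max n n') (min m m') g" by (rule LC_mono[OF assms(2)]) auto
  show ?thesis by (simp add: I_eq[OF LC_add[OF f g]] I_eq[OF f] I_eq[OF g] sum.distrib distrib_left)
qed

lemma I_translate:
  assumes "LC n m f"
  shows "I (\<lambda>x. f (x + h)) = I f"
proof -
  obtain k where "h \<in> B k" using ex_B by blast
  then have h: "h \<in> B (min k m)" using B_mono[of "min k m" k] by simp
  have f: "LC n (min k m) f" by (rule LC_mono[OF assms]) auto
  show ?thesis unfolding I_eq[OF LC_translate[OF f h]] I_eq[OF f]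
    using sum_T_translate[OF LC_le[OF f] h, of f] LC_inv[OF f] by simp
qed

text \<open>The substitution shifts both levels by \<open>k\<close>, and only the volume of a coset
  notices: the factor is the inverse of the module of \<open>a\<close>.\<close>

lemma I_scale:
  assumes "LC n m f" "absv a = absv \<pi> powi k"
  shows "I (\<lambda>x. f (a * x)) = vol (- k) * I f"
proof -
  have "I (\<lambda>x. f (a * x)) = vol (n - k) * (\<Sum>t\<in>T (n - k) (m - k). f (a * t))"
    by (rule I_eq[OF LC_scale[OF assms]])
  also have "\<dots> = vol (n - k) * (\<Sum>t\<in>T n m. f t)"
    using sum_T_scale[OF LC_le[OF assms(1)] assms(2), of f] LC_inv[OF assms(1)] by simp
  also have "\<dots> = vol (- k) * I f"
    using vol_add[of "- k" n] by (simp add: I_eq[OF assms(1)] algebra_simps)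
  finally show ?thesis .
qed

text \<open>Fubini. The levels in each variable are uniform in the other one, so both sides are the
  same finite double sum.\<close>

lemma I_swap:
  assumes "m \<le> n" "m' \<le> n'"
    and "\<And>x. LC n' m' (f x)" "\<And>y. LC n m (\<lambda>x. f x y)"
  shows "I (\<lambda>x. I (f x)) = I (\<lambda>y. I (\<lambda>x. f x y))"
proof -
  have "LC n m (\<lambda>x. I (f x))"
    unfolding LC_def using assms LC_inv[OF assms(4)] LC_outside[OF assms(4)]
    by (simp add: I_eq[OF assms(3)])
  moreover have "LC n' m' (\<lambda>y. I (\<lambda>x. f x y))"
    unfolding LC_def using assms LC_inv[OF assms(3)] LC_outside[OF assms(3)]
    by (simp add: I_eq[OF assms(4)])
  ultimately have "I (\<lambda>x. I (f x)) = vol n * (\<Sum>s\<in>T n m. vol n' * (\<Sum>t\<in>T n' m'. f s t))"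
    "I (\<lambda>y. I (\<lambda>x. f x y)) = vol n' * (\<Sum>t\<in>T n' m'. vol n * (\<Sum>s\<in>T n m. f s t))"
    by (simp_all add: I_eq[OF assms(3)] I_eq[OF assms(4)] I_eq[where n = n and m = m]
        I_eq[where n = n' and m = m'])
  then show ?thesis
    by (simp add: sum_distrib_left mult_ac) (rule sum.swap)
qed

section \<open>Volumes of balls and orthogonality of characters\<close>

lemma sum_T_1:
  assumes "m \<le> n"
  shows "vol n * of_nat (card (T n m)) = vol m"
proof -
  have "vol n * (\<Sum>t\<in>T n m. if t \<in> B m then 1 else 0)
      = vol m * (\<Sum>t\<in>T m m. if t \<in> B m then 1 else 0)"
    by (rule sum_T_refine_LC[OF LC_ball assms]) simp
  \<comment> \<open>\<open>T m m\<close> consists of one representative of \<open>B m\<close>, which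
    need not be 0.\<close>
  moreover have "rep m 0 \<in> B m" using rep_diff'[of m 0] by simp
  ultimately show ?thesis
    using T_in_B[OF assms] by (simp add: T_same if_distrib cong: if_cong)
qed

lemma I_ball: "I (\<lambda>x. if x \<in> B m then 1 else 0) = vol m"
  using rep_diff'[of m 0] by (simp add: I_eq[OF LC_ball[OF order_refl]] T_same)

text \<open>Translation by \<open>h\<close> preserves the sum and multiplies it by
  \<open>chi (y * h)\<close>, which is not 1.\<close>

lemma sum_T_chi_0:
  assumes "m \<le> n" "\<And>x. x \<in> B n \<Longrightarrow> chi (y * x) = 1" "h \<in> B m" "chi (y * h) \<noteq> 1"
  shows "(\<Sum>t\<in>T n m. chi (y * t)) = 0"
proof -
  have "(\<Sum>t\<in>T n m. chi (y * (t + h))) = (\<Sum>t\<in>T n m. chi (y * t))"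
  proof (rule sum_T_translate[OF assms(1,3)])
    fix x z assume "x - z \<in> B n"
    then have "chi (y * (x - z)) = 1" by (rule assms(2))
    then show "chi (y * x) = chi (y * z)" using chi_add[of "y * (x - z)" "y * z"]
      by (simp flip: distrib_left)
  qed
  also have "(\<Sum>t\<in>T n m. chi (y * (t + h))) = (\<Sum>t\<in>T n m. chi (y * t)) * chi (y * h)"
    unfolding sum_distrib_right by (simp only: distrib_left chi_add)
  finally show ?thesis using assms(4) by simp
qed

text \<open>The Fourier transform of the indicator of a ball is a multiple of the indicator of the
  dual ball.\<close>

lemma I_ball_chi:
  "I (\<lambda>x. if x \<in> B m then chi (y * x) else 0) = (if y \<in> B (c - m) then vol m else 0)"
proof (cases "y \<in> B (c - m)")
  case True
  have "chi (y * x) = 1" if "x \<in> B m" for x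
    using B_mult[OF True that] by (intro chi_triv) simp
  then have "(\<lambda>x. if x \<in> B m then chi (y * x) else 0) = (\<lambda>x. if x \<in> B m then 1 else 0)"
    by auto
  then show ?thesis using True by (simp add: I_ball)
next
  case False
  obtain k where k: "y \<in> B k" using ex_B by blast
  \<comment> \<open>A level at which the character with frequency \<open>y\<close> has become
    trivial.\<close>
  define n where "n = max m (c - k)"
  have n: "m \<le> n" by (simp add: n_def)
  have tr: "chi (y * x) = 1" if "x \<in> B n" for x
    using B_mono[OF _ B_mult[OF k that], of c] by (intro chi_triv) (simp add: n_def)
  obtain h where "h \<in> B m" "chi (y * h) \<noteq> 1" using ex_chi_nontriv[OF False] by blast
  then have s: "(\<Sum>t\<in>T n m. chi (y * t)) = 0" using sum_T_chi_0[OF n tr] by blast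
  have "LC n m (\<lambda>x. if x \<in> B m then chi (y * x) else 0)"
  proof (rule LC_restrict[OF n])
    fix x z assume "x - z \<in> B n"
    then have "chi (y * (x - z)) = 1" by (rule tr)
    then show "chi (y * x) = chi (y * z)" using chi_add[of "y * (x - z)" "y * z"]
      by (simp flip: distrib_left)
  qed
  then have "I (\<lambda>x. if x \<in> B m then chi (y * x) else 0) = vol n * (\<Sum>t\<in>T n m. chi (y * t))"
    by (simp add: I_eq T_in_B[OF n] cong: sum.cong)
  then show ?thesis using False s by simp
qed

end

section \<open>The norm form of the unramified quadratic extension\<close>

context uniformized
begin

lemma O_mult: "x \<in> B 0 \<Longrightarrow> y \<in> B 0 \<Longrightarrow> x * y \<in> B 0"
  using B_mult[of x 0 y 0] by simp

lemma P_mult: "x \<in> B 1 \<Longrightarrow> y \<in> B 0 \<Longrightarrow> x * y \<in> B 1" "x \<in> B 0 \<Longrightarrow> y \<in> B 1 \<Longrightarrow> x * y \<in> B 1"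
  using B_mult[of x 1 y 0] B_mult[of x 0 y 1] by simp_all

lemma P_in_O: "x \<in> B 1 \<Longrightarrow> x \<in> B 0"
  by (rule B_mono[of 0 1]) auto

lemma numeral_in_O [simp]: "numeral k \<in> B 0"
proof -
  have "of_nat n \<in> B 0" for n
    by (induction n) (auto intro: B_add)
  from this[of "numeral k"] show ?thesis by simp
qed

lemma one_notin_P [simp]: "1 \<notin> B 1"
  using pi_lt by (simp add: B_def)

lemma P_prime:
  assumes "x * y \<in> B 1" "x \<in> B 0" "x \<notin> B 1"
  shows "y \<in> B 1"
proof -
  have "x \<noteq> 0" using assms(3) by auto
  then show ?thesis
    using P_mult(2)[OF B_inverse_unit[OF assms(2,3)] assms(1)] by (simp flip: mult.assoc)
qed

text \<open>The map \<open>t \<mapsto> t^2 + t\<close> takes equal values at 0 and -1, so it is not onto on the finite residue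
  field, whatever the residue characteristic.\<close>

lemma ex_irreducible: "\<exists>d\<in>B 0. \<forall>t\<in>B 0. t\<^sup>2 + t - d \<notin> B 1"
proof (rule ccontr)
  assume "\<not> ?thesis"
  then have *: "\<exists>t\<in>B 0. t\<^sup>2 + t - d \<in> B 1" if "d \<in> B 0" for d using that by blast
  define g where "g t = rep 1 (t\<^sup>2 + t)" for t
  have g_cong: "g s = g t" if "s - t \<in> B 1" "s \<in> B 0" "t \<in> B 0" for s t
  proof -
    have "(s\<^sup>2 + s) - (t\<^sup>2 + t) = (s - t) * (s + t + 1)"
      by (simp add: power2_eq_square algebra_simps)
    moreover have "s + t + 1 \<in> B 0" using that by (intro B_add) auto
    ultimately show ?thesis unfolding g_def rep_eq_iff using P_mult(1)[OF that(1)] by simp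
  qed
  have rO: "rep 1 t \<in> B 0" if "t \<in> B 0" for t using T_in_B[of 0 1] rep_in_T[OF that] by simp
  have "T 1 0 \<subseteq> g ` T 1 0"
  proof
    fix d assume d: "d \<in> T 1 0"
    then have "d \<in> B 0" using T_in_B[of 0 1] by simp
    then obtain t where t: "t \<in> B 0" "t\<^sup>2 + t - d \<in> B 1" using * by blast
    then have "g t = rep 1 d" by (simp add: g_def rep_eq_iff)
    then have "g (rep 1 t) = d" using g_cong[OF rep_diff' rO t(1)] t(1) rep_T[OF d] by simp
    then show "d \<in> g ` T 1 0" using rep_in_T[OF t(1)] by blast
  qed
  moreover have "g ` T 1 0 \<subseteq> T 1 0"
  proof
    fix x assume "x \<in> g ` T 1 0"
    then obtain t where "t \<in> T 1 0" "x = g t" by blast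
    moreover from this have "t \<in> B 0" using T_in_B[of 0 1] by simp
    then have "t\<^sup>2 + t \<in> B 0" by (auto simp: power2_eq_square intro: B_add O_mult)
    ultimately show "x \<in> T 1 0" by (auto simp: g_def rep_in_T)
  qed
  ultimately have "inj_on g (T 1 0)"
    by (intro eq_card_imp_inj_on) auto
  moreover have "g (rep 1 0) = g (rep 1 (- 1))"
  proof -
    have "g (rep 1 0) = g 0" by (rule g_cong[OF rep_diff' rO]) simp_all
    moreover have "g (rep 1 (- 1)) = g (- 1)" by (rule g_cong[OF rep_diff' rO]) simp_all
    ultimately show ?thesis by (simp add: g_def)
  qed
  ultimately have "rep 1 0 = rep 1 (- 1 :: 'f)"
    by (meson B_0 B_minus inj_onD one_in_B rep_in_T)
  then show False by (simp add: rep_eq_iff)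
qed

text \<open>Suppose that \<open>1 + 4 * d\<close> lies in the maximal ideal. If 2 does so too, then
  so does 1; otherwise \<open>-1/2\<close> is a root of \<open>t^2 + t - d\<close> modulo the
  maximal ideal, since the value there is \<open>-(1 + 4 * d) / 4\<close>.\<close>

lemma discriminant_unit:
  assumes "d \<in> B 0" "\<forall>t\<in>B 0. t\<^sup>2 + t - d \<notin> B 1"
  shows "1 + 4 * d \<in> B 0" "1 + 4 * d \<notin> B 1"
proof -
  show "1 + 4 * d \<in> B 0" using assms(1) by (intro B_add O_mult) auto
  show "1 + 4 * d \<notin> B 1"
  proof
    assume P: "1 + 4 * d \<in> B 1"
    show False
    proof (cases "(2 :: 'f) \<in> B 1")
      case True
      have "(2 :: 'f) * (2 * d) \<in> B 1" using assms(1) by (intro P_mult(1)[OF True] O_mult) auto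
      then have "4 * d \<in> B 1" by (simp flip: mult.assoc)
      then show False using P B_add_iff[of "4 * d" 1 1] by simp
    next
      case False
      then have n2: "(2 :: 'f) \<noteq> 0" by auto
      have i2: "inverse (2 :: 'f) \<in> B 0" by (rule B_inverse_unit) (use False in auto)
      define t :: 'f where "t = - inverse 2"
      have "t\<^sup>2 + t - d = (1 + 4 * d) * (- (inverse 2 * inverse 2))"
      proof -
        have "(- i)\<^sup>2 + - i - d = (1 + 4 * d) * - (i * i)" if "2 * i = 1" for i
        proof -
          have "(- i)\<^sup>2 + - i - d - (1 + 4 * d) * - (i * i)
              = i * (2 * i) - i + (d * ((2 * i) * (2 * i)) - d)"
            by (simp add: power2_eq_square algebra_simps)
          also have "\<dots> = 0" using that by simp
          finally show ?thesis by (simp only: right_minus_eq)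
        qed
        then show ?thesis unfolding t_def using n2 by simp
      qed
      also have "\<dots> \<in> B 1" using O_mult[OF i2 i2] by (intro P_mult(1)[OF P]) (simp only: B_minus)
      finally have "t\<^sup>2 + t - d \<in> B 1" .
      moreover have "t \<in> B 0" using i2 by (simp only: t_def B_minus)
      ultimately show False using assms(2) by blast
    qed
  qed
qed

text \<open>A point of the conic is joined to \<open>(1, 0)\<close> by the line of direction \<open>(t, 1)\<close>.\<close>

lemma card_conic:
  assumes d: "d \<in> B 0" "\<forall>t\<in>B 0. t\<^sup>2 + t - d \<notin> B 1"
  shows "card {(x, y). x \<in> T 1 0 \<and> y \<in> T 1 0 \<and> x\<^sup>2 + x * y - d * y\<^sup>2 - 1 \<in> B 1} = q + 1"
proof -
  let ?T = "T 1 0"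
  let ?S = "{(x, y). x \<in> ?T \<and> y \<in> ?T \<and> x\<^sup>2 + x * y - d * y\<^sup>2 - 1 \<in> B 1}"
  \<comment> \<open>\<open>S0\<close> holds the points (1, 0) and (-1, 0), which coincide when 2 is
    in \<open>B 1\<close>. \<open>Z\<close> is the direction of the tangent at (1, 0), which meets
    the conic in no second point; it exists exactly when 2 is not in \<open>B 1\<close>, so the two
    exceptions balance.\<close>
  define S0 where "S0 = {(x, y) \<in> ?S. y \<in> B 1}"
  define S1 where "S1 = {(x, y) \<in> ?S. y \<notin> B 1}"
  define Z where "Z = {t \<in> ?T. 2 * t + 1 \<in> B 1}"
  have TO: "t \<in> B 0" if "t \<in> ?T" for t using T_in_B[of 0 1] that by simp
  have rO: "rep 1 t \<in> B 0" if "t \<in> B 0" for t using TO rep_in_T[OF that] by simp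
  have r0: "rep 1 0 \<in> B 1" using rep_diff'[of 1 0] by simp
  have S0_eq: "S0 = {rep 1 1, rep 1 (- 1)} \<times> {rep 1 0}"
  proof -
    have "x\<^sup>2 + x * y - d * y\<^sup>2 - 1 \<in> B 1 \<longleftrightarrow> x = rep 1 1 \<or> x = rep 1 (- 1)"
      if x: "x \<in> ?T" and y: "y \<in> B 1" for x y
    proof -
      have "x * y - d * y * y \<in> B 1"
        using y P_in_O[OF y] TO[OF x] d by (intro B_diff P_mult(2) O_mult)
      then have "x\<^sup>2 + x * y - d * y\<^sup>2 - 1 \<in> B 1 \<longleftrightarrow> (x - 1) * (x + 1) \<in> B 1"
        using B_add_iff[of "x * y - d * y * y" 1 "(x - 1) * (x + 1)"]
        by (simp add: power2_eq_square algebra_simps)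
      also have "\<dots> \<longleftrightarrow> x - 1 \<in> B 1 \<or> x + 1 \<in> B 1"
      proof
        assume *: "(x - 1) * (x + 1) \<in> B 1"
        have "x - 1 \<in> B 0" using TO[OF x] by (intro B_diff) auto
        then show "x - 1 \<in> B 1 \<or> x + 1 \<in> B 1" using P_prime[OF *] by blast
      next
        have "x - 1 \<in> B 0" "x + 1 \<in> B 0" using TO[OF x] by (auto intro: B_diff B_add)
        then show "x - 1 \<in> B 1 \<or> x + 1 \<in> B 1 \<Longrightarrow> (x - 1) * (x + 1) \<in> B 1"
          using P_mult by blast
      qed
      also have "\<dots> \<longleftrightarrow> rep 1 x = rep 1 1 \<or> rep 1 x = rep 1 (- 1)"
        by (simp add: rep_eq_iff)
      finally show ?thesis using rep_T[OF x] by simp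
    qed
    moreover have "y = rep 1 0 \<longleftrightarrow> y \<in> B 1" if "y \<in> ?T" for y
      using rep_T[OF that] rep_eq_iff[of 1 y 0] by auto
    moreover have "rep 1 1 \<in> ?T" "rep 1 (- 1) \<in> ?T" "rep 1 0 \<in> ?T" by (auto intro: rep_in_T)
    ultimately show ?thesis unfolding S0_def by (auto simp del: rep_rep)
  qed
  have card_S0: "card S0 = (if (2 :: 'f) \<in> B 1 then 1 else 2)"
    unfolding S0_eq by (auto simp: card_insert_if rep_eq_iff)
  have card_Z: "card Z = (if (2 :: 'f) \<in> B 1 then 0 else 1)"
  proof (cases "(2 :: 'f) \<in> B 1")
    case True
    have "2 * t + 1 \<notin> B 1" if "t \<in> ?T" for t
      using B_add_iff[of "2 * t" 1 1] P_mult(1)[OF True TO[OF that]] by (simp add: add.commute)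
    then have "Z = {}" by (auto simp: Z_def)
    then show ?thesis using True by simp
  next
    case False
    then have n2: "(2 :: 'f) \<noteq> 0" by auto
    have i2: "inverse (2 :: 'f) \<in> B 0" by (rule B_inverse_unit) (use False in auto)
    let ?h = "- inverse (2 :: 'f)"
    have hO: "?h \<in> B 0" using i2 by simp
    have "2 * t + 1 \<in> B 1 \<longleftrightarrow> t - ?h \<in> B 1" for t
    proof -
      have e: "2 * t + 1 = 2 * (t - ?h)" using n2 by (simp add: algebra_simps)
      show ?thesis unfolding e using P_prime[of 2 "t - ?h"] False P_mult(2)[of 2 "t - ?h"] by auto
    qed
    also have "t - ?h \<in> B 1 \<longleftrightarrow> rep 1 t = rep 1 ?h" for t by (simp only: rep_eq_iff)
    finally have *: "2 * t + 1 \<in> B 1 \<longleftrightarrow> rep 1 t = rep 1 ?h" for t .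
    have "Z = {rep 1 ?h}"
    proof (intro equalityI subsetI)
      fix t assume "t \<in> Z"
      then show "t \<in> {rep 1 ?h}" using * rep_T[of t] unfolding Z_def by auto
    next
      fix t assume "t \<in> {rep 1 ?h}"
      then show "t \<in> Z" unfolding Z_def using rep_in_T[OF hO, of 1] * by auto
    qed
    then show ?thesis using False by simp
  qed
  have "bij_betw (\<lambda>(x, y). rep 1 ((x - 1) / y)) S1 (?T - Z)"
  proof -
    \<comment> \<open>The equation of the conic divided by \<open>y\<close>, written in the slope
      \<open>(x - 1) / y\<close>.\<close>
    have main: "(x - 1) / y \<in> B 0" "2 * ((x - 1) / y) + 1 + y * (((x - 1) / y)\<^sup>2 + (x - 1) / y - d) \<in> B 1"
      "y \<in> B 0" "inverse y \<in> B 0" "y \<noteq> 0" if "(x, y) \<in> S1" for x y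
    proof -
      have xy: "x \<in> B 0" "y \<in> B 0" "y \<notin> B 1" "x\<^sup>2 + x * y - d * y\<^sup>2 - 1 \<in> B 1"
        using that TO by (auto simp: S1_def)
      show y0: "y \<noteq> 0" using xy by auto
      show "y \<in> B 0" by fact
      show iy: "inverse y \<in> B 0" using B_inverse_unit xy by blast
      show "(x - 1) / y \<in> B 0" unfolding divide_inverse using xy iy by (intro O_mult B_diff) auto
      have "2 * ((x - 1) / y) + 1 + y * (((x - 1) / y)\<^sup>2 + (x - 1) / y - d)
          = (x\<^sup>2 + x * y - d * y\<^sup>2 - 1) * inverse y"
        using y0 by (simp add: field_simps power2_eq_square)
      then show "2 * ((x - 1) / y) + 1 + y * (((x - 1) / y)\<^sup>2 + (x - 1) / y - d) \<in> B 1"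
        using P_mult(1)[OF xy(4) iy] by simp
    qed
    \<comment> \<open>The divided equation depends on the slope only modulo the maximal ideal, so
      the slope may be replaced by its representative.\<close>
    have move: "2 * t + 1 + y * (t\<^sup>2 + t - d) \<in> B 1"
      if "2 * s + 1 + y * (s\<^sup>2 + s - d) \<in> B 1" "t - s \<in> B 1" "s \<in> B 0" "t \<in> B 0" "y \<in> B 0" for s t y
    proof -
      have "(t - s) * (2 + y * (s + t + 1)) \<in> B 1"
        using that by (intro P_mult(1) B_add O_mult) auto
      from B_add[OF that(1) this] show ?thesis by (simp add: power2_eq_square algebra_simps)
    qed
    show ?thesis
    proof (rule bij_betwI')
      fix p p' assume p: "p \<in> S1" "p' \<in> S1"
      obtain x y x' y' where pp: "p = (x, y)" "p' = (x', y')" by fastforce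
      note m = main[OF p(1)[unfolded pp]] and m' = main[OF p(2)[unfolded pp]]
      let ?t = "(x - 1) / y" and ?t' = "(x' - 1) / y'"
      have "p = p'" if "rep 1 ?t = rep 1 ?t'"
      proof -
        have tt: "?t - ?t' \<in> B 1" using that by (simp only: rep_eq_iff)
        have "2 * ?t + 1 + y' * (?t\<^sup>2 + ?t - d) \<in> B 1"
          by (rule move[OF m'(2) tt m'(1) m(1) m'(3)])
        note tmove = this
        have "2 * s + 1 + y * N - (2 * s + 1 + y' * N) = N * (y - y')" for s N
          by (simp add: algebra_simps)
        with B_diff[OF m(2) tmove] have "(?t\<^sup>2 + ?t - d) * (y - y') \<in> B 1"
          by (simp only:)
        moreover have "?t\<^sup>2 + ?t - d \<in> B 0"
          using m(1) d(1) unfolding power2_eq_square by (intro B_diff B_add O_mult)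
        ultimately have yy: "y - y' \<in> B 1" using P_prime d(2) m(1) by blast
        have "t * (y - y') + (t - t') * y' = t * y - t' * y'" for t t'
          by (simp add: algebra_simps)
        moreover have "?t * y - ?t' * y' = x - x'" using m(5) m'(5) by simp
        ultimately have "x - x' = ?t * (y - y') + (?t - ?t') * y'" by (simp only:)
        also have "\<dots> \<in> B 1" using m m' tt yy by (intro B_add P_mult(1)[OF tt] P_mult(2)) auto
        finally show ?thesis using T_eq[of x 1 0 x' 0] T_eq[of y 1 0 y' 0] yy p pp
          by (auto simp: S1_def)
      qed
      then show "(case p of (x, y) \<Rightarrow> rep 1 ((x - 1) / y)) = (case p' of (x, y) \<Rightarrow> rep 1 ((x - 1) / y))
          \<longleftrightarrow> p = p'" using pp by auto
    next
      fix p assume p: "p \<in> S1"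
      obtain x y where pp: "p = (x, y)" by fastforce
      note m = main[OF p[unfolded pp]]
      let ?t = "(x - 1) / y"
      have rt: "rep 1 ?t \<in> B 0" using rO m(1) by blast
      have "2 * rep 1 ?t + 1 \<notin> B 1"
      proof
        assume *: "2 * rep 1 ?t + 1 \<in> B 1"
        have "2 * rep 1 ?t + 1 + y * ((rep 1 ?t)\<^sup>2 + rep 1 ?t - d) \<in> B 1"
          by (rule move[OF m(2) _ m(1) rt m(3)]) simp
        from B_diff[OF this *] have "y * ((rep 1 ?t)\<^sup>2 + rep 1 ?t - d) \<in> B 1" by simp
        moreover have "y \<notin> B 1" using p pp by (auto simp: S1_def)
        ultimately show False using P_prime[OF _ m(3)] d(2) rt by blast
      qed
      then show "(case p of (x, y) \<Rightarrow> rep 1 ((x - 1) / y)) \<in> ?T - Z"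
        using rep_in_T[OF m(1)] pp by (auto simp: Z_def)
    next
      fix t assume t: "t \<in> ?T - Z"
      then have tO: "t \<in> B 0" and t2: "2 * t + 1 \<notin> B 1" using TO by (auto simp: Z_def)
      let ?N = "t\<^sup>2 + t - d"
      have NO: "?N \<in> B 0" using tO d(1) unfolding power2_eq_square by (intro B_diff B_add O_mult)
      have NP: "?N \<notin> B 1" using d(2) tO by blast
      have iN: "inverse ?N \<in> B 0" using B_inverse_unit[OF NO NP] .
      have N0: "?N \<noteq> 0" using NP by (metis B_0)
      \<comment> \<open>On the line \<open>(1 + l * t, l)\<close> the equation of the conic is
        \<open>l * (2 * t + 1 + l * ?N)\<close>, and this is its second root. It is a unit because
        \<open>t\<close> is not the tangent direction.\<close>
      define l where "l = - (2 * t + 1) * inverse ?N"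
      have lO: "l \<in> B 0" unfolding l_def using tO iN by (intro O_mult) (auto intro!: B_diff O_mult)
      have lN: "l * ?N = - (2 * t + 1)" unfolding l_def using N0 by (simp add: mult.assoc)
      have lP: "l \<notin> B 1"
      proof
        assume "l \<in> B 1"
        from P_mult(1)[OF this NO] have "- (2 * t + 1) \<in> B 1" by (simp only: lN)
        then show False using t2 by (simp only: B_minus)
      qed
      have xO: "1 + l * t \<in> B 0" using lO tO by (intro B_add O_mult) auto
      define x y where "x = rep 1 (1 + l * t)" and "y = rep 1 l"
      have xd: "x - (1 + l * t) \<in> B 1" and yd: "y - l \<in> B 1" by (simp_all add: x_def y_def)
      have xy: "x \<in> ?T" "y \<in> ?T" using rep_in_T xO lO by (auto simp: x_def y_def)
      note xyO = TO[OF xy(1)] TO[OF xy(2)]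
      have yP: "y \<notin> B 1" using yd lP B_add_iff[of "y - l" 1 l] by simp
      \<comment> \<open>An expansion around the point \<open>(1 + l * t, l)\<close>, where the
        equation holds exactly: by \<open>lN\<close> the last summand vanishes.\<close>
      have "x\<^sup>2 + x * y - d * y\<^sup>2 - 1 = (x - (1 + l * t)) * (x + (1 + l * t)) + (x - (1 + l * t)) * y
          + (y - l) * (1 + l * t - d * (y + l)) + l * (2 * t + 1 + l * ?N)"
        by (simp add: power2_eq_square algebra_simps)
      also have "\<dots> \<in> B 1"
        unfolding lN using xyO xO lO tO d(1) xd yd by (intro B_add P_mult(1)[OF xd] P_mult(1)[OF yd] B_diff O_mult) auto
      finally have "(x, y) \<in> S1" using xy yP by (simp add: S1_def)
      moreover have "t = rep 1 ((x - 1) / y)"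
      proof -
        have y0: "y \<noteq> 0" using yP by auto
        have iy: "inverse y \<in> B 0" using B_inverse_unit xyO(2) yP by blast
        have "t - (x - 1) / y = ((y - l) * t - (x - (1 + l * t))) * inverse y"
          using y0 by (simp add: field_simps)
        also have "\<dots> \<in> B 1" by (intro P_mult(1) B_diff P_mult(1)[OF yd] tO xd iy)
        finally show ?thesis using rep_T[of t] t by (metis DiffD1 rep_eq_iff)
      qed
      ultimately show "\<exists>p\<in>S1. t = (case p of (x, y) \<Rightarrow> rep 1 ((x - 1) / y))" by force
    qed
  qed
  then have "card S1 = card (?T - Z)" by (rule bij_betw_same_card)
  moreover have Zs: "Z \<subseteq> ?T" by (auto simp: Z_def)
  then have "card (?T - Z) = q - card Z" unfolding q_def by (intro card_Diff_subset) (auto intro: finite_subset)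
  moreover have "card Z \<le> q" unfolding q_def by (rule card_mono[OF _ Zs]) simp
  moreover have "card ?S = card S0 + card S1"
  proof -
    have "finite ?S" by (rule finite_subset[of _ "?T \<times> ?T"]) auto
    then have "finite S0" "finite S1" unfolding S0_def S1_def by (auto intro: rev_finite_subset)
    moreover have "?S = S0 \<union> S1" "S0 \<inter> S1 = {}" by (auto simp: S0_def S1_def)
    ultimately show ?thesis by (simp add: card_Un_disjoint)
  qed
  ultimately show ?thesis using card_S0 card_Z by (auto split: if_splits)
qed

end

section \<open>Gauss integrals are not multiplicative\<close>

context local_char
begin

text \<open>The integral over all of F does not converge and is truncated to \<open>B M\<close>. For
  nonzero \<open>e\<close> the value is eventually independent of \<open>M\<close>, see
  \<open>gauss_eventually_G\<close>.\<close>

definition gauss :: "int \<Rightarrow> 'f \<Rightarrow> 'r" where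
  "gauss M e = I (\<lambda>s. if s \<in> B M then chi (e * s\<^sup>2) else 0)"

lemma chi_eq_1_imp_eq:
  assumes "chi (x - y) = 1" shows "chi x = chi y"
  using chi_add[of "x - y" y] assms by simp

text \<open>Averaging over the translations by \<open>B j\<close> cancels the terms with \<open>l x\<close> outside \<open>B 0\<close>.\<close>

lemma sum_T_average:
  assumes mn: "m \<le> j" "j \<le> n" and a: "absv a = absv \<pi> powi (c - j)"
    and f_inv: "\<And>x y. x \<in> B m \<Longrightarrow> y \<in> B m \<Longrightarrow> x - y \<in> B n \<Longrightarrow> f x = f y"
    and f_shift: "\<And>x h. x \<in> B m \<Longrightarrow> h \<in> B j \<Longrightarrow> f (x + h) = f x * chi (a * l x * h)"
    and l: "\<And>x. x \<in> B m \<Longrightarrow> a * l x \<in> B (c - n)"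
  shows "(\<Sum>x\<in>T n m. f x) = (\<Sum>x\<in>T n m. if l x \<in> B 0 then f x else 0)"
proof -
  have mn': "m \<le> n" using mn by simp
  let ?N = "of_nat (card (T n j)) :: 'r"
  have "(\<Sum>x\<in>T n m. f (x + h)) = (\<Sum>x\<in>T n m. f x)" if "h \<in> T n j" for h
    using B_mono[OF mn(1) T_in_B[OF mn(2) that]] by (intro sum_T_translate mn' f_inv)
  then have "?N * (\<Sum>x\<in>T n m. f x) = (\<Sum>h\<in>T n j. \<Sum>x\<in>T n m. f (x + h))"
    by simp
  also have "\<dots> = (\<Sum>h\<in>T n j. \<Sum>x\<in>T n m. f x * chi (a * l x * h))"
    by (intro sum.cong refl f_shift) (auto intro: T_in_B[OF mn'] T_in_B[OF mn(2)])
  also have "\<dots> = (\<Sum>x\<in>T n m. f x * (\<Sum>h\<in>T n j. chi (a * l x * h)))"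
    by (subst sum.swap) (simp add: sum_distrib_left)
  also have "\<dots> = (\<Sum>x\<in>T n m. ?N * (if l x \<in> B 0 then f x else 0))"
  proof (rule sum.cong)
    fix x assume x: "x \<in> T n m"
    then have xB: "x \<in> B m" by (rule T_in_B[OF mn'])
    have iff: "a * l x \<in> B (c - j) \<longleftrightarrow> l x \<in> B 0" using B_scale[OF a, of "l x" "c - j"] by simp
    show "f x * (\<Sum>h\<in>T n j. chi (a * l x * h)) = ?N * (if l x \<in> B 0 then f x else 0)"
    proof (cases "l x \<in> B 0")
      case True
      have "chi (a * l x * h) = 1" if "h \<in> T n j" for h
        using B_mult[OF _ T_in_B[OF mn(2) that], of "a * l x" "c - j"] iff True
        by (intro chi_triv) simp
      then show ?thesis using True by simp
    next
      case False
      then obtain h where h: "h \<in> B j" "chi (a * l x * h) \<noteq> 1" using ex_chi_nontriv iff by blast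
      have "chi (a * l x * h) = 1" if "h \<in> B n" for h
        using B_mult[OF l[OF xB] that] by (intro chi_triv) simp
      then show ?thesis using False sum_T_chi_0[OF mn(2) _ h] by simp
    qed
  qed simp
  also have "\<dots> = ?N * (\<Sum>x\<in>T n m. if l x \<in> B 0 then f x else 0)"
    by (simp add: sum_distrib_left)
  finally have "?N * (\<Sum>x\<in>T n m. f x) = ?N * (\<Sum>x\<in>T n m. if l x \<in> B 0 then f x else 0)" .
  \<comment> \<open>Averaging has multiplied both sides by the number of cosets. It cancels because
    it is a quotient of volumes and so nonzero in R.\<close>
  moreover have "?N \<noteq> 0" using sum_T_1[OF mn(2)] vol_nz[of j] by (metis mult_zero_right)
  ultimately show ?thesis by simp
qed

lemma gauss_eq_sum:
  assumes "M \<le> n" "\<And>x y. x - y \<in> B n \<Longrightarrow> x \<in> B M \<Longrightarrow> y \<in> B M \<Longrightarrow> chi (e * x\<^sup>2) = chi (e * y\<^sup>2)"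
  shows "gauss M e = vol n * (\<Sum>x\<in>T n M. chi (e * x\<^sup>2))"
proof -
  have "LC n M (\<lambda>s. if s \<in> B M then chi (e * s\<^sup>2) else 0)"
    by (rule LC_restrict[OF assms])
  then show ?thesis using T_in_B[OF assms(1)] by (simp add: gauss_def I_eq cong: sum.cong)
qed

text \<open>The cross term \<open>x y\<close> appears after translating \<open>x\<close> by \<open>y / 2\<close> in the first integral, which needs
  the ball \<open>B M'\<close> to be large compared to \<open>B M\<close>.\<close>

lemma gauss_product:
  assumes d: "d \<in> B 0" "\<forall>t\<in>B 0. t\<^sup>2 + t - d \<notin> B 1" and n2: "(2 :: 'f) \<noteq> 0"
    and j: "j = 0 \<or> j = 1" and a: "absv a = absv \<pi> powi (c - j)"
  shows "\<exists>M1. \<forall>M\<le>M1. \<exists>M2. \<forall>M'\<le>M2. gauss M' a * gauss M (- a * (1 + 4 * d) / 4)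
    = vol 1 * vol 1 * (\<Sum>y\<in>T 1 0. \<Sum>x\<in>T 1 0. chi (a * (x\<^sup>2 + x * y - d * y\<^sup>2)))"
proof (rule exI[of _ 0], intro allI impI)
  fix M :: int assume M: "M \<le> 0"
  have n4: "(4 :: 'f) \<noteq> 0" using n2 by (metis mult_eq_0_iff numeral_Bit0 mult_2)
  obtain w where w: "absv (2 :: 'f) = absv \<pi> powi w" using ex_val[OF n2] by blast
  define b where "b = 1 + 4 * d"
  obtain k where k: "b / 4 \<in> B k" using ex_B by blast
  define Q where "Q x y = x\<^sup>2 + x * y - d * y\<^sup>2" for x y
  have aB: "a \<in> B (c - j)" using a by (simp add: B_def)
  show "\<exists>M2. \<forall>M'\<le>M2. gauss M' a * gauss M (- a * (1 + 4 * d) / 4)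
    = vol 1 * vol 1 * (\<Sum>y\<in>T 1 0. \<Sum>x\<in>T 1 0. chi (a * (x\<^sup>2 + x * y - d * y\<^sup>2)))"
  \<comment> \<open>Halving lowers the index by the valuation \<open>w\<close> of 2, which is
    positive in residue characteristic 2; the bound \<open>M - w\<close> keeps \<open>y / 2\<close>
    inside \<open>B M'\<close>.\<close>
  proof (rule exI[of _ "min M (M - w)"], intro allI impI)
    fix M' assume M': "M' \<le> min M (M - w)"
    \<comment> \<open>So fine that products of \<open>B n\<close> with \<open>B M'\<close>, and
      those of \<open>B n\<close> with \<open>B M\<close> and \<open>b / 4\<close>, fall into
      \<open>B j\<close>, where multiplication by \<open>a\<close> gives trivial character
      values.\<close>
    define n where "n = Max {j - M', j - M - k, 1}"
    have n: "j - M' \<le> n" "j - M - k \<le> n" "1 \<le> n" "M \<le> n" "M' \<le> n" "0 \<le> n" "j \<le> n"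
      using M M' j by (auto simp: n_def)
    have triv: "chi (a * z) = 1" if "z \<in> B j" for z
      using B_mult[OF aB that] by (intro chi_triv) simp
    have MM: "x \<in> B M'" if "x \<in> B M" for x by (rule B_mono[OF _ that]) (use M' in simp)
    have OM: "x \<in> B M" if "x \<in> B 0" for x by (rule B_mono[OF M that])
    have prod_in: "z * v \<in> B j" if "z \<in> B n" "v \<in> B M'" for z v
      using B_mult[OF that] by (rule B_mono[rotated]) (use n in simp)
    have dv: "d * v \<in> B i" if "v \<in> B i" for v i using B_mult[OF d(1) that] by simp
    have g1: "gauss M' a = vol n * (\<Sum>x\<in>T n M'. chi (a * x\<^sup>2))"
    proof (rule gauss_eq_sum[OF n(5)], rule chi_eq_1_imp_eq)
      fix x y assume *: "x - y \<in> B n" "x \<in> B M'" "y \<in> B M'"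
      have "a * x\<^sup>2 - a * y\<^sup>2 = a * ((x - y) * (x + y))" by (simp add: power2_eq_square algebra_simps)
      then show "chi (a * x\<^sup>2 - a * y\<^sup>2) = 1" using triv[OF prod_in[OF *(1) B_add[OF *(2,3)]]] by simp
    qed
    have g2: "gauss M (- a * b / 4) = vol n * (\<Sum>y\<in>T n M. chi (- a * b / 4 * y\<^sup>2))"
    proof (rule gauss_eq_sum[OF n(4)], rule chi_eq_1_imp_eq)
      fix x y assume *: "x - y \<in> B n" "x \<in> B M" "y \<in> B M"
      have "(x - y) * (x + y) * - (b / 4) \<in> B (n + M + k)"
        using k by (intro B_mult *(1) B_add[OF *(2,3)]) simp
      then have "(x - y) * (x + y) * - (b / 4) \<in> B j" by (rule B_mono[rotated]) (use n in simp)
      from triv[OF this] show "chi (- a * b / 4 * x\<^sup>2 - - a * b / 4 * y\<^sup>2) = 1"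
        by (simp add: power2_eq_square algebra_simps)
    qed
    have shift: "(\<Sum>x\<in>T n M'. chi (a * x\<^sup>2)) = (\<Sum>x\<in>T n M'. chi (a * (x + y / 2)\<^sup>2))"
      if y: "y \<in> B M" for y
    proof (rule sum_T_translate[symmetric, OF n(5)])
      have "y / 2 \<in> B (M - w)" using B_scale[OF w, of "y / 2" M] y n2 by simp
      then show "y / 2 \<in> B M'" by (rule B_mono[rotated]) (use M' in simp)
      fix x y assume *: "x \<in> B M'" "y \<in> B M'" "x - y \<in> B n"
      have "a * x\<^sup>2 - a * y\<^sup>2 = a * ((x - y) * (x + y))" by (simp add: power2_eq_square algebra_simps)
      then show "chi (a * x\<^sup>2) = chi (a * y\<^sup>2)"
        using triv[OF prod_in[OF *(3) B_add[OF *(1,2)]]] by (intro chi_eq_1_imp_eq) simp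
    qed
    have Qid: "a * (x + y / 2)\<^sup>2 + - a * b / 4 * y\<^sup>2 = a * Q x y" for x y
    proof -
      obtain h where h: "y = 2 * h" using n2 by (metis dvd_def dvd_field_iff)
      have "- a * b / 4 * y\<^sup>2 = - a * b * h\<^sup>2" using n4 by (simp add: h power2_eq_square)
      moreover have "y / 2 = h" using n2 by (simp add: h)
      ultimately show ?thesis by (simp add: Q_def b_def h power2_eq_square algebra_simps)
    qed
    have inv_x: "chi (a * Q x y) = chi (a * Q x' y)"
      if "x \<in> B M'" "x' \<in> B M'" "x - x' \<in> B n" "y \<in> B M'" for x x' y
    proof (rule chi_eq_1_imp_eq)
      have "a * Q x y - a * Q x' y = a * ((x - x') * (x + x' + y))"
        by (simp add: Q_def power2_eq_square algebra_simps)
      then show "chi (a * Q x y - a * Q x' y) = 1"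
        using triv[OF prod_in[OF that(3) B_add[OF B_add[OF that(1,2)] that(4)]]] by simp
    qed
    have inv_y: "chi (a * Q x y) = chi (a * Q x y')"
      if "y \<in> B M'" "y' \<in> B M'" "y - y' \<in> B n" "x \<in> B M'" for x y y'
    proof (rule chi_eq_1_imp_eq)
      have "a * Q x y - a * Q x y' = a * ((y - y') * (x - d * (y + y')))"
        by (simp add: Q_def power2_eq_square algebra_simps)
      then show "chi (a * Q x y - a * Q x y') = 1"
        using triv[OF prod_in[OF that(3) B_diff[OF that(4) dv[OF B_add[OF that(1,2)]]]]] by simp
    qed
    have sq: "h * h \<in> B j" if "h \<in> B j" for h
      using B_mult[OF that that] by (rule B_mono[rotated]) (use j in auto)
    have al: "a * z \<in> B (c - n)" if "z \<in> B M'" for z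
      using B_mult[OF aB that] by (rule B_mono[rotated]) (use n in simp)
    have two: "2 * z \<in> B i" if "z \<in> B i" for z i using B_mult[OF numeral_in_O that] by simp
    have "gauss M' a * gauss M (- a * b / 4)
        = vol n * vol n * (\<Sum>y\<in>T n M. \<Sum>x\<in>T n M'. chi (a * x\<^sup>2) * chi (- a * b / 4 * y\<^sup>2))"
      unfolding g1 g2 by (simp add: sum_distrib_left sum_distrib_right mult_ac)
    also have "(\<Sum>y\<in>T n M. \<Sum>x\<in>T n M'. chi (a * x\<^sup>2) * chi (- a * b / 4 * y\<^sup>2))
        = (\<Sum>y\<in>T n M. \<Sum>x\<in>T n M'. chi (a * Q x y))"
    proof (rule sum.cong)
      fix y assume "y \<in> T n M"
      then have y: "y \<in> B M" by (rule T_in_B[OF n(4)])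
      show "(\<Sum>x\<in>T n M'. chi (a * x\<^sup>2) * chi (- a * b / 4 * y\<^sup>2)) = (\<Sum>x\<in>T n M'. chi (a * Q x y))"
        unfolding sum_distrib_right[symmetric] shift[OF y]
        unfolding sum_distrib_right chi_add[symmetric] Qid ..
    qed simp
    \<comment> \<open>Stationary phase in \<open>x\<close>: a shift by \<open>h\<close> in
      \<open>B j\<close> changes \<open>Q\<close> by \<open>(2 * x + y) * h + h * h\<close>, and the
      square is harmless, so only points with integral partial derivative survive.\<close>
    also have "\<dots> = (\<Sum>y\<in>T n M. \<Sum>x\<in>T n M'. if 2 * x + y \<in> B 0 then chi (a * Q x y) else 0)"
    proof (rule sum.cong)
      fix y assume "y \<in> T n M"
      then have y: "y \<in> B M'" using T_in_B[OF n(4)] MM by blast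
      show "(\<Sum>x\<in>T n M'. chi (a * Q x y)) = (\<Sum>x\<in>T n M'. if 2 * x + y \<in> B 0 then chi (a * Q x y) else 0)"
      proof (rule sum_T_average[where l = "\<lambda>x. 2 * x + y", OF _ n(7) a])
        show "M' \<le> j" using M M' j by auto
        show "chi (a * Q x y) = chi (a * Q x' y)" if "x \<in> B M'" "x' \<in> B M'" "x - x' \<in> B n" for x x'
          by (rule inv_x[OF that y])
        show "a * (2 * x + y) \<in> B (c - n)" if "x \<in> B M'" for x
          by (intro al B_add two that y)
        show "chi (a * Q (x + h) y) = chi (a * Q x y) * chi (a * (2 * x + y) * h)" if "h \<in> B j" for x h
        proof -
          have "a * Q (x + h) y = a * Q x y + a * (2 * x + y) * h + a * (h * h)"
            by (simp add: Q_def power2_eq_square algebra_simps)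
          then show ?thesis using triv[OF sq[OF that]] by (simp add: chi_add)
        qed
      qed
    qed simp
    also have "\<dots> = (\<Sum>x\<in>T n M'. \<Sum>y\<in>T n M. if 2 * x + y \<in> B 0 then chi (a * Q x y) else 0)"
      by (rule sum.swap)
    \<comment> \<open>The same in \<open>y\<close>, where the partial derivative is
      \<open>x - 2 * d * y\<close>. The condition already imposed is unaffected by the shifts
      because \<open>B j\<close> lies in \<open>B 0\<close>.\<close>
    also have "\<dots> = (\<Sum>x\<in>T n M'. \<Sum>y\<in>T n M. if x - 2 * d * y \<in> B 0
        then if 2 * x + y \<in> B 0 then chi (a * Q x y) else 0 else 0)"
    proof (rule sum.cong)
      fix x assume "x \<in> T n M'"
      then have x: "x \<in> B M'" by (rule T_in_B[OF n(5)])
      have lin: "2 * x + y' \<in> B 0 \<longleftrightarrow> 2 * x + y \<in> B 0" if "y' - y \<in> B 0" for y y'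
        using B_add_iff[OF that, of "2 * x + y"] by simp
      show "(\<Sum>y\<in>T n M. if 2 * x + y \<in> B 0 then chi (a * Q x y) else 0)
        = (\<Sum>y\<in>T n M. if x - 2 * d * y \<in> B 0
        then if 2 * x + y \<in> B 0 then chi (a * Q x y) else 0 else 0)"
      proof (rule sum_T_average[where l = "\<lambda>y. x - 2 * d * y", OF _ n(7) a])
        show "M \<le> j" using M j by auto
        show "(if 2 * x + y \<in> B 0 then chi (a * Q x y) else 0)
            = (if 2 * x + y' \<in> B 0 then chi (a * Q x y') else 0)"
          if "y \<in> B M" "y' \<in> B M" "y - y' \<in> B n" for y y'
          using inv_y[OF MM MM _ x, of y y'] lin[of y y'] that B_mono[OF n(6) that(3)] by simp
        show "a * (x - 2 * d * y) \<in> B (c - n)" if "y \<in> B M" for y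
          using two[OF dv[OF MM[OF that]]] by (intro al B_diff x) (simp add: mult.assoc)
        show "(if 2 * x + (y + h) \<in> B 0 then chi (a * Q x (y + h)) else 0)
          = (if 2 * x + y \<in> B 0 then chi (a * Q x y) else 0) * chi (a * (x - 2 * d * y) * h)"
          if h: "h \<in> B j" for y h
        proof -
          have "h \<in> B 0" by (rule B_mono[OF _ h]) (use j in auto)
          then have l: "2 * x + (y + h) \<in> B 0 \<longleftrightarrow> 2 * x + y \<in> B 0" using lin[of "y + h" y] by simp
          have "a * Q x (y + h) = a * Q x y + a * (x - 2 * d * y) * h + a * (- (d * (h * h)))"
            by (simp add: Q_def power2_eq_square algebra_simps)
          then have "chi (a * Q x (y + h))
              = chi (a * Q x y) * chi (a * (x - 2 * d * y) * h) * chi (a * (- (d * (h * h))))"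
            by (simp only: chi_add)
          moreover have "chi (a * (- (d * (h * h)))) = 1"
            using dv[OF sq[OF h]] by (intro triv) simp
          ultimately show ?thesis using l by simp
        qed
      qed
    qed simp
    \<comment> \<open>The gradient is a linear map of determinant \<open>-(1 + 4 * d)\<close>, a
      unit, so it is integral exactly at integral points.\<close>
    also have "\<dots> = (\<Sum>x\<in>T n M'. \<Sum>y\<in>T n M. if x \<in> B 0 \<and> y \<in> B 0 then chi (a * Q x y) else 0)"
    proof (intro sum.cong refl)
      fix x y
      have iff: "x - 2 * d * y \<in> B 0 \<and> 2 * x + y \<in> B 0 \<longleftrightarrow> x \<in> B 0 \<and> y \<in> B 0"
      proof (intro iffI conjI; elim conjE)
        assume *: "x - 2 * d * y \<in> B 0" "2 * x + y \<in> B 0"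
        have bO: "b \<in> B 0" "b \<notin> B 1" using discriminant_unit[OF d] by (simp_all add: b_def)
        have "2 * d \<in> B 0" using d(1) by (intro O_mult) auto
        from B_add[OF O_mult[OF this *(2)] *(1)]
        have "(2 * d) * (2 * x + y) + (x - 2 * d * y) \<in> B 0" .
        then have "b * x \<in> B 0" by (simp add: b_def algebra_simps)
        from O_mult[OF B_inverse_unit[OF bO] this] have "inverse b * b * x \<in> B 0"
          by (simp only: mult.assoc)
        moreover have "b \<noteq> 0" using bO(2) by auto
        ultimately show x: "x \<in> B 0" by simp
        show "y \<in> B 0" using B_diff[OF *(2) two[OF x]] by simp
      next
        assume *: "x \<in> B 0" "y \<in> B 0"
        show "x - 2 * d * y \<in> B 0" using * d(1) by (intro B_diff O_mult) auto
        show "2 * x + y \<in> B 0" using * by (intro B_add O_mult) auto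
      qed
      then show "(if x - 2 * d * y \<in> B 0 then if 2 * x + y \<in> B 0 then chi (a * Q x y) else 0 else 0)
        = (if x \<in> B 0 \<and> y \<in> B 0 then chi (a * Q x y) else 0)" by auto
    qed
    \<comment> \<open>On integral points the summand depends only on residues, because
      \<open>j \<le> 1\<close>; level \<open>n\<close> can therefore be coarsened to level
      1.\<close>
    also have "vol n * vol n * \<dots> = vol 1 * vol 1 * (\<Sum>x\<in>T 1 0. \<Sum>y\<in>T 1 0. chi (a * Q x y))"
    proof -
      have aO: "a \<in> B (c - 1)" by (rule B_mono[OF _ aB]) (use j in auto)
      have aO1: "chi (a * z) = 1" if "z \<in> B 1" for z
        using B_mult[OF aO that] by (intro chi_triv) simp
      have O1: "LC 1 0 (\<lambda>y. if x \<in> B 0 \<and> y \<in> B 0 then chi (a * Q x y) else 0)" for x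
      proof (cases "x \<in> B 0")
        case True
        have "LC 1 0 (\<lambda>y. if y \<in> B 0 then chi (a * Q x y) else 0)"
        proof (rule LC_restrict, simp, rule chi_eq_1_imp_eq)
          fix y y' assume *: "y - y' \<in> B 1" "y \<in> B 0" "y' \<in> B 0"
          have "a * Q x y - a * Q x y' = a * ((y - y') * (x - d * (y + y')))"
            by (simp add: Q_def power2_eq_square algebra_simps)
          moreover have "(y - y') * (x - d * (y + y')) \<in> B 1"
            using * True d(1) by (intro P_mult(1)[OF *(1)] B_diff O_mult B_add)
          ultimately show "chi (a * Q x y - a * Q x y') = 1" using aO1 by simp
        qed
        then show ?thesis using True by simp
      qed (simp add: LC_def)
      have O2: "LC 1 0 (\<lambda>x. if x \<in> B 0 then (\<Sum>y\<in>T 1 0. chi (a * Q x y)) else 0)"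
      proof (rule LC_restrict, simp, intro sum.cong refl, rule chi_eq_1_imp_eq)
        fix x x' y assume *: "x - x' \<in> B 1" "x \<in> B 0" "x' \<in> B 0" "y \<in> T 1 0"
        have y: "y \<in> B 0" using T_in_B[OF _ *(4)] by simp
        have "a * Q x y - a * Q x' y = a * ((x - x') * (x + x' + y))"
          by (simp add: Q_def power2_eq_square algebra_simps)
        moreover have "(x - x') * (x + x' + y) \<in> B 1"
          using * y by (intro P_mult(1) B_add)
        ultimately show "chi (a * Q x y - a * Q x' y) = 1" using aO1 by simp
      qed
      have "vol n * (\<Sum>y\<in>T n M. if x \<in> B 0 \<and> y \<in> B 0 then chi (a * Q x y) else 0)
          = vol 1 * (if x \<in> B 0 then (\<Sum>y\<in>T 1 0. chi (a * Q x y)) else 0)" for x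
        unfolding sum_T_mono[OF O1 n(3) M] using T_in_B[of 0 1] by (auto intro!: sum.cong)
      then have "vol n * vol n * (\<Sum>x\<in>T n M'. \<Sum>y\<in>T n M. if x \<in> B 0 \<and> y \<in> B 0 then chi (a * Q x y) else 0)
          = vol n * (\<Sum>x\<in>T n M'. vol 1 * (if x \<in> B 0 then (\<Sum>y\<in>T 1 0. chi (a * Q x y)) else 0))"
        by (simp only: mult.assoc sum_distrib_left[of "vol n" _ "T n M'"])
      also have "\<dots> = vol 1 * (vol n * (\<Sum>x\<in>T n M'. if x \<in> B 0 then (\<Sum>y\<in>T 1 0. chi (a * Q x y)) else 0))"
        by (simp only: sum_distrib_left[symmetric] mult_ac)
      also have "\<dots> = vol 1 * (vol 1 * (\<Sum>x\<in>T 1 0. if x \<in> B 0 then (\<Sum>y\<in>T 1 0. chi (a * Q x y)) else 0))"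
        using sum_T_mono[OF O2 n(3), of M'] M M' by simp
      also have "(\<Sum>x\<in>T 1 0. if x \<in> B 0 then (\<Sum>y\<in>T 1 0. chi (a * Q x y)) else 0)
          = (\<Sum>x\<in>T 1 0. \<Sum>y\<in>T 1 0. chi (a * Q x y))"
        using T_in_B[of 0 1] by (auto intro!: sum.cong)
      finally show ?thesis by (simp add: mult.assoc)
    qed
    also have "(\<Sum>x\<in>T 1 0. \<Sum>y\<in>T 1 0. chi (a * Q x y)) = (\<Sum>y\<in>T 1 0. \<Sum>x\<in>T 1 0. chi (a * Q x y))"
      by (rule sum.swap)
    finally show "gauss M' a * gauss M (- a * (1 + 4 * d) / 4)
      = vol 1 * vol 1 * (\<Sum>y\<in>T 1 0. \<Sum>x\<in>T 1 0. chi (a * (x\<^sup>2 + x * y - d * y\<^sup>2)))"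
      by (simp add: b_def Q_def)
  qed
qed

text \<open>Neither \<open>g\<close> nor the values of \<open>\<eta>\<close> are known, only the
  squares of these values. Multiplying the Gauss integrals at \<open>a\<close> and at
  \<open>a * b\<close> leaves a single unknown constant.\<close>

theorem gauss_not_multiplicative:
  assumes n2: "(2 :: 'f) \<noteq> 0" and n2': "(2 :: 'r) \<noteq> 0"
    and gauss: "\<And>e. e \<noteq> 0 \<Longrightarrow> \<exists>M0. \<forall>M\<le>M0. gauss M e = g * \<eta> e"
    and mult: "\<And>x y. x \<noteq> 0 \<Longrightarrow> y \<noteq> 0 \<Longrightarrow> \<eta> (x * y) = \<eta> x * \<eta> y"
    and sq: "\<And>x k. absv x = absv \<pi> powi k \<Longrightarrow> \<eta> x * \<eta> x = vol (- k)"
  shows False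
proof -
  obtain d where d: "d \<in> B 0" "\<forall>t\<in>B 0. t\<^sup>2 + t - d \<notin> B 1" using ex_irreducible by blast
  have n4: "(4 :: 'f) \<noteq> 0" using n2 by (metis mult_eq_0_iff numeral_Bit0 mult_2)
  define b where "b = - (1 + 4 * d) / 4"
  have b0: "b \<noteq> 0"
  proof -
    have "1 + 4 * d \<noteq> 0" using discriminant_unit(2)[OF d] by (intro notI) simp
    then have "- (1 + 4 * d) \<noteq> 0" by (simp only: neg_equal_0_iff_equal not_False_eq_True)
    then show ?thesis unfolding b_def using n4 by (simp only: divide_eq_0_iff) simp
  qed
  define S where "S a = (\<Sum>y\<in>T 1 0. \<Sum>x\<in>T 1 0. chi (a * (x\<^sup>2 + x * y - d * y\<^sup>2)))" for a
  define C where "C = g * g * \<eta> b"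
  have pp: "absv \<pi> powi k \<noteq> 0" for k using pi_pos by simp
  have TO: "t \<in> B 0" if "t \<in> T 1 0" for t using T_in_B[of 0 1] that by simp
  have QO: "x\<^sup>2 + x * y - d * y\<^sup>2 \<in> B 0" if "x \<in> B 0" "y \<in> B 0" for x y
    unfolding power2_eq_square using that d(1) by (intro B_diff B_add O_mult)
  \<comment> \<open>For \<open>j = 0\<close> the character with frequency \<open>a\<close> is
    trivial on the integers; for \<open>j = 1\<close> it induces a nontrivial character of the
    residue field. Both cases share the constant \<open>C\<close>.\<close>
  have key: "vol 1 * vol 1 * S a = C * vol (j - c)"
    if a: "absv a = absv \<pi> powi (c - j)" and j: "j = 0 \<or> j = 1" for a j
  proof -
    have a0: "a \<noteq> 0" using a pp[of "c - j"] by auto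
    then have ab0: "a * b \<noteq> 0" using b0 by simp
    obtain M0 where M0: "\<forall>M\<le>M0. gauss M a = g * \<eta> a" using gauss[OF a0] by blast
    obtain N0 where N0: "\<forall>M\<le>N0. gauss M (a * b) = g * \<eta> (a * b)" using gauss[OF ab0] by blast
    obtain M1 where M1: "\<forall>M\<le>M1. \<exists>M2. \<forall>M'\<le>M2. gauss M' a * gauss M (a * b) = vol 1 * vol 1 * S a"
    proof -
      have "- a * (1 + 4 * d) / 4 = a * b"
        unfolding b_def by (simp only: mult_minus_left mult_minus_right times_divide_eq_right)
      note gauss_product[OF d n2 j a, unfolded this, folded S_def]
      then show ?thesis using that by blast
    qed
    obtain M2 where M2: "\<forall>M'\<le>M2. gauss M' a * gauss (min N0 M1) (a * b) = vol 1 * vol 1 * S a"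
      using M1 by (meson min.cobounded2)
    have "vol 1 * vol 1 * S a = gauss (min M0 M2) a * gauss (min N0 M1) (a * b)"
      using M2 by simp
    also have "\<dots> = g * \<eta> a * (g * \<eta> (a * b))" using M0 N0 by simp
    also have "\<dots> = C * (\<eta> a * \<eta> a)" using mult[OF a0 b0] by (simp add: C_def mult_ac)
    finally show ?thesis using sq[OF a] by simp
  qed
  have card_sum: "vol 1 * of_nat q = 1" using vol_Suc[of 0] by (simp add: mult.commute)
  define \<delta> where "\<delta> = \<pi> powi c"
  \<comment> \<open>At level \<open>j = 0\<close> every summand of \<open>S\<close> is 1, which
    determines the constant.\<close>
  have C: "C * vol (- c) = 1"
  proof -
    have "chi (\<delta> * z) = 1" if "z \<in> B 0" for z
      using B_mult[OF pi_in_B that, of c] by (intro chi_triv) (simp add: \<delta>_def)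
    then have "S \<delta> = (\<Sum>y\<in>T 1 0. \<Sum>x\<in>T 1 0. 1)"
      unfolding S_def using QO TO by (intro sum.cong refl) blast
    then have "S \<delta> = of_nat q * of_nat q" by (simp add: q_def)
    then have "vol 1 * vol 1 * S \<delta> = 1" using card_sum by (metis mult.assoc mult.left_commute mult_1)
    then show ?thesis using key[of \<delta> 0] by (simp add: \<delta>_def absv_pi_powi)
  qed
  define eps where "eps = \<pi> powi (c - 1)"
  have eps: "absv eps = absv \<pi> powi (c - 1)" by (simp add: eps_def absv_pi_powi)
  define \<theta> where "\<theta> z = chi (eps * z)" for z
  have \<theta>1: "\<theta> z = 1" if "z \<in> B 1" for z
    using B_mult[OF pi_in_B that, of "c - 1"] unfolding \<theta>_def eps_def by (intro chi_triv) simp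
  have \<theta>_add: "\<theta> (x + y) = \<theta> x * \<theta> y" for x y by (simp add: \<theta>_def distrib_left chi_add)
  have \<theta>_sum: "(\<Sum>u\<in>T 1 0. \<theta> (z * u)) = (if z \<in> B 1 then of_nat q else 0)" if z: "z \<in> B 0" for z
  proof (cases "z \<in> B 1")
    case True
    then have "\<theta> (z * u) = 1" if "u \<in> T 1 0" for u using \<theta>1 P_mult(1)[OF True TO[OF that]] by blast
    then show ?thesis using True by (simp add: q_def)
  next
    case False
    have "eps * z \<notin> B (c - 0)" using B_scale[OF eps, of z c] False by simp
    then obtain h where h: "h \<in> B 0" "chi (eps * z * h) \<noteq> 1" using ex_chi_nontriv by blast
    have "(\<Sum>u\<in>T 1 0. chi (eps * z * u)) = 0"
    proof (rule sum_T_chi_0[OF _ _ h])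
      show "chi (eps * z * x) = 1" if "x \<in> B 1" for x
        using \<theta>1[OF P_mult(2)[OF z that]] by (simp add: \<theta>_def mult.assoc)
    qed simp
    then show ?thesis using False by (simp add: \<theta>_def mult.assoc)
  qed
  \<comment> \<open>The value forced by the assumptions. The actual sum for a binary form without
    nontrivial zeros over the residue field is \<open>-q\<close>.\<close>
  have Su: "S (eps * u) = of_nat q" if "u \<in> T 1 0" "u \<notin> B 1" for u
  proof -
    have "absv u = 1" using TO[OF that(1)] not_B_imp[OF that(2)] by (simp add: B_def)
    then have "absv (eps * u) = absv \<pi> powi (c - 1)" using eps by (simp add: absv_mult)
    then have "vol 1 * vol 1 * S (eps * u) = C * vol (1 - c)" by (rule key) simp
    also have "\<dots> = vol 1" using C vol_add[of 1 "- c"] by (simp add: mult.left_commute)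
    finally have "vol 1 * S (eps * u) = vol 1 * of_nat q" using card_sum by (simp add: mult.assoc)
    then show ?thesis by simp
  qed
  \<comment> \<open>The residue class 0, whose representative need not be 0. It is split off because
    \<open>S\<close> is there the trivial sum \<open>q^2\<close>.\<close>
  let ?z = "rep 1 0"
  have z: "?z \<in> T 1 0" "?z \<in> B 1" using rep_in_T[of 0 0 1] rep_diff'[of 1 0] by simp_all
  have other: "u \<notin> B 1" if "u \<in> T 1 0 - {?z}" for u
    using T_eq[of u 1 0 ?z 0] that z B_diff by blast
  have Sz: "S (eps * ?z) = of_nat q * of_nat q"
  proof -
    have "chi (eps * ?z * z) = 1" if "z \<in> B 0" for z
      using \<theta>1[OF P_mult(1)[OF z(2) that]] by (simp add: \<theta>_def mult.assoc)
    then have "S (eps * ?z) = (\<Sum>y\<in>T 1 0. \<Sum>x\<in>T 1 0. 1)"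
      unfolding S_def using QO TO by (intro sum.cong refl) blast
    then show ?thesis by (simp add: q_def)
  qed
  have \<theta>z: "\<theta> (- ?z) = 1" using z(2) by (intro \<theta>1) simp
  have "0 = (\<Sum>u\<in>T 1 0. \<theta> (- u))" using \<theta>_sum[of "- 1"] by simp
  also have "\<dots> = 1 + (\<Sum>u\<in>T 1 0 - {?z}. \<theta> (- u))"
    using sum.remove[OF finite_T z(1), of "\<lambda>u. \<theta> (- u)"] \<theta>z by simp
  finally have rest: "(\<Sum>u\<in>T 1 0 - {?z}. \<theta> (- u)) = - 1"
    by (metis add_eq_0_iff)
  have "(\<Sum>u\<in>T 1 0. \<theta> (- u) * S (eps * u))
      = of_nat q * of_nat q + (\<Sum>u\<in>T 1 0 - {?z}. \<theta> (- u) * of_nat q)"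
    using sum.remove[OF finite_T z(1), of "\<lambda>u. \<theta> (- u) * S (eps * u)"] \<theta>z Sz Su other by simp
  also have "\<dots> = of_nat q * of_nat q - of_nat q"
    unfolding sum_distrib_right[symmetric] rest by simp
  finally have lhs: "(\<Sum>u\<in>T 1 0. \<theta> (- u) * S (eps * u)) = of_nat q * of_nat q - of_nat q" .
  \<comment> \<open>The second evaluation: orthogonality in \<open>u\<close> picks out the residue
    points with \<open>Q = 1\<close>, each with weight \<open>q\<close>.\<close>
  have "(\<Sum>u\<in>T 1 0. \<theta> (- u) * S (eps * u))
      = (\<Sum>u\<in>T 1 0. \<Sum>y\<in>T 1 0. \<Sum>x\<in>T 1 0. \<theta> ((x\<^sup>2 + x * y - d * y\<^sup>2 - 1) * u))"
    unfolding S_def sum_distrib_left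
  proof (intro sum.cong refl)
    fix u x y
    have "(x\<^sup>2 + x * y - d * y\<^sup>2 - 1) * u = - u + u * (x\<^sup>2 + x * y - d * y\<^sup>2)"
      by (simp add: algebra_simps)
    then show "\<theta> (- u) * chi (eps * u * (x\<^sup>2 + x * y - d * y\<^sup>2)) = \<theta> ((x\<^sup>2 + x * y - d * y\<^sup>2 - 1) * u)"
      by (simp only: \<theta>_add) (simp add: \<theta>_def mult.assoc)
  qed
  also have "\<dots> = (\<Sum>y\<in>T 1 0. \<Sum>x\<in>T 1 0. \<Sum>u\<in>T 1 0. \<theta> ((x\<^sup>2 + x * y - d * y\<^sup>2 - 1) * u))"
    by (subst sum.swap) (intro sum.cong refl sum.swap)
  also have "\<dots> = (\<Sum>y\<in>T 1 0. \<Sum>x\<in>T 1 0. if x\<^sup>2 + x * y - d * y\<^sup>2 - 1 \<in> B 1 then of_nat q else 0)"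
    by (intro sum.cong refl \<theta>_sum B_diff[OF QO one_in_B] TO)
  also have "\<dots> = (\<Sum>x\<in>T 1 0. \<Sum>y\<in>T 1 0. if x\<^sup>2 + x * y - d * y\<^sup>2 - 1 \<in> B 1 then of_nat q else 0)"
    by (rule sum.swap)
  also have "\<dots> = (\<Sum>p\<in>T 1 0 \<times> T 1 0. if p \<in> {(x, y). x \<in> T 1 0 \<and> y \<in> T 1 0 \<and> x\<^sup>2 + x * y - d * y\<^sup>2 - 1 \<in> B 1} then of_nat q else 0)"
    unfolding sum.cartesian_product by (intro sum.cong) (auto split: if_splits)
  also have "\<dots> = of_nat (card {(x, y). x \<in> T 1 0 \<and> y \<in> T 1 0 \<and> x\<^sup>2 + x * y - d * y\<^sup>2 - 1 \<in> B 1}) * of_nat q"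
  proof -
    have "T 1 0 \<times> T 1 0 \<inter> {(x, y). x \<in> T 1 0 \<and> y \<in> T 1 0 \<and> x\<^sup>2 + x * y - d * y\<^sup>2 - 1 \<in> B 1}
      = {(x, y). x \<in> T 1 0 \<and> y \<in> T 1 0 \<and> x\<^sup>2 + x * y - d * y\<^sup>2 - 1 \<in> B 1}" by auto
    then show ?thesis by (subst sum.inter_restrict[symmetric]) auto
  qed
  also have "\<dots> = (of_nat q + 1) * of_nat q" unfolding card_conic[OF d] by (simp add: add.commute)
  finally have "2 * (of_nat q :: 'r) = 0" unfolding lhs by (simp add: algebra_simps)
  then show False using n2' card_sum by auto
qed

end

section \<open>The residue field and the conductor\<close>

lemma of_nat_dvd_1_if_primes:
  assumes "n > 0" "\<And>l. prime l \<Longrightarrow> l dvd n \<Longrightarrow> (of_nat l :: 'r::comm_ring_1) dvd 1"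
  shows "(of_nat n :: 'r) dvd 1"
  using assms
proof (induction n rule: less_induct)
  case (less n)
  show ?case
  proof (cases "n = 1")
    case False
    then obtain l where l: "prime l" "l dvd n" using prime_factor_nat by blast
    then obtain m where m: "n = l * m" by blast
    have "m < n" "m > 0" using less.prems(1) m prime_gt_1_nat[OF l(1)] by auto
    then have "(of_nat m :: 'r) dvd 1" using less.IH less.prems(2) m by auto
    from mult_dvd_mono[OF less.prems(2)[OF l] this] show ?thesis by (simp add: m)
  qed simp
qed

text \<open>A Sylow argument supplies an element of additive order \<open>l\<close>, and the
  characteristic annihilates every element. This carries invertibility in R from p over to the
  cardinality \<open>q\<close>.\<close>

lemma (in ring) prime_dvd_card_imp_dvd_ring_char:
  assumes "finite (carrier R)" "prime l" "l dvd card (carrier R)"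
  shows "l dvd ring_char R"
proof -
  let ?G = "add_monoid R"
  note G = add.is_group
  obtain m where "card (carrier R) = l ^ 1 * m" using assms(3) by auto
  then obtain H where H: "subgroup H ?G" "card H = l"
    using sylow_thm[OF assms(2) add.is_group, of 1 m] assms(1) by (auto simp: order_def)
  have "finite H" using H(1) assms(1) by (metis finite_subset partial_object.select_convs(1) subgroup.subset)
  have "\<exists>x\<in>H. x \<noteq> \<zero>"
  proof (rule ccontr)
    assume "\<not> ?thesis"
    then have "H \<subseteq> {\<zero>}" by auto
    then have "card H \<le> 1" using card_mono[of "{\<zero>}" H] by simp
    then show False using H(2) prime_gt_1_nat[OF assms(2)] by simp
  qed
  then obtain x where x: "x \<in> H" "x \<noteq> \<zero>" by blast
  have xR: "x \<in> carrier R" using subgroup.subset[OF H(1)] x(1) by auto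
  interpret H: group "?G\<lparr>carrier := H\<rparr>" by (rule group.subgroup_imp_group[OF G H(1)])
  have "x [^]\<^bsub>?G\<lparr>carrier := H\<rparr>\<^esub> l = \<zero>"
    using H.pow_order_eq_1[of x] x(1) H(2) by (simp add: order_def)
  then have "x [^]\<^bsub>?G\<^esub> l = \<zero>" by (simp add: nat_pow_def)
  then have o1: "group.ord ?G x dvd l" using group.pow_eq_id[OF G, of x l] xR by simp
  have "[ring_char R] \<cdot> \<one> = \<zero>"
    using group.pow_ord_eq_1[OF G, of \<one>] by (simp add: ring_char_def add_pow_def)
  then have "[ring_char R] \<cdot> x = \<zero>"
    using add_pow_ldistr[of \<one> x "ring_char R"] xR by simp
  then have o2: "group.ord ?G x dvd ring_char R"
    using group.pow_eq_id[OF G, of x "ring_char R"] xR by (simp add: add_pow_def)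
  have "group.ord ?G x \<noteq> 1" using group.ord_eq_1[OF G, of x] xR x(2) by simp
  then have "group.ord ?G x = l" using o1 assms(2) by (metis prime_nat_iff)
  then show ?thesis using o2 by simp
qed

context uniformized
begin

section \<open>The residue ring in terms of representatives\<close>

lemma B_0_eq: "B 0 = {x. absv x \<le> 1}" and B_1_eq: "B 1 = {x. absv x < 1}"
  using pi_max pi_lt by (force simp: B_def)+

lemma valuation_ring_simps [simp]:
  "carrier (valuation_ring absv) = B 0"
  "mult (valuation_ring absv) = (*)" "one (valuation_ring absv) = 1"
  "zero (valuation_ring absv) = 0" "add (valuation_ring absv) = (+)"
  by (simp_all add: valuation_ring_def B_0_eq)

lemma ring_valuation_ring: "ring (valuation_ring absv)"
proof (rule ringI)
  show "abelian_group (valuation_ring absv)"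
  proof (rule abelian_groupI)
    show "\<exists>y\<in>carrier (valuation_ring absv). y \<oplus>\<^bsub>valuation_ring absv\<^esub> x = \<zero>\<^bsub>valuation_ring absv\<^esub>"
      if "x \<in> carrier (valuation_ring absv)" for x
      using that by (intro bexI[of _ "- x"]) auto
  qed (auto intro: B_add)
  show "monoid (valuation_ring absv)"
    by (rule monoidI) (auto intro: O_mult simp: mult.assoc)
qed (auto simp: algebra_simps)

lemma ideal_P: "ideal (B 1) (valuation_ring absv)"
proof (rule idealI[OF ring_valuation_ring])
  interpret V: ring "valuation_ring absv" by (rule ring_valuation_ring)
  show "subgroup (B 1) (add_monoid (valuation_ring absv))"
  proof (rule group.subgroupI[OF V.add.is_group])
    fix a assume a: "a \<in> B 1"
    have "inv\<^bsub>add_monoid (valuation_ring absv)\<^esub> a = - a"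
      by (rule group.inv_equality[OF V.add.is_group]) (use P_in_O[OF a] in auto)
    then show "inv\<^bsub>add_monoid (valuation_ring absv)\<^esub> a \<in> B 1" using a by simp
  next
    show "B 1 \<noteq> {}" using B_0 by blast
  qed (use P_in_O B_add in auto)
qed (auto intro: P_mult)

lemma carrier_residue_field:
  "carrier (residue_field absv) = (\<lambda>t. {y. y - t \<in> B 1}) ` T 1 0"
proof -
  have coset: "B 1 +>\<^bsub>valuation_ring absv\<^esub> t = {y. y - t \<in> B 1}" for t
  proof -
    have "y \<in> (\<Union>h\<in>B 1. {h + t})" if "y - t \<in> B 1" for y
      using that by (intro UN_I[of "y - t"]) auto
    then show ?thesis unfolding a_r_coset_def r_coset_def by auto
  qed
  have "carrier (residue_field absv) = (\<lambda>t. {y. y - t \<in> B 1}) ` B 0"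
    unfolding residue_field_def FactRing_def B_1_eq[symmetric] A_RCOSETS_defs coset[unfolded a_r_coset_def]
    by auto
  also have "\<dots> = (\<lambda>t. {y. y - t \<in> B 1}) ` T 1 0"
  proof (intro equalityI subsetI)
    fix S assume "S \<in> (\<lambda>t. {y. y - t \<in> B 1}) ` B 0"
    then obtain x where x: "x \<in> B 0" "S = {y. y - x \<in> B 1}" by blast
    have "y - x \<in> B 1 \<longleftrightarrow> y - rep 1 x \<in> B 1" for y
      using B_diff_trans[OF _ rep_diff] B_diff_trans[OF _ rep_diff'] by blast
    then have "S = {y. y - rep 1 x \<in> B 1}" unfolding x(2) by blast
    then show "S \<in> (\<lambda>t. {y. y - t \<in> B 1}) ` T 1 0" using rep_in_T[OF x(1)] by blast
  next
    fix S assume "S \<in> (\<lambda>t. {y. y - t \<in> B 1}) ` T 1 0"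
    then show "S \<in> (\<lambda>t. {y. y - t \<in> B 1}) ` B 0" using T_in_B[of 0 1] by auto
  qed
  finally show ?thesis .
qed

lemma finite_residue_field: "finite (carrier (residue_field absv))"
  unfolding carrier_residue_field by simp

lemma card_residue_field: "card (carrier (residue_field absv)) = q"
  unfolding carrier_residue_field q_def
proof (rule card_image, rule inj_onI)
  fix s t assume *: "s \<in> T 1 0" "t \<in> T 1 0" "{y. y - s \<in> B 1} = {y. y - t \<in> B 1}"
  have "s \<in> {y. y - s \<in> B 1}" by simp
  then have "s - t \<in> B 1" using *(3) by blast
  then show "s = t" using T_eq *(1,2) by blast
qed

lemma q_pos: "q > 0"
proof -
  have "T 1 0 \<noteq> {}" using rep_in_T[OF one_in_B] by blast
  then show ?thesis unfolding q_def by (simp add: card_gt_0_iff)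
qed

lemma q_unit:
  assumes "(of_nat (ring_char (residue_field absv)) :: 'r::comm_ring_1) dvd 1"
  shows "(of_nat q :: 'r) dvd 1"
proof (rule of_nat_dvd_1_if_primes[OF q_pos])
  fix l :: nat assume l: "prime l" "l dvd q"
  interpret K: ring "residue_field absv"
    unfolding residue_field_def B_1_eq[symmetric] by (rule ideal.quotient_is_ring[OF ideal_P])
  have "l dvd ring_char (residue_field absv)"
    by (rule K.prime_dvd_card_imp_dvd_ring_char) (use l finite_residue_field card_residue_field in auto)
  then obtain m where "ring_char (residue_field absv) = l * m" by blast
  then have "(of_nat l :: 'r) dvd of_nat (ring_char (residue_field absv))" by simp
  then show "(of_nat l :: 'r) dvd 1" using assms dvd_trans by blast
qed

text \<open>The open kernel contains some \<open>B n\<close>. Without a conductor, triviality would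
  pass from each ball to the next larger one and so to the whole field.\<close>

lemma ex_conductor:
  fixes chi :: "'f \<Rightarrow> 'r::comm_ring_1"
  assumes "smooth_character chi" "\<exists>x. chi x \<noteq> 1"
  shows "\<exists>c. (\<forall>x\<in>B c. chi x = 1) \<and> (\<exists>x\<in>B (c - 1). chi x \<noteq> 1)"
proof -
  have hom: "chi \<in> hom additive_group units_group" and op: "open {x. chi x = 1}"
    using assms(1) by (auto simp: smooth_character_def)
  have add: "chi (x + y) = chi x * chi y" for x y
    using hom by (auto simp: hom_def additive_group_def units_group_def)
  have un: "chi x dvd 1" for x
    using hom by (auto simp: hom_def additive_group_def units_group_def)
  \<comment> \<open>R is only a commutative ring here, so cancellation is replaced by the fact that
    an idempotent unit is 1.\<close>
  have idem: "chi 0 * chi 0 = chi 0" using add[of 0 0] by simp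
  obtain u where u: "1 = chi 0 * u" using un[of 0] by (elim dvdE)
  have "chi 0 = chi 0 * (chi 0 * u)" by (simp only: u[symmetric] mult_1_right)
  also have "\<dots> = chi 0 * u" using idem by (simp only: mult.assoc[symmetric])
  also have "\<dots> = 1" by (rule u[symmetric])
  finally have "chi 0 = 1" .
  then obtain e where e: "e > 0" "\<And>y. dist y 0 < e \<Longrightarrow> chi y = 1"
    using op unfolding open_dist by blast
  then obtain n where n: "\<forall>x\<in>B n. chi x = 1"
    using ex_B_small[OF e(1)] dist_absv by (metis diff_zero)
  obtain x0 where x0: "chi x0 \<noteq> 1" using assms(2) by blast
  obtain m where m: "x0 \<in> B m" using ex_B by blast
  show ?thesis
  proof (rule ccontr)
    assume *: "\<not> ?thesis"
    have "\<forall>x\<in>B (n - int i). chi x = 1" for i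
    proof (induction i)
      case (Suc i)
      then have "\<forall>x\<in>B (n - int i - 1). chi x = 1" using * by blast
      then show ?case by (simp add: algebra_simps)
    qed (use n in simp)
    moreover have "x0 \<in> B (n - int (nat (n - m)))" by (rule B_mono[OF _ m]) simp
    ultimately show False using x0 by blast
  qed
qed

end

section \<open>The Fourier transform on the line\<close>

lemma (in uniformized) B_max_iff: "x \<in> B (max a b) \<longleftrightarrow> x \<in> B a \<and> x \<in> B b"
  using B_mono[of a "max a b" x] B_mono[of b "max a b" x] by (auto simp: max_def)

lemma (in uniformized) B_min_iff: "x \<in> B (min a b) \<longleftrightarrow> x \<in> B a \<or> x \<in> B b"
  using B_mono[of "min a b" a x] B_mono[of "min a b" b x] by (auto simp: min_def)

context local_char
begin

text \<open>The transform carries no sign and uses the measure with volume 1 on \<open>B 0\<close>,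
  hence the reflection and the factor \<open>vol c\<close> in the inversion formula
  \<open>I_hat_chi\<close>.\<close>

definition hat :: "('f \<Rightarrow> 'r) \<Rightarrow> 'f \<Rightarrow> 'r" where
  "hat f s = I (\<lambda>t. f t * chi (s * t))"

lemma chi_mult_eqI:
  assumes "y \<in> B k" "x - x' \<in> B (c - k)"
  shows "chi (x * y) = chi (x' * y)" "chi (y * x) = chi (y * x')"
proof -
  have "x * y - x' * y \<in> B c" using B_mult[OF assms(2,1)] by (simp add: left_diff_distrib)
  then show "chi (x * y) = chi (x' * y)" by (rule chi_eqI)
  then show "chi (y * x) = chi (y * x')" by (simp add: mult.commute)
qed

lemma LC_mult_chi:
  assumes "LC n m f" "s \<in> B k"
  shows "LC (max n (c - k)) m (\<lambda>t. f t * chi (s * t))"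
  by (rule LC_mult(1)[OF LC_mono[OF assms(1)]])
    (auto intro!: chi_mult_eqI(2)[OF assms(2)] simp: B_max_iff)

lemma ex_LC_mult_chi: "LC n m f \<Longrightarrow> \<exists>n'. LC n' m (\<lambda>t. f t * chi (s * t))"
  using LC_mult_chi ex_B by blast

text \<open>A translation by \<open>h\<close> in \<open>B n\<close> leaves \<open>f\<close> alone
  but multiplies the integral by \<open>chi (s * h)\<close>.\<close>

lemma I_mult_chi_eq_0:
  assumes "LC n m f" "s \<notin> B (c - n)"
  shows "I (\<lambda>t. f t * chi (s * t)) = 0"
proof -
  obtain h where h: "h \<in> B n" "chi (s * h) \<noteq> 1" using ex_chi_nontriv[OF assms(2)] by blast
  obtain n' where L: "LC n' m (\<lambda>t. f t * chi (s * t))" using ex_LC_mult_chi[OF assms(1)] by blast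
  have "I (\<lambda>t. f t * chi (s * t)) = I (\<lambda>t. f (t + h) * chi (s * (t + h)))"
    by (rule I_translate[OF L, symmetric])
  also have "(\<lambda>t. f (t + h) * chi (s * (t + h))) = (\<lambda>t. chi (s * h) * (f t * chi (s * t)))"
    using LC_inv[OF assms(1), of "_ + h" _] h(1) by (auto simp: distrib_left chi_add mult_ac)
  also have "I \<dots> = chi (s * h) * I (\<lambda>t. f t * chi (s * t))" by (rule I_cmult[OF L])
  finally have "(1 - chi (s * h)) * I (\<lambda>t. f t * chi (s * t)) = 0" by (simp add: left_diff_distrib)
  then show ?thesis using h(2) by simp
qed

text \<open>Support in \<open>B m\<close> gives invariance under \<open>B (c - m)\<close>, and
  invariance under \<open>B n\<close> gives support in \<open>B (c - n)\<close>. The maximum and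
  minimum provide levels that also fit \<open>f\<close>, since on X the other coordinates keep their
  old levels.\<close>

lemma LC_hat:
  assumes "LC n m f"
  shows "LC (max n (c - m)) (min m (c - n)) (hat f)"
  unfolding LC_def
proof (intro conjI allI impI)
  show "min m (c - n) \<le> max n (c - m)" using LC_le[OF assms] by auto
next
  fix x y assume *: "x - y \<in> B (max n (c - m))"
  have "f t * chi (x * t) = f t * chi (y * t)" for t
  proof (cases "t \<in> B m")
    case True
    then show ?thesis using chi_mult_eqI(1)[OF True B_mono[OF _ *]] by simp
  qed (simp add: LC_outside[OF assms])
  then show "hat f x = hat f y" unfolding hat_def by (intro arg_cong[of _ _ I] ext)
next
  fix x assume "x \<notin> B (min m (c - n))"
  then have "x \<notin> B (c - n)" using B_mono[of "min m (c - n)" "c - n" x] by auto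
  then show "hat f x = 0" unfolding hat_def by (rule I_mult_chi_eq_0[OF assms])
qed

text \<open>Fubini moves the transform from \<open>f\<close> to the truncated \<open>g\<close>. It
  serves both for inversion and for the Gaussian, neither of which is integrable without
  truncation.\<close>

lemma I_ball_hat:
  assumes f: "LC n m f" and g: "\<And>x y. x - y \<in> B N \<Longrightarrow> x \<in> B M \<Longrightarrow> y \<in> B M \<Longrightarrow> g x = g y"
  shows "I (\<lambda>s. (if s \<in> B M then g s else 0) * hat f s)
    = I (\<lambda>t. f t * I (\<lambda>s. if s \<in> B M then g s * chi (t * s) else 0))"
proof -
  define n' where "n' = max (max n (c - M)) m"
  define N' where "N' = max (max N (c - m)) M"
  have L1: "LC n' m (\<lambda>t. (if s \<in> B M then g s else 0) * (f t * chi (s * t)))" for s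
  proof (cases "s \<in> B M")
    case True
    have "LC n' m (\<lambda>t. f t * chi (s * t))"
      by (rule LC_mono[OF LC_mult_chi[OF f True]]) (auto simp: n'_def)
    from LC_cmult[OF this] show ?thesis .
  next
    case False
    then show ?thesis by (simp add: LC_def n'_def)
  qed
  have g': "LC N' M (\<lambda>s. if s \<in> B M then g s else 0)"
    by (rule LC_restrict) (auto simp: N'_def B_max_iff intro!: g)
  have L2: "LC N' M (\<lambda>s. (if s \<in> B M then g s else 0) * (f t * chi (s * t)))" for t
  proof (rule LC_mult(1)[OF g'])
    fix x y assume *: "x - y \<in> B N'"
    show "f t * chi (x * t) = f t * chi (y * t)"
    proof (cases "t \<in> B m")
      case True
      then show ?thesis using chi_mult_eqI(1)[OF True B_mono[OF _ *]] by (simp add: N'_def)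
    qed (simp add: LC_outside[OF f])
  qed
  have "I (\<lambda>s. (if s \<in> B M then g s else 0) * hat f s)
      = I (\<lambda>s. I (\<lambda>t. (if s \<in> B M then g s else 0) * (f t * chi (s * t))))"
  proof -
    have "(if s \<in> B M then g s else 0) * hat f s
        = I (\<lambda>t. (if s \<in> B M then g s else 0) * (f t * chi (s * t)))" for s
      using ex_LC_mult_chi[OF f, of s] I_cmult unfolding hat_def by metis
    then show ?thesis by simp
  qed
  also have "\<dots> = I (\<lambda>t. I (\<lambda>s. (if s \<in> B M then g s else 0) * (f t * chi (s * t))))"
    by (rule I_swap[OF _ _ L1 L2]) (auto simp: N'_def n'_def)
  also have "\<dots> = I (\<lambda>t. f t * I (\<lambda>s. if s \<in> B M then g s * chi (t * s) else 0))"
  proof -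
    have "I (\<lambda>s. (if s \<in> B M then g s else 0) * (f t * chi (s * t)))
        = f t * I (\<lambda>s. if s \<in> B M then g s * chi (t * s) else 0)" for t
    proof -
      obtain N'' where L: "LC N'' M (\<lambda>s. (if s \<in> B M then g s else 0) * chi (t * s))"
        using ex_LC_mult_chi[OF g'] by blast
      have "I (\<lambda>s. (if s \<in> B M then g s else 0) * (f t * chi (s * t)))
          = I (\<lambda>s. f t * ((if s \<in> B M then g s else 0) * chi (t * s)))"
        by (simp add: mult_ac)
      also have "\<dots> = f t * I (\<lambda>s. (if s \<in> B M then g s else 0) * chi (t * s))"
        by (rule I_cmult[OF L])
      also have "(\<lambda>s. (if s \<in> B M then g s else 0) * chi (t * s))
          = (\<lambda>s. if s \<in> B M then g s * chi (t * s) else 0)" by auto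
      finally show ?thesis .
    qed
    then show ?thesis by simp
  qed
  finally show ?thesis .
qed

text \<open>After the exchange, the inner integral restricts \<open>t\<close> to a ball around
  \<open>-x\<close> on which \<open>f\<close> is constant; the volumes of this ball and of
  \<open>B M\<close> multiply to \<open>vol c\<close>.\<close>

lemma I_hat_chi:
  assumes "LC n m f"
  shows "I (\<lambda>s. hat f s * chi (x * s)) = vol c * f (- x)"
proof -
  obtain k where k: "x \<in> B k" using ex_B by blast
  \<comment> \<open>Large enough a ball to contain the support of \<open>hat f\<close>, and with a
    dual ball \<open>B (c - M)\<close> inside the invariance of \<open>f\<close>.\<close>
  define M where "M = min m (c - n)"
  have "I (\<lambda>s. hat f s * chi (x * s)) = I (\<lambda>s. (if s \<in> B M then chi (x * s) else 0) * hat f s)"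
    using LC_outside[OF LC_hat[OF assms]] by (intro arg_cong[of _ _ I]) (auto simp: M_def)
  also have "\<dots> = I (\<lambda>t. f t * I (\<lambda>s. if s \<in> B M then chi (x * s) * chi (t * s) else 0))"
    by (rule I_ball_hat[OF assms, of "c - k"]) (rule chi_mult_eqI(2)[OF k])
  also have "(\<lambda>t. f t * I (\<lambda>s. if s \<in> B M then chi (x * s) * chi (t * s) else 0))
      = (\<lambda>t. vol M * f (- x) * (if t + x \<in> B (c - M) then 1 else 0))"
  proof
    fix t
    have "I (\<lambda>s. if s \<in> B M then chi (x * s) * chi (t * s) else 0)
        = I (\<lambda>s. if s \<in> B M then chi ((t + x) * s) else 0)"
      by (intro arg_cong[of _ _ I] ext) (simp add: distrib_right distrib_left chi_add mult.commute)
    also have "\<dots> = (if t + x \<in> B (c - M) then vol M else 0)" by (rule I_ball_chi)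
    moreover have "f t = f (- x)" if "t + x \<in> B (c - M)"
      using B_mono[OF _ that, of n] by (intro LC_inv[OF assms]) (simp add: M_def)
    ultimately show "f t * I (\<lambda>s. if s \<in> B M then chi (x * s) * chi (t * s) else 0)
      = vol M * f (- x) * (if t + x \<in> B (c - M) then 1 else 0)" by simp
  qed
  also have "I \<dots> = vol M * f (- x) * I (\<lambda>t. if t + x \<in> B (c - M) then 1 else 0)"
  proof -
    obtain k where k: "x \<in> B k" using ex_B by blast
    have "LC (c - M) (min k (c - M)) (\<lambda>t. (if t + x \<in> B (c - M) then 1 else 0))"
      by (rule LC_translate[OF LC_mono[OF LC_ball[OF order_refl]]]) (use B_mono[OF _ k] in auto)
    then show ?thesis by (rule I_cmult)
  qed
  also have "I (\<lambda>t. if t + x \<in> B (c - M) then 1 else 0) = vol (c - M)"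
    using I_translate[OF LC_ball[OF order_refl, of "c - M"], of x] I_ball by simp
  finally show ?thesis using vol_add[of M "c - M"] by (simp add: mult_ac)
qed

text \<open>After Fubini the exponent in \<open>s\<close> is \<open>e * s^2 + (t + x) * s\<close>.
  Completing the square moves its centre by \<open>(t + x) / (2 * e)\<close>, and a ball containing
  all these centres is invariant under the translation, so the Gauss integral factors out.\<close>

lemma I_chi_square_hat:
  assumes n2: "(2 :: 'f) \<noteq> 0" and e: "e \<noteq> 0" and f: "LC n m f"
  shows "\<exists>M0. \<forall>M\<le>M0. I (\<lambda>s. chi (e * s\<^sup>2) * hat f s * chi (x * s))
    = gauss M e * (chi (- x\<^sup>2 / (4 * e)) * I (\<lambda>t. f t * chi (- t\<^sup>2 / (4 * e)) * chi (- x * t / (2 * e))))"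
proof -
  have n4: "(4 :: 'f) \<noteq> 0" using n2 by (metis mult_eq_0_iff numeral_Bit0 mult_2)
  obtain k where k: "x \<in> B k" using ex_B by blast
  obtain i where i: "1 / (2 * e) \<in> B i" using ex_B by blast
  obtain v where v: "e \<in> B v" using ex_B by blast
  have quad: "chi (a * s\<^sup>2) = chi (a * s'\<^sup>2)" if "a \<in> B u" "s - s' \<in> B (c - u - w)" "s \<in> B w" "s' \<in> B w" for a s s' u w
  proof (rule chi_eqI)
    have "a * ((s - s') * (s + s')) \<in> B (u + (c - u - w + w))"
      by (intro B_mult that B_add)
    then show "a * s\<^sup>2 - a * s'\<^sup>2 \<in> B c" by (simp add: power2_eq_square algebra_simps)
  qed
  show ?thesis
  \<comment> \<open>The first bound covers the support of \<open>hat f\<close>, the second one all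
    centres \<open>h\<close> for \<open>t\<close> in the support of \<open>f\<close>.\<close>
  proof (rule exI[of _ "min (min m (c - n)) (min m k + i)"], intro allI impI)
    fix M assume M: "M \<le> min (min m (c - n)) (min m k + i)"
    have gs: "LC (max M (c - v - M)) M (\<lambda>s. if s \<in> B M then chi (e * s\<^sup>2) else 0)"
      by (rule LC_restrict) (auto intro!: quad[OF v] simp: B_max_iff)
    have "I (\<lambda>s. chi (e * s\<^sup>2) * hat f s * chi (x * s))
        = I (\<lambda>s. (if s \<in> B M then chi (e * s\<^sup>2) * chi (x * s) else 0) * hat f s)"
    proof -
      have "hat f s = 0" if "s \<notin> B M" for s
      proof (rule LC_outside[OF LC_hat[OF f]])
        show "s \<notin> B (min m (c - n))" using that B_mono[of M "min m (c - n)"] M by auto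
      qed
      then show ?thesis by (intro arg_cong[of _ _ I]) auto
    qed
    also have "\<dots> = I (\<lambda>t. f t * I (\<lambda>s. if s \<in> B M then (chi (e * s\<^sup>2) * chi (x * s)) * chi (t * s) else 0))"
    proof (rule I_ball_hat[OF f, of "max (c - v - M) (c - k)"])
      fix s s' assume *: "s - s' \<in> B (max (c - v - M) (c - k))" "s \<in> B M" "s' \<in> B M"
      have "chi (e * s\<^sup>2) = chi (e * s'\<^sup>2)" by (rule quad[OF v B_mono[OF _ *(1)] *(2,3)]) simp
      moreover have "chi (x * s) = chi (x * s')"
        by (rule chi_mult_eqI(2)[OF k B_mono[OF _ *(1)]]) simp
      ultimately show "chi (e * s\<^sup>2) * chi (x * s) = chi (e * s'\<^sup>2) * chi (x * s')" by simp
    qed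
    also have "\<dots> = I (\<lambda>t. (gauss M e * chi (- x\<^sup>2 / (4 * e))) * (f t * chi (- t\<^sup>2 / (4 * e)) * chi (- x * t / (2 * e))))"
    proof (intro arg_cong[of _ _ I] ext)
      fix t
      show "f t * I (\<lambda>s. if s \<in> B M then (chi (e * s\<^sup>2) * chi (x * s)) * chi (t * s) else 0)
        = (gauss M e * chi (- x\<^sup>2 / (4 * e))) * (f t * chi (- t\<^sup>2 / (4 * e)) * chi (- x * t / (2 * e)))"
      proof (cases "t \<in> B m")
        case True
        define h where "h = (t + x) * (1 / (2 * e))"
        have "t + x \<in> B (min m k)" using True k by (intro B_add) (auto simp: B_min_iff)
        then have "h \<in> B (min m k + i)" unfolding h_def by (rule B_mult[OF _ i])
        then have hM: "h \<in> B M" by (rule B_mono[rotated]) (use M in simp)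
        have eh: "2 * e * h = t + x" using e n2 by (simp add: h_def)
        have sq: "chi (e * s\<^sup>2) * chi (x * s) * chi (t * s) = chi (- e * h\<^sup>2) * chi (e * (s + h)\<^sup>2)" for s
        proof -
          have "e * s\<^sup>2 + x * s + t * s = e * s\<^sup>2 + (t + x) * s" by (simp add: algebra_simps)
          also have "\<dots> = - e * h\<^sup>2 + e * (s + h)\<^sup>2"
            unfolding eh[symmetric] by (simp add: power2_eq_square algebra_simps)
          finally have "chi (e * s\<^sup>2 + x * s + t * s) = chi (- e * h\<^sup>2 + e * (s + h)\<^sup>2)" by (rule arg_cong)
          then show ?thesis by (simp only: chi_add)
        qed
        have "I (\<lambda>s. if s \<in> B M then (chi (e * s\<^sup>2) * chi (x * s)) * chi (t * s) else 0)
            = I (\<lambda>s. chi (- e * h\<^sup>2) * (if s + h \<in> B M then chi (e * (s + h)\<^sup>2) else 0))"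
          unfolding sq B_add_iff[OF hM] by (intro arg_cong[of _ _ I]) auto
        also have "\<dots> = chi (- e * h\<^sup>2) * I (\<lambda>s. if s + h \<in> B M then chi (e * (s + h)\<^sup>2) else 0)"
          by (rule I_cmult[OF LC_translate[OF gs hM]])
        also have "I (\<lambda>s. if s + h \<in> B M then chi (e * (s + h)\<^sup>2) else 0) = gauss M e"
          unfolding gauss_def by (rule I_translate[OF gs])
        also have "- e * h\<^sup>2 = - x\<^sup>2 / (4 * e) + - t\<^sup>2 / (4 * e) + - x * t / (2 * e)"
        proof -
          have "4 * e * (- e * h\<^sup>2) = - ((2 * e * h) * (2 * e * h))"
            by (simp add: power2_eq_square algebra_simps)
          also have "\<dots> = - x\<^sup>2 - t\<^sup>2 - 2 * x * t" unfolding eh by (simp add: power2_eq_square algebra_simps)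
          also have "\<dots> = 4 * e * (- x\<^sup>2 / (4 * e) + - t\<^sup>2 / (4 * e) + - x * t / (2 * e))"
          proof -
            have "4 * e * (- x * t / (2 * e)) = - (2 * x * t)"
              using e n2 by (simp add: field_simps)
            moreover have "4 * e * (- x\<^sup>2 / (4 * e)) = - x\<^sup>2" "4 * e * (- t\<^sup>2 / (4 * e)) = - t\<^sup>2"
              using e n4 by simp_all
            ultimately show ?thesis by (simp only: distrib_left) simp
          qed
          finally show ?thesis using e n4 by (metis mult_cancel_left mult_eq_0_iff)
        qed
        finally show ?thesis by (simp only: chi_add) (simp only: mult_ac)
      qed (simp add: LC_outside[OF f])
    qed
    also have "\<dots> = (gauss M e * chi (- x\<^sup>2 / (4 * e))) * I (\<lambda>t. f t * chi (- t\<^sup>2 / (4 * e)) * chi (- x * t / (2 * e)))"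
    proof -
      obtain j where j: "- 1 / (4 * e) \<in> B j" using ex_B by blast
      have "LC (max n (c - j - m)) m (\<lambda>t. f t * chi (- 1 / (4 * e) * t\<^sup>2))"
      proof (rule LC_mult(1)[OF LC_mono[OF f]])
        fix s s' assume *: "s - s' \<in> B (max n (c - j - m))" "s \<in> B m" "s' \<in> B m"
        then show "chi (- 1 / (4 * e) * s\<^sup>2) = chi (- 1 / (4 * e) * s'\<^sup>2)"
          by (intro quad[OF j _ *(2,3)]) (simp add: B_max_iff)
      qed simp_all
      then obtain n'' where "LC n'' m (\<lambda>t. f t * chi (- 1 / (4 * e) * t\<^sup>2) * chi (- x / (2 * e) * t))"
        using ex_LC_mult_chi by blast
      moreover have "- 1 / (4 * e) * t\<^sup>2 = - t\<^sup>2 / (4 * e)" "- x / (2 * e) * t = - x * t / (2 * e)" for t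
        by simp_all
      ultimately have "LC n'' m (\<lambda>t. f t * chi (- t\<^sup>2 / (4 * e)) * chi (- x * t / (2 * e)))"
        by (simp only:)
      then show ?thesis by (rule I_cmult)
    qed
    finally show "I (\<lambda>s. chi (e * s\<^sup>2) * hat f s * chi (x * s))
      = gauss M e * (chi (- x\<^sup>2 / (4 * e)) * I (\<lambda>t. f t * chi (- t\<^sup>2 / (4 * e)) * chi (- x * t / (2 * e))))"
      by (simp only: mult.assoc)
  qed
qed

text \<open>For the indicator of a ball so small that \<open>chi (- t^2 / (4 * e))\<close> is
  trivial on it, the formula equates an expression free of \<open>M\<close> with
  \<open>gauss M e\<close> times the nonzero \<open>vol k\<close>.\<close>

lemma ex_gauss_limit:
  assumes n2: "(2 :: 'f) \<noteq> 0" and e: "e \<noteq> 0"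
  shows "\<exists>G M0. \<forall>M\<le>M0. gauss M e = G"
proof -
  obtain j where j: "- 1 / (4 * e) \<in> B j" using ex_B by blast
  \<comment> \<open>This gives \<open>j + 2 * k \<ge> c\<close> whatever the signs of
    \<open>c\<close> and \<open>j\<close>.\<close>
  define k where "k = \<bar>c\<bar> + \<bar>j\<bar>"
  have triv: "chi (- t\<^sup>2 / (4 * e)) = 1" if "t \<in> B k" for t
  proof -
    have "- 1 / (4 * e) * (t * t) \<in> B (j + (k + k))" by (intro B_mult j that)
    then have "- t\<^sup>2 / (4 * e) \<in> B (j + (k + k))" by (simp add: power2_eq_square)
    then show ?thesis by (intro chi_triv) (erule B_mono[rotated], simp add: k_def)
  qed
  let ?f = "\<lambda>t. if t \<in> B k then 1 else 0 :: 'r"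
  obtain M0 where M0: "\<forall>M\<le>M0. I (\<lambda>s. chi (e * s\<^sup>2) * hat ?f s * chi (0 * s))
      = gauss M e * (chi (- 0\<^sup>2 / (4 * e)) * I (\<lambda>t. ?f t * chi (- t\<^sup>2 / (4 * e)) * chi (- 0 * t / (2 * e))))"
    using I_chi_square_hat[OF n2 e LC_ball[OF order_refl, of k], of 0] by blast
  have "(\<lambda>t. ?f t * chi (- t\<^sup>2 / (4 * e)) * chi (- 0 * t / (2 * e))) = ?f"
    using triv by auto
  then have *: "I (\<lambda>s. chi (e * s\<^sup>2) * hat ?f s * chi (0 * s)) = gauss M e * vol k" if "M \<le> M0" for M
    using M0 that I_ball[of k] by simp
  have "gauss M e = gauss M0 e" if "M \<le> M0" for M
    using *[OF that] *[OF order_refl] by simp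
  then show ?thesis by blast
qed

text \<open>The balls \<open>B M\<close> exhaust the field as \<open>M\<close> decreases, and \<open>gauss M e\<close> becomes stationary.\<close>

definition G :: "'f \<Rightarrow> 'r" where
  "G e = (SOME G. \<exists>M0. \<forall>M\<le>M0. gauss M e = G)"

lemma gauss_eventually_G:
  assumes "(2 :: 'f) \<noteq> 0" "e \<noteq> 0"
  shows "\<exists>M0. \<forall>M\<le>M0. gauss M e = G e"
  unfolding G_def by (rule someI_ex[OF ex_gauss_limit[OF assms]])

lemma I_chi_square_hat_G:
  assumes "(2 :: 'f) \<noteq> 0" "e \<noteq> 0" "LC n m f"
  shows "I (\<lambda>s. chi (e * s\<^sup>2) * hat f s * chi (x * s))
    = G e * (chi (- x\<^sup>2 / (4 * e)) * I (\<lambda>t. f t * chi (- t\<^sup>2 / (4 * e)) * chi (- x * t / (2 * e))))"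
proof -
  obtain M0 where M0: "\<forall>M\<le>M0. gauss M e = G e" using gauss_eventually_G[OF assms(1,2)] by blast
  obtain M1 where M1: "\<forall>M\<le>M1. I (\<lambda>s. chi (e * s\<^sup>2) * hat f s * chi (x * s))
    = gauss M e * (chi (- x\<^sup>2 / (4 * e)) * I (\<lambda>t. f t * chi (- t\<^sup>2 / (4 * e)) * chi (- x * t / (2 * e))))"
    using I_chi_square_hat[OF assms] by blast
  have "gauss (min M0 M1) e = G e" using M0 by simp
  with M1[rule_format, OF min.cobounded2[of M0 M1]] show ?thesis by (simp only:)
qed

end

section \<open>The topology of the vector space\<close>

locale weil_space = local_char absv \<pi> chi c qi + V: finite_dimensional_vector_space sc Basis
  for absv :: "'f::{field,metric_space} \<Rightarrow> real" and \<pi> :: 'f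
    and chi :: "'f \<Rightarrow> 'r::idom" and c :: int and qi :: 'r
    and sc :: "'f \<Rightarrow> 'x::ab_group_add \<Rightarrow> 'x" and Basis :: "'x set" +
  fixes e0 :: 'x
  assumes e0_Basis: "e0 \<in> Basis"
    and two_neq_0 [simp]: "(2 :: 'f) \<noteq> 0"
begin

section \<open>Coordinates and linear functionals\<close>

definition crd :: "'x \<Rightarrow> 'x \<Rightarrow> 'f" where "crd b x = V.representation Basis x b"

lemma crd_add [simp]: "crd b (x + y) = crd b x + crd b y"
  by (simp add: crd_def V.representation_add V.independent_Basis V.span_Basis)

lemma crd_scale [simp]: "crd b (sc a x) = a * crd b x"
  by (simp add: crd_def V.representation_scale V.independent_Basis V.span_Basis)

lemma crd_0 [simp]: "crd b 0 = 0"
  by (simp add: crd_def V.representation_zero)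

lemma crd_minus [simp]: "crd b (- x) = - crd b x"
  using crd_add[of b x "- x"] by (simp add: eq_neg_iff_add_eq_0 add.commute)

lemma crd_diff [simp]: "crd b (x - y) = crd b x - crd b y"
  using crd_add[of b x "- y"] by simp

lemma crd_Basis: "b' \<in> Basis \<Longrightarrow> crd b b' = (if b = b' then 1 else 0)"
  by (simp add: crd_def V.representation_basis V.independent_Basis)

lemma sum_crd: "(\<Sum>b\<in>Basis. sc (crd b x) b) = x"
  unfolding crd_def by (rule V.sum_representation_eq)
    (auto simp: V.independent_Basis V.span_Basis V.finite_Basis)

lemma dual_iff: "f \<in> dual sc \<longleftrightarrow> (\<forall>x y. f (x + y) = f x + f y) \<and> (\<forall>a x. f (sc a x) = a * f x)"
  unfolding dual_def Vector_Spaces.linear_iff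
  using V.vector_space_axioms vector_space_over_itself.vector_space_axioms[where 'a = 'f] by simp

lemma dual_add: "f \<in> dual sc \<Longrightarrow> f (x + y) = f x + f y"
  and dual_scale: "f \<in> dual sc \<Longrightarrow> f (sc a x) = a * f x"
  by (simp_all add: dual_iff)

lemma dual_0: "f \<in> dual sc \<Longrightarrow> f 0 = 0"
  using dual_scale[of f 0 0] by simp

lemma dual_minus: "f \<in> dual sc \<Longrightarrow> f (- x) = - f x"
  using dual_add[of f x "- x"] dual_0[of f] by (simp add: eq_neg_iff_add_eq_0 add.commute)

lemma dual_diff: "f \<in> dual sc \<Longrightarrow> f (x - y) = f x - f y"
  using dual_add[of f x "- y"] dual_minus[of f y] by simp

lemma crd_dual [simp]: "crd b \<in> dual sc"
  by (simp add: dual_iff)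

lemma dual_eq_sum:
  assumes "f \<in> dual sc" shows "f x = (\<Sum>b\<in>Basis. crd b x * f b)"
proof -
  have "f (\<Sum>b\<in>A. sc (crd b x) b) = (\<Sum>b\<in>A. crd b x * f b)" if "finite A" for A
    using that by (induction A) (simp_all add: dual_0 dual_add dual_scale assms)
  from this[OF V.finite_Basis] show ?thesis by (simp add: sum_crd)
qed

text \<open>The lattice spanned by the basis over the fractional ideal \<open>B n\<close>; these
  lattices turn out to be a neighbourhood basis of 0.\<close>

definition L :: "int \<Rightarrow> 'x set" where
  "L n = {x. \<forall>b\<in>Basis. crd b x \<in> B n}"

lemma L_0 [simp]: "0 \<in> L n"
  by (simp add: L_def)

lemma L_add: "x \<in> L n \<Longrightarrow> y \<in> L n \<Longrightarrow> x + y \<in> L n"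
  by (auto simp: L_def intro: B_add)

lemma L_minus [simp]: "- x \<in> L n \<longleftrightarrow> x \<in> L n"
  by (simp add: L_def)

lemma L_diff: "x \<in> L n \<Longrightarrow> y \<in> L n \<Longrightarrow> x - y \<in> L n"
  using L_add[of x n "- y"] by simp

lemma L_diff_commute: "x - y \<in> L n \<longleftrightarrow> y - x \<in> L n"
  using L_minus[of "x - y"] by simp

lemma L_add_iff: "y \<in> L n \<Longrightarrow> x + y \<in> L n \<longleftrightarrow> x \<in> L n"
  using L_add[of x n y] L_diff[of "x + y" n y] by auto

lemma L_mono: "n \<le> m \<Longrightarrow> x \<in> L m \<Longrightarrow> x \<in> L n"
  by (auto simp: L_def intro: B_mono)

lemma L_max_iff: "x \<in> L (max a b) \<longleftrightarrow> x \<in> L a \<and> x \<in> L b"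
  by (auto simp: L_def B_max_iff)

lemma B_bound:
  assumes "finite A" shows "\<exists>k. \<forall>b\<in>A. f b \<in> B k"
  using assms
proof (induction A)
  case (insert a A)
  then obtain k where "\<forall>b\<in>A. f b \<in> B k" by blast
  moreover obtain l where "f a \<in> B l" using ex_B by blast
  ultimately show ?case by (intro exI[of _ "min k l"]) (auto simp: B_min_iff)
qed simp

lemma ex_L: "\<exists>k. x \<in> L k"
  using B_bound[OF V.finite_Basis, of "\<lambda>b. crd b x"] by (simp add: L_def)

lemma sum_in_B: "(\<And>b. b \<in> A \<Longrightarrow> f b \<in> B n) \<Longrightarrow> sum f A \<in> B n"
  by (induction A rule: infinite_finite_induct) (auto intro: B_add)

lemma dual_bound:
  assumes "f \<in> dual sc" shows "\<exists>k. \<forall>n. \<forall>x\<in>L n. f x \<in> B (n + k)"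
proof -
  obtain k where k: "\<forall>b\<in>Basis. f b \<in> B k" using B_bound[OF V.finite_Basis, of f] by blast
  have "f x \<in> B (n + k)" if "x \<in> L n" for x n
  proof -
    have "(\<Sum>b\<in>Basis. crd b x * f b) \<in> B (n + k)"
      using that k by (intro sum_in_B B_mult) (auto simp: L_def)
    then show ?thesis by (simp only: dual_eq_sum[OF assms, of x, symmetric])
  qed
  then show ?thesis by blast
qed

section \<open>The topology of functionals as the lattice topology\<close>

lemma open_coset: "open {x. x - y \<in> B n}"
  unfolding open_dist
proof (intro ballI exI[of _ "absv \<pi> powi n"] conjI allI impI)
  show "absv \<pi> powi n > 0" using pi_pos by simp
  fix x z assume "x \<in> {x. x - y \<in> B n}" "dist z x < absv \<pi> powi n"
  then show "z \<in> {x. x - y \<in> B n}"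
    using B_add[of "x - y" n "z - x"] by (simp add: dist_absv B_def)
qed

lemma open_contains_coset:
  assumes "open U" "y \<in> U" shows "\<exists>n. \<forall>x. x - y \<in> B n \<longrightarrow> x \<in> U"
proof -
  obtain r where r: "r > 0" "\<And>x. dist x y < r \<Longrightarrow> x \<in> U" using assms unfolding open_dist by blast
  obtain n where "\<forall>x\<in>B n. absv x < r" using ex_B_small[OF r(1)] by blast
  then show ?thesis using r(2) by (auto simp: dist_absv)
qed

lemma topspace_vs [simp]: "topspace (vs_topology sc) = UNIV"
proof -
  have "crd e0 -` UNIV \<in> {f -` V | f V. f \<in> dual sc \<and> open V}"
    using crd_dual open_UNIV by blast
  then have "UNIV \<in> {f -` V | f V. f \<in> dual sc \<and> open V}" by (simp only: vimage_UNIV)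
  then show ?thesis unfolding vs_topology_def topology_generated_by_topspace by blast
qed

text \<open>By \<open>dual_bound\<close> functionals are continuous for the lattice topology;
  conversely a coset of a lattice is a finite intersection of preimages under coordinate
  functionals.\<close>

lemma openin_vs_iff:
  "openin (vs_topology sc) U \<longleftrightarrow> (\<forall>x\<in>U. \<exists>n. \<forall>y. y - x \<in> L n \<longrightarrow> y \<in> U)"
proof
  assume "openin (vs_topology sc) U"
  then have "generate_topology_on {f -` V | f V. f \<in> dual sc \<and> open V} U"
    unfolding vs_topology_def openin_topology_generated_by_iff .
  then show "\<forall>x\<in>U. \<exists>n. \<forall>y. y - x \<in> L n \<longrightarrow> y \<in> U"
  proof induction
    case (Int a b)
    show ?case
    proof
      fix x assume x: "x \<in> a \<inter> b"
      obtain n m where "\<forall>y. y - x \<in> L n \<longrightarrow> y \<in> a" "\<forall>y. y - x \<in> L m \<longrightarrow> y \<in> b"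
        using Int.IH x by blast
      then show "\<exists>n. \<forall>y. y - x \<in> L n \<longrightarrow> y \<in> a \<inter> b"
        by (intro exI[of _ "max n m"]) (simp add: L_max_iff)
    qed
  next
    case (UN K)
    then show ?case by (meson Union_iff)
  next
    case (Basis s)
    then obtain f V where s: "s = f -` V" "f \<in> dual sc" "open V" by blast
    obtain k where k: "\<forall>n. \<forall>x\<in>L n. f x \<in> B (n + k)" using dual_bound[OF s(2)] by blast
    show ?case
    proof
      fix x assume "x \<in> s"
      then obtain n where n: "\<forall>y. y - f x \<in> B n \<longrightarrow> y \<in> V"
        using open_contains_coset[OF s(3)] s(1) by blast
      have "y \<in> s" if "y - x \<in> L (n - k)" for y
      proof -
        have "f (y - x) \<in> B (n - k + k)" using k that by blast
        then have "f y - f x \<in> B n" by (simp add: dual_diff[OF s(2)])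
        then show ?thesis using n s(1) by simp
      qed
      then show "\<exists>n. \<forall>y. y - x \<in> L n \<longrightarrow> y \<in> s" by blast
    qed
  qed simp
next
  assume *: "\<forall>x\<in>U. \<exists>n. \<forall>y. y - x \<in> L n \<longrightarrow> y \<in> U"
  show "openin (vs_topology sc) U"
  proof (subst openin_subopen, intro ballI)
    fix x assume "x \<in> U"
    then obtain n where n: "\<forall>y. y - x \<in> L n \<longrightarrow> y \<in> U" using * by blast
    let ?T = "\<Inter>b\<in>Basis. crd b -` {z. z - crd b x \<in> B n}"
    have "openin (vs_topology sc) ?T"
    proof (rule openin_INT2)
      show "openin (vs_topology sc) (crd b -` {z. z - crd b x \<in> B n})" for b
        unfolding vs_topology_def
        by (rule topology_generated_by_Basis) (use open_coset crd_dual in blast)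
    qed (use V.finite_Basis e0_Basis in auto)
    moreover have "?T \<subseteq> U" using n by (auto simp: L_def)
    moreover have "x \<in> ?T" by simp
    ultimately show "\<exists>T. openin (vs_topology sc) T \<and> x \<in> T \<and> T \<subseteq> U" by blast
  qed
qed

lemma openin_coset: "openin (vs_topology sc) {y. y - x \<in> L n}"
  unfolding openin_vs_iff
proof (intro ballI exI allI impI)
  fix y z assume "y \<in> {y. y - x \<in> L n}" "z - y \<in> L n"
  then show "z \<in> {y. y - x \<in> L n}" using L_add[of "y - x" n "z - y"] by simp
qed

lemma closedin_L: "closedin (vs_topology sc) (L n)"
  unfolding closedin_def
proof
  show "openin (vs_topology sc) (topspace (vs_topology sc) - L n)"
    unfolding openin_vs_iff
  proof (intro ballI exI allI impI)
    fix x y assume "x \<in> topspace (vs_topology sc) - L n" "y - x \<in> L n"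
    then show "y \<in> topspace (vs_topology sc) - L n" using L_diff[of y n "y - x"] by auto
  qed
qed simp

text \<open>A lattice is the image of a product of compact balls under the map that assembles a
  vector from its coordinates.\<close>

lemma compactin_L: "compactin (vs_topology sc) (L m)"
proof -
  let ?P = "product_topology (\<lambda>_. euclidean) Basis"
  define g :: "('x \<Rightarrow> 'f) \<Rightarrow> 'x" where "g u = (\<Sum>b\<in>Basis. sc (u b) b)" for u
  have crd_g: "crd b (g u) = u b" if "b \<in> Basis" for b u
  proof -
    have "crd b (\<Sum>b'\<in>A. sc (u b') b') = (\<Sum>b'\<in>A. u b' * crd b b')" if "finite A" for A
      using that by (induction A) simp_all
    then have "crd b (g u) = (\<Sum>b'\<in>Basis. u b' * crd b b')"
      unfolding g_def using V.finite_Basis by blast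
    also have "\<dots> = (\<Sum>b'\<in>Basis. if b = b' then u b' else 0)"
      by (intro sum.cong refl) (simp add: crd_Basis)
    finally show ?thesis using that V.finite_Basis by simp
  qed
  have "continuous_map ?P (vs_topology sc) g"
    unfolding continuous_map_def
  proof (intro conjI allI impI)
    fix U assume U: "openin (vs_topology sc) U"
    show "openin ?P {u \<in> topspace ?P. g u \<in> U}"
    proof (subst openin_subopen, intro ballI)
      fix u assume u: "u \<in> {u \<in> topspace ?P. g u \<in> U}"
      then obtain n where n: "\<forall>y. y - g u \<in> L n \<longrightarrow> y \<in> U" using U unfolding openin_vs_iff by blast
      let ?T = "PiE Basis (\<lambda>b. {z. z - u b \<in> B n})"
      have "openin ?P ?T" using open_coset by (subst openin_PiE) (auto simp: V.finite_Basis)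
      moreover have "u \<in> ?T" using u by (auto simp: PiE_iff)
      moreover have "?T \<subseteq> {u \<in> topspace ?P. g u \<in> U}"
      proof
        fix w assume w: "w \<in> ?T"
        then have "g w - g u \<in> L n" by (auto simp: L_def crd_g PiE_iff)
        then show "w \<in> {u \<in> topspace ?P. g u \<in> U}" using n w by (auto simp: PiE_iff)
      qed
      ultimately show "\<exists>T. openin ?P T \<and> u \<in> T \<and> T \<subseteq> {u \<in> topspace ?P. g u \<in> U}" by blast
    qed
  qed simp
  moreover have "compactin ?P (PiE Basis (\<lambda>_. B m))"
    using compact_ball by (simp add: compactin_PiE B_def)
  ultimately have "compactin (vs_topology sc) (g ` PiE Basis (\<lambda>_. B m))"
    by (rule image_compactin[rotated])
  moreover have "g ` PiE Basis (\<lambda>_. B m) = L m"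
  proof (intro equalityI subsetI)
    fix x assume "x \<in> g ` PiE Basis (\<lambda>_. B m)"
    then show "x \<in> L m" by (auto simp: L_def crd_g PiE_iff)
  next
    fix x assume x: "x \<in> L m"
    have "g (\<lambda>b\<in>Basis. crd b x) = (\<Sum>b\<in>Basis. sc (crd b x) b)"
      unfolding g_def by (rule sum.cong) simp_all
    then have "x = g (\<lambda>b\<in>Basis. crd b x)" by (simp only: sum_crd)
    moreover have "(\<lambda>b\<in>Basis. crd b x) \<in> PiE Basis (\<lambda>_. B m)" using x by (auto simp: L_def)
    ultimately show "x \<in> g ` PiE Basis (\<lambda>_. B m)" by blast
  qed
  ultimately show ?thesis by simp
qed

section \<open>Schwartz functions by levels of invariance and support\<close>

definition SX :: "int \<Rightarrow> int \<Rightarrow> ('x \<Rightarrow> 'r) \<Rightarrow> bool" where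
  "SX n m \<Phi> \<longleftrightarrow> m \<le> n \<and> (\<forall>x y. x - y \<in> L n \<longrightarrow> \<Phi> x = \<Phi> y) \<and> (\<forall>x. x \<notin> L m \<longrightarrow> \<Phi> x = 0)"

lemma SX_inv: "SX n m \<Phi> \<Longrightarrow> x - y \<in> L n \<Longrightarrow> \<Phi> x = \<Phi> y"
  and SX_outside: "SX n m \<Phi> \<Longrightarrow> x \<notin> L m \<Longrightarrow> \<Phi> x = 0"
  and SX_le: "SX n m \<Phi> \<Longrightarrow> m \<le> n"
  by (auto simp: SX_def)

lemma SX_mono: "SX n m \<Phi> \<Longrightarrow> n \<le> N \<Longrightarrow> M \<le> m \<Longrightarrow> SX N M \<Phi>"
  unfolding SX_def using L_mono by (meson order_trans)

text \<open>Finitely many cosets of local constancy cover the closed support, so the extreme levels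
  among them work for the whole function; off the support the value is 0.\<close>

lemma S_space_imp_SX:
  assumes "\<Phi> \<in> S_space sc" shows "\<exists>n m. SX n m \<Phi>"
proof -
  let ?V = "vs_topology sc" and ?K = "vs_topology sc closure_of {x. \<Phi> x \<noteq> 0}"
  have K: "compactin ?V ?K" and lc: "locally_constant ?V \<Phi>"
    using assms by (auto simp: S_space_def compactly_supported_def)
  have sub: "x \<in> ?K" if "\<Phi> x \<noteq> 0" for x
    using closure_of_subset[of "{x. \<Phi> x \<noteq> 0}" ?V] that by auto
  have "\<forall>x. \<exists>n. \<forall>y. y - x \<in> L n \<longrightarrow> \<Phi> y = \<Phi> x"
  proof
    fix x
    obtain U where U: "openin ?V U" "x \<in> U" "\<forall>y\<in>U. \<Phi> y = \<Phi> x"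
      using lc unfolding locally_constant_def by auto
    then obtain n where "\<forall>y. y - x \<in> L n \<longrightarrow> y \<in> U" unfolding openin_vs_iff by blast
    then show "\<exists>n. \<forall>y. y - x \<in> L n \<longrightarrow> \<Phi> y = \<Phi> x" using U(3) by blast
  qed
  from choice[OF this] obtain N where N: "\<And>x y. y - x \<in> L (N x) \<Longrightarrow> \<Phi> y = \<Phi> x" by blast
  have "\<forall>x. \<exists>k. x \<in> L k" using ex_L by blast
  from choice[OF this] obtain M where M: "\<And>x. x \<in> L (M x)" by blast
  \<comment> \<open>A coset on which \<Phi> is constant and which, as \<open>x\<close> is in
    \<open>L (M x)\<close>, stays inside that lattice.\<close>
  define W where "W x = {y. y - x \<in> L (max (N x) (M x))}" for x
  have "\<exists>F. finite F \<and> F \<subseteq> range W \<and> ?K \<subseteq> \<Union>F"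
  proof -
    have "?K \<subseteq> \<Union>(range W)"
    proof
      fix x
      have "x \<in> W x" by (simp add: W_def)
      then show "x \<in> \<Union>(range W)" by blast
    qed
    moreover have "\<forall>U\<in>range W. openin ?V U" using openin_coset by (auto simp: W_def)
    ultimately show ?thesis using K unfolding compactin_def by blast
  qed
  then obtain F where F: "finite F" "F \<subseteq> range W" "?K \<subseteq> \<Union>F" by blast
  from finite_subset_image[OF F(1,2)] F(3) obtain A where A: "finite A" "?K \<subseteq> (\<Union>x\<in>A. W x)"
    by blast
  have "\<exists>n. \<forall>x\<in>A. N x \<le> n \<and> M x \<le> n \<and> - n \<le> M x" using A(1)
  proof (induction A)
    case (insert a A)
    then obtain n where n: "\<forall>x\<in>A. N x \<le> n \<and> M x \<le> n \<and> - n \<le> M x" by blast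
    show ?case
      by (rule exI[of _ "max n (max \<bar>M a\<bar> \<bar>N a\<bar>)"]) (use n in auto)
  qed simp
  then obtain n where n: "\<And>x. x \<in> A \<Longrightarrow> N x \<le> n \<and> M x \<le> n \<and> - n \<le> M x" by blast
  have cov: "\<Phi> y = \<Phi> z" if "y \<in> ?K" "z - y \<in> L (max n 0)" for y z
  proof -
    obtain x where x: "x \<in> A" "y - x \<in> L (max (N x) (M x))" using A(2) \<open>y \<in> ?K\<close> by (auto simp: W_def)
    then have yx: "y - x \<in> L (N x)" by (simp add: L_max_iff)
    have "z - y \<in> L (N x)" using that(2) n[OF x(1)] by (intro L_mono[of "N x" "max n 0"]) auto
    then have "z - x \<in> L (N x)" using L_add[OF _ yx, of "z - y"] by simp
    then show ?thesis using N[OF yx] N[of z x] by simp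
  qed
  have "SX (max n 0) (min (- n) 0) \<Phi>"
    unfolding SX_def
  proof (intro conjI allI impI)
    fix x y assume xy: "x - y \<in> L (max n 0)"
    show "\<Phi> x = \<Phi> y"
    proof (cases "x \<in> ?K")
      case True
      show ?thesis by (rule cov[OF True]) (rule iffD1[OF L_diff_commute xy])
    next
      case False
      then have "\<Phi> x = 0" using sub by blast
      moreover have "\<Phi> y = \<Phi> x" if "y \<in> ?K" by (rule cov[OF that xy])
      moreover have "\<Phi> y = 0" if "y \<notin> ?K" using sub that by blast
      ultimately show ?thesis by (cases "y \<in> ?K") simp_all
    qed
  next
    fix y assume y: "y \<notin> L (min (- n) 0)"
    show "\<Phi> y = 0"
    proof (rule ccontr)
      assume "\<Phi> y \<noteq> 0"
      then obtain x where x: "x \<in> A" "y - x \<in> L (max (N x) (M x))"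
        using A(2) sub[of y] by (auto simp: W_def)
      then have "y \<in> L (M x)" using L_add[OF _ M[of x], of "y - x"] by (simp add: L_max_iff)
      then have "y \<in> L (min (- n) 0)" by (rule L_mono[rotated]) (use n[OF x(1)] in auto)
      then show False using y by blast
    qed
  qed auto
  then show ?thesis by blast
qed

lemma SX_imp_S_space:
  assumes "SX n m \<Phi>" shows "\<Phi> \<in> S_space sc"
proof -
  let ?V = "vs_topology sc"
  have "locally_constant ?V \<Phi>"
    unfolding locally_constant_def
  proof
    fix x
    have "\<forall>y\<in>{y. y - x \<in> L n}. \<Phi> y = \<Phi> x" using SX_inv[OF assms] by blast
    moreover have "x \<in> {y. y - x \<in> L n}" by simp
    ultimately show "\<exists>U. openin ?V U \<and> x \<in> U \<and> (\<forall>y\<in>U. \<Phi> y = \<Phi> x)"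
      using openin_coset[of x n] by blast
  qed
  moreover have "{x. \<Phi> x \<noteq> 0} \<subseteq> L m" using SX_outside[OF assms] by blast
  then have "?V closure_of {x. \<Phi> x \<noteq> 0} \<subseteq> L m" by (rule closure_of_minimal[OF _ closedin_L])
  then have "compactly_supported ?V \<Phi>"
    unfolding compactly_supported_def by (rule closed_compactin[OF compactin_L]) simp
  ultimately show ?thesis by (simp add: S_space_def)
qed

lemma S_space_iff: "\<Phi> \<in> S_space sc \<longleftrightarrow> (\<exists>n m. SX n m \<Phi>)"
  using S_space_imp_SX SX_imp_S_space by blast

section \<open>Operators on Schwartz functions\<close>

abbreviation eps :: "'x \<Rightarrow> 'f" where "eps \<equiv> crd e0"

text \<open>The point with coordinate \<open>s\<close> on the line through \<open>x\<close> in direction \<open>e0\<close>.\<close>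

definition pt :: "'x \<Rightarrow> 'f \<Rightarrow> 'x" where "pt x s = x + sc (s - eps x) e0"

lemma crd_pt: "b \<in> Basis \<Longrightarrow> crd b (pt x s) = (if b = e0 then s else crd b x)"
  by (simp add: pt_def crd_Basis e0_Basis)

lemma eps_e0 [simp]: "eps e0 = 1"
  by (simp add: crd_Basis e0_Basis)

lemma eps_pt [simp]: "eps (pt x s) = s"
  by (simp add: crd_pt e0_Basis)

lemma pt_pt [simp]: "pt (pt x s) t = pt x t"
  by (simp add: pt_def add.assoc flip: V.scale_left_distrib)

lemma pt_eps [simp]: "pt x (eps x) = x"
  by (simp add: pt_def)

lemma pt_add: "pt (x + y) (s + t) = pt x s + pt y t"
proof -
  have "s + t - eps (x + y) = (s - eps x) + (t - eps y)" by simp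
  then show ?thesis unfolding pt_def by (simp only: V.scale_left_distrib add_ac)
qed

lemma pt_scale: "pt (sc a x) (a * s) = sc a (pt x s)"
proof -
  have "a * s - eps (sc a x) = a * (s - eps x)" by (simp add: right_diff_distrib)
  then show ?thesis unfolding pt_def by (simp only: V.scale_right_distrib V.scale_scale)
qed

lemma pt_diff: "pt x s - pt y t = pt (x - y) (s - t)"
  using pt_add[of "x - y" y "s - t" t] by simp

lemma pt_same_diff: "pt x s - pt x t = pt 0 (s - t)"
  by (simp add: pt_diff)

lemma dual_pt: "f \<in> dual sc \<Longrightarrow> f (pt x s) = f x + (s - eps x) * f e0"
  by (simp add: pt_def dual_add dual_scale)

lemma pt_in_L: "pt x s \<in> L m \<longleftrightarrow> s \<in> B m \<and> (\<forall>b\<in>Basis - {e0}. crd b x \<in> B m)"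
  using e0_Basis by (auto simp: L_def crd_pt)

lemma L_iff: "x \<in> L m \<longleftrightarrow> eps x \<in> B m \<and> (\<forall>b\<in>Basis - {e0}. crd b x \<in> B m)"
  using pt_in_L[of x "eps x" m] by simp

lemma L_minI: "x \<in> L a \<Longrightarrow> x \<in> L (min a b)" "x \<in> L b \<Longrightarrow> x \<in> L (min a b)"
  by (auto simp: L_def B_min_iff)

lemma LC_pt: "SX n m \<Phi> \<Longrightarrow> LC n m (\<lambda>s. \<Phi> (pt x s))"
  unfolding LC_def
proof (intro conjI allI impI)
  assume S: "SX n m \<Phi>"
  show "m \<le> n" by (rule SX_le[OF S])
  show "\<Phi> (pt x s) = \<Phi> (pt x t)" if "s - t \<in> B n" for s t
    by (rule SX_inv[OF S]) (use that in \<open>simp add: pt_same_diff pt_in_L\<close>)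
  show "\<Phi> (pt x s) = 0" if "s \<notin> B m" for s
    by (rule SX_outside[OF S]) (use that in \<open>simp add: pt_in_L\<close>)
qed

definition opN :: "'f \<Rightarrow> ('x \<Rightarrow> 'r) \<Rightarrow> 'x \<Rightarrow> 'r" where
  "opN b \<Phi> x = chi (b * (eps x)\<^sup>2) * \<Phi> x"

definition opM :: "'f \<Rightarrow> ('x \<Rightarrow> 'r) \<Rightarrow> 'x \<Rightarrow> 'r" where
  "opM a \<Phi> x = \<Phi> (pt x (a * eps x))"

definition opF :: "('x \<Rightarrow> 'r) \<Rightarrow> 'x \<Rightarrow> 'r" where
  "opF \<Phi> x = hat (\<lambda>s. \<Phi> (pt x s)) (eps x)"

text \<open>\<open>U_op\<close> without its restriction to the Schwartz space, so that identities of
  operators can be checked pointwise; \<open>U_op_eq\<close> is the link.\<close>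

definition opU :: "'x \<Rightarrow> ('x \<Rightarrow> 'f) \<Rightarrow> 'r \<Rightarrow> ('x \<Rightarrow> 'r) \<Rightarrow> 'x \<Rightarrow> 'r" where
  "opU v f t \<Phi> x = t * \<Phi> (x + v) * chi (f x)"

definition opZ :: "'r \<Rightarrow> ('x \<Rightarrow> 'r) \<Rightarrow> 'x \<Rightarrow> 'r" where
  "opZ t \<Phi> x = t * \<Phi> x"

section \<open>Stability of the Schwartz space\<close>

lemma SX_mult_left:
  assumes S: "SX n m \<Phi>" and g: "\<And>x y. x - y \<in> L n \<Longrightarrow> x \<in> L m \<Longrightarrow> y \<in> L m \<Longrightarrow> g x = g y"
  shows "SX n m (\<lambda>x. g x * \<Phi> x)"
  unfolding SX_def
proof (intro conjI allI impI)
  show "m \<le> n" by (rule SX_le[OF S])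
  show "g x * \<Phi> x = g y * \<Phi> y" if "x - y \<in> L n" for x y
  proof (cases "x \<in> L m \<and> y \<in> L m")
    case True
    then show ?thesis using g[OF that] SX_inv[OF S that] by simp
  next
    case False
    then show ?thesis using SX_outside[OF S] SX_inv[OF S that] by auto
  qed
  show "g x * \<Phi> x = 0" if "x \<notin> L m" for x using SX_outside[OF S that] by simp
qed

lemma opN_S: assumes "\<Phi> \<in> S_space sc" shows "opN b \<Phi> \<in> S_space sc"
proof -
  obtain n m where S: "SX n m \<Phi>" using assms S_space_iff by blast
  obtain k where k: "b \<in> B k" using ex_B by blast
  have "SX (max n (c - k - m)) m (\<lambda>x. chi (b * (eps x)\<^sup>2) * \<Phi> x)"
  proof (rule SX_mult_left[OF SX_mono[OF S]], simp, simp)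
    fix x y assume *: "x - y \<in> L (max n (c - k - m))" "x \<in> L m" "y \<in> L m"
    have d: "eps x - eps y \<in> B (c - k - m)" using *(1) by (simp add: L_max_iff L_iff[of "x - y"])
    have s: "eps x + eps y \<in> B m" using *(2,3) by (auto simp: L_iff intro: B_add)
    have "b * ((eps x - eps y) * (eps x + eps y)) \<in> B (k + (c - k - m + m))"
      by (intro B_mult k d s)
    then show "chi (b * (eps x)\<^sup>2) = chi (b * (eps y)\<^sup>2)"
      by (intro chi_eqI) (simp add: power2_eq_square algebra_simps)
  qed
  then show ?thesis using S_space_iff opN_def[abs_def] by auto
qed

lemma opM_S: assumes "a \<noteq> 0" "\<Phi> \<in> S_space sc" shows "opM a \<Phi> \<in> S_space sc"
proof -
  obtain n m where S: "SX n m \<Phi>" using assms S_space_iff by blast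
  obtain k where k: "absv a = absv \<pi> powi k" using ex_val[OF assms(1)] by blast
  \<comment> \<open>Only the coordinate along \<open>e0\<close> is rescaled; the others keep the
    levels \<open>n\<close> and \<open>m\<close>, hence the maximum and minimum.\<close>
  have "SX (max n (n - k)) (min m (m - k)) (opM a \<Phi>)"
    unfolding SX_def
  proof (intro conjI allI impI)
    show "min m (m - k) \<le> max n (n - k)" using SX_le[OF S] by auto
    fix x y assume *: "x - y \<in> L (max n (n - k))"
    have "pt x (a * eps x) - pt y (a * eps y) \<in> L n"
      using * B_scale[OF k, of "eps x - eps y" n]
      by (simp add: pt_diff pt_in_L L_max_iff L_iff[of "x - y"] right_diff_distrib)
    then show "opM a \<Phi> x = opM a \<Phi> y" unfolding opM_def by (rule SX_inv[OF S])
  next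
    fix x assume *: "x \<notin> L (min m (m - k))"
    have "pt x (a * eps x) \<notin> L m"
    proof
      assume "pt x (a * eps x) \<in> L m"
      then have "eps x \<in> B (m - k)" "\<forall>b\<in>Basis - {e0}. crd b x \<in> B m"
        unfolding pt_in_L using B_scale[OF k, of "eps x" m] by auto
      then have "x \<in> L (min m (m - k))" by (simp add: L_iff B_min_iff)
      then show False using * by blast
    qed
    then show "opM a \<Phi> x = 0" unfolding opM_def by (rule SX_outside[OF S])
  qed
  then show ?thesis using S_space_iff by blast
qed

lemma opF_S: assumes "\<Phi> \<in> S_space sc" shows "opF \<Phi> \<in> S_space sc"
proof -
  obtain n m where S: "SX n m \<Phi>" using assms S_space_iff by blast
  have "SX (max n (c - m)) (min m (c - n)) (opF \<Phi>)"
    unfolding SX_def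
  proof (intro conjI allI impI)
    show "min m (c - n) \<le> max n (c - m)" using SX_le[OF S] by auto
    fix x y assume *: "x - y \<in> L (max n (c - m))"
    then have e: "eps x - eps y \<in> B (max n (c - m))" by (simp add: L_iff)
    have "(\<lambda>s. \<Phi> (pt x s)) = (\<lambda>s. \<Phi> (pt y s))"
    proof (rule ext, rule SX_inv[OF S])
      fix s show "pt x s - pt y s \<in> L n" using * by (simp add: pt_diff pt_in_L L_max_iff L_iff[of "x - y"])
    qed
    then show "opF \<Phi> x = opF \<Phi> y"
      unfolding opF_def using LC_inv[OF LC_hat[OF LC_pt[OF S]] e] by simp
  next
    fix x assume *: "x \<notin> L (min m (c - n))"
    show "opF \<Phi> x = 0"
    proof (cases "eps x \<in> B (min m (c - n))")
      case True
      then obtain b where b: "b \<in> Basis - {e0}" "crd b x \<notin> B (min m (c - n))" using * L_iff by blast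
      then have "crd b x \<notin> B m" by (simp add: B_min_iff)
      then have "\<Phi> (pt x s) = 0" for s using b(1) by (intro SX_outside[OF S]) (auto simp: pt_in_L)
      then show ?thesis by (simp add: opF_def hat_def)
    next
      case False
      then show ?thesis unfolding opF_def by (rule LC_outside[OF LC_hat[OF LC_pt[OF S]]])
    qed
  qed
  then show ?thesis using S_space_iff by blast
qed

lemma opU_S: assumes "f \<in> dual sc" "\<Phi> \<in> S_space sc" shows "opU v f t \<Phi> \<in> S_space sc"
proof -
  obtain n m where S: "SX n m \<Phi>" using assms S_space_iff by blast
  obtain k where k: "v \<in> L k" using ex_L by blast
  obtain l where l: "\<forall>n. \<forall>x\<in>L n. f x \<in> B (n + l)" using dual_bound[OF assms(1)] by blast
  have "SX n (min m k) (\<lambda>x. \<Phi> (x + v))"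
    unfolding SX_def
  proof (intro conjI allI impI)
    show "min m k \<le> n" using SX_le[OF S] by simp
    show "\<Phi> (x + v) = \<Phi> (y + v)" if "x - y \<in> L n" for x y
      by (rule SX_inv[OF S]) (use that in simp)
    show "\<Phi> (x + v) = 0" if x: "x \<notin> L (min m k)" for x
    proof (rule SX_outside[OF S], rule notI)
      assume "x + v \<in> L m"
      then have "x + v \<in> L (min m k)" by (rule L_minI)
      moreover have "v \<in> L (min m k)" using k by (rule L_minI)
      ultimately show False using L_add_iff x by blast
    qed
  qed
  then have "SX (max n (c - l)) (min m k) (\<lambda>x. \<Phi> (x + v))" by (rule SX_mono) auto
  then have "SX (max n (c - l)) (min m k) (\<lambda>x. (t * chi (f x)) * \<Phi> (x + v))"
  proof (rule SX_mult_left)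
    fix x y assume "x - y \<in> L (max n (c - l))"
    then have "f (x - y) \<in> B (c - l + l)" using l by (simp only: L_max_iff)
    then have "chi (f x) = chi (f y)" by (intro chi_eqI) (simp add: dual_diff[OF assms(1)])
    then show "t * chi (f x) = t * chi (f y)" by simp
  qed
  moreover have "(\<lambda>x. (t * chi (f x)) * \<Phi> (x + v)) = opU v f t \<Phi>"
    by (auto simp: opU_def mult_ac)
  ultimately show ?thesis using S_space_iff by auto
qed

lemma opZ_S: assumes "\<Phi> \<in> S_space sc" shows "opZ t \<Phi> \<in> S_space sc"
proof -
  obtain n m where S: "SX n m \<Phi>" using assms S_space_iff by blast
  have "SX n m (\<lambda>x. t * \<Phi> x)" by (rule SX_mult_left[OF S]) simp
  then have "SX n m (opZ t \<Phi>)" unfolding opZ_def[abs_def] .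
  then show ?thesis using S_space_iff by blast
qed

lemma opF_add:
  assumes "\<Phi> \<in> S_space sc" "\<Psi> \<in> S_space sc"
  shows "opF (\<lambda>x. \<Phi> x + \<Psi> x) = (\<lambda>x. opF \<Phi> x + opF \<Psi> x)"
proof
  fix x
  obtain n m n' m' where S: "SX n m \<Phi>" "SX n' m' \<Psi>" using assms S_space_iff by blast
  obtain k l where "LC k m (\<lambda>t. \<Phi> (pt x t) * chi (eps x * t))" "LC l m' (\<lambda>t. \<Psi> (pt x t) * chi (eps x * t))"
    using ex_LC_mult_chi[OF LC_pt[OF S(1)]] ex_LC_mult_chi[OF LC_pt[OF S(2)]] by blast
  from I_add[OF this] show "opF (\<lambda>x. \<Phi> x + \<Psi> x) x = opF \<Phi> x + opF \<Psi> x"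
    by (simp add: opF_def hat_def distrib_right)
qed

lemma opF_cmult:
  assumes "\<Phi> \<in> S_space sc"
  shows "opF (\<lambda>x. a * \<Phi> x) = (\<lambda>x. a * opF \<Phi> x)"
proof
  fix x
  obtain n m where S: "SX n m \<Phi>" using assms S_space_iff by blast
  obtain k where "LC k m (\<lambda>t. \<Phi> (pt x t) * chi (eps x * t))"
    using ex_LC_mult_chi[OF LC_pt[OF S]] by blast
  from I_cmult[OF this] show "opF (\<lambda>x. a * \<Phi> x) x = a * opF \<Phi> x"
    by (simp add: opF_def hat_def mult.assoc)
qed

section \<open>Relations among the operators\<close>

lemma opN_opN: "opN b (opN b' \<Phi>) = opN (b + b') \<Phi>"
  by (rule ext) (simp add: opN_def chi_add distrib_right mult.assoc)

lemma opM_opM: "opM a (opM a' \<Phi>) = opM (a * a') \<Phi>"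
  by (rule ext) (simp add: opM_def mult_ac)

lemma opM_1: "opM 1 \<Phi> = \<Phi>"
  by (rule ext) (simp add: opM_def)

lemma opN_0: "opN 0 \<Phi> = \<Phi>"
  by (rule ext) (simp add: opN_def)

lemma opM_opN: "opM a (opN b \<Phi>) = opN (b * a\<^sup>2) (opM a \<Phi>)"
  by (rule ext) (simp add: opM_def opN_def power_mult_distrib mult.assoc)

text \<open>In the integral along the line, the substitution contributes the inverse module of
  \<open>a\<close>, and the frequency is divided by \<open>a\<close>.\<close>

lemma opF_opM:
  assumes "\<Phi> \<in> S_space sc" "absv a = absv \<pi> powi k"
  shows "opF (opM a \<Phi>) = opZ (vol (- k)) (opM (1 / a) (opF \<Phi>))"
proof
  fix x
  obtain n m where S: "SX n m \<Phi>" using assms S_space_iff by blast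
  have a0: "a \<noteq> 0" using assms(2) pi_pos by (auto dest: sym)
  obtain j where L: "LC j m (\<lambda>t. \<Phi> (pt x t) * chi (eps x / a * t))"
    using ex_LC_mult_chi[OF LC_pt[OF S]] by blast
  have "opF (opM a \<Phi>) x = I (\<lambda>s. \<Phi> (pt x (a * s)) * chi (eps x / a * (a * s)))"
    using a0 by (simp add: opF_def hat_def opM_def)
  also have "\<dots> = vol (- k) * I (\<lambda>t. \<Phi> (pt x t) * chi (eps x / a * t))"
    by (rule I_scale[OF L assms(2)])
  finally show "opF (opM a \<Phi>) x = opZ (vol (- k)) (opM (1 / a) (opF \<Phi>)) x"
    by (simp add: opZ_def opM_def opF_def hat_def)
qed

lemma opF_opF:
  assumes "\<Phi> \<in> S_space sc"
  shows "opF (opF \<Phi>) = opZ (vol c) (opM (- 1) \<Phi>)"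
proof
  fix x
  obtain n m where S: "SX n m \<Phi>" using assms S_space_iff by blast
  have "opF (opF \<Phi>) x = I (\<lambda>s. hat (\<lambda>t. \<Phi> (pt x t)) s * chi (eps x * s))"
    by (simp add: opF_def hat_def)
  also have "\<dots> = vol c * \<Phi> (pt x (- eps x))" by (rule I_hat_chi[OF LC_pt[OF S]])
  finally show "opF (opF \<Phi>) x = opZ (vol c) (opM (- 1) \<Phi>) x" by (simp add: opZ_def opM_def)
qed

text \<open>Its symplectic shadow is the Bruhat decomposition in SL_2 of a unipotent element between
  two Weyl elements. Lifting it to operators costs the scalar \<open>G e\<close>, by
  \<open>I_chi_square_hat_G\<close> on every line.\<close>

lemma opF_opN_opF:
  assumes e: "e \<noteq> 0" and "\<Phi> \<in> S_space sc"
  shows "opF (opN e (opF \<Phi>))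
    = opZ (G e) (opN (- 1 / (4 * e)) (opM (- 1 / (2 * e)) (opF (opN (- 1 / (4 * e)) \<Phi>))))"
proof
  fix x
  obtain n m where S: "SX n m \<Phi>" using assms S_space_iff by blast
  have 1: "- (eps x)\<^sup>2 / (4 * e) = - 1 / (4 * e) * (eps x)\<^sup>2"
    and 2: "\<Phi> (pt x t) * chi (- t\<^sup>2 / (4 * e)) * chi (- eps x * t / (2 * e))
      = chi (- 1 / (4 * e) * t\<^sup>2) * \<Phi> (pt x t) * chi (- 1 / (2 * e) * eps x * t)" for t
    by (simp_all add: mult_ac)
  have "opF (opN e (opF \<Phi>)) x = I (\<lambda>s. chi (e * s\<^sup>2) * hat (\<lambda>t. \<Phi> (pt x t)) s * chi (eps x * s))"
    by (simp add: opF_def hat_def opN_def)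
  also have "\<dots> = G e * (chi (- (eps x)\<^sup>2 / (4 * e))
      * I (\<lambda>t. \<Phi> (pt x t) * chi (- t\<^sup>2 / (4 * e)) * chi (- eps x * t / (2 * e))))"
    by (rule I_chi_square_hat_G[OF two_neq_0 e LC_pt[OF S]])
  finally have "opF (opN e (opF \<Phi>)) x = G e * (chi (- 1 / (4 * e) * (eps x)\<^sup>2)
      * I (\<lambda>t. chi (- 1 / (4 * e) * t\<^sup>2) * \<Phi> (pt x t) * chi (- 1 / (2 * e) * eps x * t)))"
    unfolding 1 2 .
  then show "opF (opN e (opF \<Phi>)) x
      = opZ (G e) (opN (- 1 / (4 * e)) (opM (- 1 / (2 * e)) (opF (opN (- 1 / (4 * e)) \<Phi>)))) x"
    unfolding opZ_def opN_def opM_def opF_def hat_def eps_pt pt_pt .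
qed

text \<open>Polarisation of the quadratic form: the cross term changes the functional, and the
  constant term is the scalar that \<open>f_sp\<close> predicts for \<open>spN\<close>.\<close>

lemma opN_opU:
  assumes "f \<in> dual sc"
  shows "opN b (opU v f t \<Phi>)
    = opU v (\<lambda>x. f x - 2 * b * eps v * eps x) (chi (- b * (eps v)\<^sup>2) * t) (opN b \<Phi>)"
proof
  fix x
  have "b * (eps x)\<^sup>2 + f x = - b * (eps v)\<^sup>2 + (b * (eps (x + v))\<^sup>2 + (f x - 2 * b * eps v * eps x))"
    by (simp add: power2_eq_square algebra_simps)
  then have "chi (b * (eps x)\<^sup>2 + f x)
      = chi (- b * (eps v)\<^sup>2 + (b * (eps (x + v))\<^sup>2 + (f x - 2 * b * eps v * eps x)))" by (rule arg_cong)
  then have "chi (b * (eps x)\<^sup>2) * chi (f x)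
      = chi (- b * (eps v)\<^sup>2) * (chi (b * (eps (x + v))\<^sup>2) * chi (f x - 2 * b * eps v * eps x))"
    by (simp only: chi_add)
  then have "(chi (b * (eps x)\<^sup>2) * chi (f x)) * (t * \<Phi> (x + v))
      = chi (- b * (eps v)\<^sup>2) * (chi (b * (eps (x + v))\<^sup>2) * chi (f x - 2 * b * eps v * eps x)) * (t * \<Phi> (x + v))"
    by (rule arg_cong)
  then show "opN b (opU v f t \<Phi>) x
    = opU v (\<lambda>x. f x - 2 * b * eps v * eps x) (chi (- b * (eps v)\<^sup>2) * t) (opN b \<Phi>) x"
    unfolding opN_def opU_def by (simp only: mult_ac)
qed

lemma opM_opU:
  assumes "a \<noteq> 0"
  shows "opM a (opU v f t \<Phi>) = opU (pt v (eps v / a)) (\<lambda>x. f (pt x (a * eps x))) t (opM a \<Phi>)"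
proof
  fix x
  have "pt (x + pt v (eps v / a)) (a * eps (x + pt v (eps v / a)))
      = pt (x + pt v (eps v / a)) (a * eps x + eps v)"
    using assms by (simp add: distrib_left)
  also have "\<dots> = pt x (a * eps x) + v" by (simp add: pt_add)
  finally show "opM a (opU v f t \<Phi>) x
      = opU (pt v (eps v / a)) (\<lambda>x. f (pt x (a * eps x))) t (opM a \<Phi>) x"
    by (simp add: opM_def opU_def)
qed

text \<open>The slope \<open>f e0\<close> of the modulation along the line becomes a translation of
  the frequency, and the translation by \<open>eps v\<close> becomes a modulation; the other
  coordinates are untouched.\<close>

lemma opF_opU:
  assumes f: "f \<in> dual sc" and "\<Phi> \<in> S_space sc"
  shows "opF (opU v f t \<Phi>) = opU (pt v (f e0)) (\<lambda>x. f (pt x 0) - eps v * eps x)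
    (chi (- eps v * f e0) * t) (opF \<Phi>)"
proof
  fix x
  obtain n m where S: "SX n m \<Phi>" using assms S_space_iff by blast
  let ?F = "\<lambda>s. \<Phi> (pt (x + v) s) * chi (eps (x + pt v (f e0)) * s)"
  obtain j where L: "LC j m ?F" using ex_LC_mult_chi[OF LC_pt[OF S]] by blast
  let ?C = "chi (- eps v * f e0) * t * chi (f (pt x 0) - eps v * eps x)"
  have "opF (opU v f t \<Phi>) x = I (\<lambda>s. ?C * ?F (s + eps v))"
    unfolding opF_def hat_def opU_def
  proof (rule arg_cong[of _ _ I], rule ext)
    fix s
    have p: "pt x s + v = pt (x + v) (s + eps v)" by (simp add: pt_add)
    have "f (pt x s) + eps x * s
        = - eps v * f e0 + (f (pt x 0) - eps v * eps x) + eps (x + pt v (f e0)) * (s + eps v)"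
      by (simp add: dual_pt[OF f] algebra_simps)
    then have "chi (f (pt x s) + eps x * s)
        = chi (- eps v * f e0 + (f (pt x 0) - eps v * eps x) + eps (x + pt v (f e0)) * (s + eps v))"
      by (rule arg_cong)
    then have "chi (f (pt x s)) * chi (eps x * s) = chi (- eps v * f e0) * chi (f (pt x 0) - eps v * eps x)
        * chi (eps (x + pt v (f e0)) * (s + eps v))" by (simp only: chi_add)
    then have "t * \<Phi> (pt x s + v) * (chi (f (pt x s)) * chi (eps x * s))
        = t * \<Phi> (pt x s + v) * (chi (- eps v * f e0) * chi (f (pt x 0) - eps v * eps x)
        * chi (eps (x + pt v (f e0)) * (s + eps v)))" by (rule arg_cong)
    then show "t * \<Phi> (pt x s + v) * chi (f (pt x s)) * chi (eps x * s) = ?C * ?F (s + eps v)"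
      unfolding p by (simp only: mult_ac)
  qed
  also have "\<dots> = ?C * I (\<lambda>s. ?F (s + eps v))"
  proof -
    obtain i where "eps v \<in> B i" using ex_B by blast
    then have "eps v \<in> B (min i m)" by (simp add: B_min_iff)
    from LC_translate[OF LC_mono[OF L] this] show ?thesis by (intro I_cmult) auto
  qed
  also have "I (\<lambda>s. ?F (s + eps v)) = I ?F" by (rule I_translate[OF L])
  also have "I ?F = opF \<Phi> (x + pt v (f e0))"
  proof -
    have "pt (x + v) s = pt (x + pt v (f e0)) s" for s
      using pt_add[of x v "eps x" "s - eps x"] pt_add[of x "pt v (f e0)" "eps x" "s - eps x"] by simp
    then show ?thesis by (simp only: opF_def hat_def)
  qed
  finally show "opF (opU v f t \<Phi>) x = opU (pt v (f e0)) (\<lambda>x. f (pt x 0) - eps v * eps x)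
    (chi (- eps v * f e0) * t) (opF \<Phi>) x"
    unfolding opU_def[of "pt v (f e0)"] by (simp only: mult_ac)
qed

lemma opU_opU:
  assumes "f \<in> dual sc" "g \<in> dual sc"
  shows "opU v f s (opU w g t \<Phi>) = opU (v + w) (\<lambda>x. f x + g x) (s * t * chi (g v)) \<Phi>"
  by (rule ext) (simp add: opU_def dual_add[OF assms(2)] chi_add mult_ac add_ac)

text \<open>Indicators of small cosets separate \<open>v\<close> from \<open>w\<close> and then give
  \<open>t * chi (f x) = s * chi (g x)\<close>. This injectivity gives the \<open>inv_into\<close>
  in \<open>pi0\<close> its meaning.\<close>

lemma opU_inj:
  assumes f: "f \<in> dual sc" and g: "g \<in> dual sc" and t: "t \<noteq> 0"
    and eq: "\<And>\<Phi>. \<Phi> \<in> S_space sc \<Longrightarrow> opU v f t \<Phi> = opU w g s \<Phi>"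
  shows "v = w \<and> f = g \<and> t = s"
proof -
  define \<delta> where "\<delta> y n x = (if x - y \<in> L n then 1 else 0 :: 'r)" for y n x
  have \<delta>S: "\<delta> y n \<in> S_space sc" for y n
  proof -
    obtain k where k: "y \<in> L k" using ex_L by blast
    have "SX n (min k n) (\<delta> y n)"
      unfolding SX_def
    proof (intro conjI allI impI)
      fix x z assume xz: "x - z \<in> L n"
      have "x - y \<in> L n \<longleftrightarrow> z - y \<in> L n" using L_add_iff[OF xz, of "z - y"] by simp
      then show "\<delta> y n x = \<delta> y n z" by (simp add: \<delta>_def)
    next
      fix x assume x: "x \<notin> L (min k n)"
      have "x - y \<notin> L n"
      proof
        assume "x - y \<in> L n"
        then have "x - y \<in> L (min k n)" by (rule L_minI)
        moreover have "y \<in> L (min k n)" using k by (rule L_minI)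
        ultimately have "x - y + y \<in> L (min k n)" by (rule L_add)
        then show False using x by simp
      qed
      then show "\<delta> y n x = 0" by (simp add: \<delta>_def)
    qed simp
    then show ?thesis using S_space_iff by blast
  qed
  have vw: "v = w"
  proof (rule ccontr)
    assume "v \<noteq> w"
    have "\<exists>b\<in>Basis. crd b (w - v) \<noteq> 0"
    proof (rule ccontr)
      assume "\<not> ?thesis"
      then have "(\<Sum>b\<in>Basis. sc (crd b (w - v)) b) = 0" by (intro sum.neutral ballI) force
      then show False using \<open>v \<noteq> w\<close> unfolding sum_crd by simp
    qed
    then obtain b where b: "b \<in> Basis" "crd b (w - v) \<noteq> 0" by blast
    then have "absv (crd b (w - v)) > 0" by (simp add: less_le del: crd_diff)
    then obtain n where n: "\<forall>z\<in>B n. absv z < absv (crd b (w - v))" using ex_B_small by blast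
    have "w - v \<notin> L n" using n b(1) by (auto simp: L_def)
    then have "opU w g s (\<delta> v n) 0 = 0" by (simp add: opU_def \<delta>_def)
    moreover have "opU v f t (\<delta> v n) 0 = t" by (simp add: opU_def \<delta>_def dual_0[OF f])
    ultimately show False using eq[OF \<delta>S, of v n] t by simp
  qed
  have val: "t * chi (f x) = s * chi (g x)" for x
    using fun_cong[OF eq[OF \<delta>S, of "x + v" 0], of x] vw by (simp add: opU_def \<delta>_def)
  from val[of 0] have ts: "t = s" by (simp add: dual_0[OF f] dual_0[OF g])
  have "f x = g x" for x
  proof (rule ccontr)
    assume ne: "f x \<noteq> g x"
    obtain z where z: "chi z \<noteq> 1" using chi_nontriv by blast
    \<comment> \<open>The multiple of \<open>x\<close> at which \<open>f\<close> and
      \<open>g\<close> differ by \<open>z\<close>, so that \<open>chi\<close> tells them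
      apart.\<close>
    define a where "a = z / (f x - g x)"
    have "f (sc a x) - g (sc a x) = z"
    proof -
      have "f (sc a x) - g (sc a x) = a * (f x - g x)"
        by (simp only: dual_scale[OF f] dual_scale[OF g] right_diff_distrib)
      then show ?thesis using ne by (simp add: a_def)
    qed
    then have "chi (f (sc a x)) = chi z * chi (g (sc a x))" by (metis chi_add diff_add_cancel)
    moreover have "chi (f (sc a x)) = chi (g (sc a x))" using val[of "sc a x"] ts t by simp
    ultimately show False using z by simp
  qed
  then show ?thesis using vw ts by blast
qed

section \<open>Lifting operators to the metaplectic group\<close>

abbreviation W where "W \<equiv> W_space sc"
abbreviation S :: "('x \<Rightarrow> 'r) set" where "S \<equiv> S_space sc"
abbreviation A where "A \<equiv> carrier (A_group sc chi)"

section \<open>The symplectic space and its automorphisms\<close>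

lemma W_iff [simp]: "(v, f) \<in> W \<longleftrightarrow> f \<in> dual sc"
  by (simp add: W_space_def)

lemma W_add_Pair [simp]: "W_add (v, f) (w, g) = (v + w, \<lambda>y. f y + g y)"
  by (simp add: W_add_def)

lemma W_scale_Pair [simp]: "W_scale sc a (v, f) = (sc a v, \<lambda>y. a * f y)"
  by (simp add: W_scale_def)

lemma bform_Pair [simp]: "bform (v, f) (w, g) = g v"
  by (simp add: bform_def)

lemma dual_sum: "f \<in> dual sc \<Longrightarrow> g \<in> dual sc \<Longrightarrow> (\<lambda>y. f y + g y) \<in> dual sc"
  by (simp add: dual_iff distrib_left add_ac)

lemma dual_cmult: "f \<in> dual sc \<Longrightarrow> (\<lambda>y. a * f y) \<in> dual sc"
  by (simp add: dual_iff distrib_left mult_ac)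

lemma W_add_closed: "w \<in> W \<Longrightarrow> w' \<in> W \<Longrightarrow> W_add w w' \<in> W"
  by (cases w, cases w') (simp add: dual_sum)

lemma W_scale_closed: "w \<in> W \<Longrightarrow> W_scale sc a w \<in> W"
  by (cases w) (simp add: dual_cmult)

lemma A_iff [simp]: "(w, t) \<in> A \<longleftrightarrow> w \<in> W \<and> t dvd 1"
  by (auto simp: A_group_def)

lemma in_Sp_iff: "\<sigma> \<in> carrier (Sp sc) \<longleftrightarrow> \<sigma> \<in> Bij W \<and>
    (\<forall>w\<in>W. \<forall>w'\<in>W. \<sigma> (W_add w w') = W_add (\<sigma> w) (\<sigma> w')) \<and>
    (\<forall>a. \<forall>w\<in>W. \<sigma> (W_scale sc a w) = W_scale sc a (\<sigma> w)) \<and>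
    (\<forall>w\<in>W. \<forall>w'\<in>W. bform (\<sigma> w) (\<sigma> w') - bform (\<sigma> w') (\<sigma> w) = bform w w' - bform w' w)"
  by (simp add: Sp_def)

lemma restrict_in_Bij:
  assumes "\<And>x. x \<in> X \<Longrightarrow> f x \<in> X" "\<And>x. x \<in> X \<Longrightarrow> g x \<in> X"
    and "\<And>x. x \<in> X \<Longrightarrow> g (f x) = x" "\<And>x. x \<in> X \<Longrightarrow> f (g x) = x"
  shows "restrict f X \<in> Bij X"
proof -
  have "bij_betw (restrict f X) X X"
    by (rule bij_betwI[of _ _ _ g]) (use assms in auto)
  then show ?thesis by (simp add: Bij_def)
qed

lemma restrict_in_Sp:
  assumes "\<And>w. w \<in> W \<Longrightarrow> \<sigma> w \<in> W" "\<And>w. w \<in> W \<Longrightarrow> \<tau> w \<in> W"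
    and "\<And>w. w \<in> W \<Longrightarrow> \<tau> (\<sigma> w) = w" "\<And>w. w \<in> W \<Longrightarrow> \<sigma> (\<tau> w) = w"
    and "\<And>w w'. w \<in> W \<Longrightarrow> w' \<in> W \<Longrightarrow> \<sigma> (W_add w w') = W_add (\<sigma> w) (\<sigma> w')"
    and "\<And>a w. w \<in> W \<Longrightarrow> \<sigma> (W_scale sc a w) = W_scale sc a (\<sigma> w)"
    and "\<And>w w'. w \<in> W \<Longrightarrow> w' \<in> W \<Longrightarrow>
      bform (\<sigma> w) (\<sigma> w') - bform (\<sigma> w') (\<sigma> w) = bform w w' - bform w' w"
  shows "restrict \<sigma> W \<in> carrier (Sp sc)"
  unfolding in_Sp_iff
proof (intro conjI ballI allI)
  show "restrict \<sigma> W \<in> Bij W" by (rule restrict_in_Bij[of _ _ \<tau>]) (fact assms)+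
qed (simp_all add: assms W_add_closed W_scale_closed)

lemma Sp_closed: "\<sigma> \<in> carrier (Sp sc) \<Longrightarrow> w \<in> W \<Longrightarrow> \<sigma> w \<in> W"
  unfolding in_Sp_iff using Bij_imp_funcset by blast

lemma Sp_surj: assumes "\<sigma> \<in> carrier (Sp sc)" "w \<in> W" shows "\<exists>w'\<in>W. \<sigma> w' = w"
proof -
  have "\<sigma> ` W = W" using assms(1) by (simp add: in_Sp_iff Bij_def bij_betw_def)
  then have "w \<in> \<sigma> ` W" using assms(2) by simp
  then show ?thesis by blast
qed

lemma compose_in_Sp:
  assumes "\<sigma> \<in> carrier (Sp sc)" "\<tau> \<in> carrier (Sp sc)"
  shows "compose W \<sigma> \<tau> \<in> carrier (Sp sc)"
  unfolding in_Sp_iff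
proof (intro conjI ballI allI)
  show "compose W \<sigma> \<tau> \<in> Bij W" using assms by (auto simp: in_Sp_iff compose_Bij)
qed (use assms Sp_closed[OF assms(2)] in
    \<open>simp_all add: compose_eq W_add_closed W_scale_closed in_Sp_iff\<close>)

section \<open>Automorphisms of the Schwartz space\<close>

lemma S_add: assumes "\<Phi> \<in> S" "\<Psi> \<in> S" shows "(\<lambda>x. \<Phi> x + \<Psi> x) \<in> S"
proof -
  obtain n m n' m' where *: "SX n m \<Phi>" "SX n' m' \<Psi>" using assms S_space_iff by blast
  have 1: "SX (max n n') (min m m') \<Phi>" by (rule SX_mono[OF *(1)]) auto
  have 2: "SX (max n n') (min m m') \<Psi>" by (rule SX_mono[OF *(2)]) auto
  have "SX (max n n') (min m m') (\<lambda>x. \<Phi> x + \<Psi> x)"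
    unfolding SX_def
  proof (intro conjI allI impI)
    show "\<Phi> x + \<Psi> x = \<Phi> y + \<Psi> y" if "x - y \<in> L (max n n')" for x y
      using SX_inv[OF 1 that] SX_inv[OF 2 that] by (simp only:)
    show "\<Phi> x + \<Psi> x = 0" if "x \<notin> L (min m m')" for x
      using SX_outside[OF 1 that] SX_outside[OF 2 that] by simp
  qed (rule SX_le[OF 1])
  then show ?thesis using S_space_iff by blast
qed

lemma S_cmult: "\<Phi> \<in> S \<Longrightarrow> (\<lambda>x. a * \<Phi> x) \<in> S"
  using opZ_S[of \<Phi> a] by (simp add: opZ_def[abs_def])

lemma in_Aut_iff: "s \<in> carrier (Aut_S sc) \<longleftrightarrow> s \<in> Bij S \<and>
    (\<forall>\<Phi>\<in>S. \<forall>\<Psi>\<in>S. s (\<lambda>x. \<Phi> x + \<Psi> x) = (\<lambda>x. s \<Phi> x + s \<Psi> x)) \<and>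
    (\<forall>a. \<forall>\<Phi>\<in>S. s (\<lambda>x. a * \<Phi> x) = (\<lambda>x. a * s \<Phi> x))"
  by (simp add: Aut_S_def)

lemma Aut_closed: "s \<in> carrier (Aut_S sc) \<Longrightarrow> \<Phi> \<in> S \<Longrightarrow> s \<Phi> \<in> S"
  unfolding in_Aut_iff using Bij_imp_funcset by blast

lemma Aut_surj: assumes "s \<in> carrier (Aut_S sc)" "\<Phi> \<in> S" shows "\<exists>\<Psi>\<in>S. s \<Psi> = \<Phi>"
proof -
  have "s ` S = S" using assms(1) by (simp add: in_Aut_iff Bij_def bij_betw_def)
  then have "\<Phi> \<in> s ` S" using assms(2) by simp
  then show ?thesis by blast
qed

lemma restrict_in_Aut:
  assumes "\<And>\<Phi>. \<Phi> \<in> S \<Longrightarrow> s \<Phi> \<in> S" "\<And>\<Phi>. \<Phi> \<in> S \<Longrightarrow> t \<Phi> \<in> S"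
    and "\<And>\<Phi>. \<Phi> \<in> S \<Longrightarrow> t (s \<Phi>) = \<Phi>" "\<And>\<Phi>. \<Phi> \<in> S \<Longrightarrow> s (t \<Phi>) = \<Phi>"
    and "\<And>\<Phi> \<Psi>. \<Phi> \<in> S \<Longrightarrow> \<Psi> \<in> S \<Longrightarrow> s (\<lambda>x. \<Phi> x + \<Psi> x) = (\<lambda>x. s \<Phi> x + s \<Psi> x)"
    and "\<And>a \<Phi>. \<Phi> \<in> S \<Longrightarrow> s (\<lambda>x. a * \<Phi> x) = (\<lambda>x. a * s \<Phi> x)"
  shows "restrict s S \<in> carrier (Aut_S sc)"
  unfolding in_Aut_iff
proof (intro conjI ballI allI)
  show "restrict s S \<in> Bij S" by (rule restrict_in_Bij[of _ _ t]) (fact assms)+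
qed (simp_all add: assms S_add S_cmult)

lemma Aut_mult: "s \<in> carrier (Aut_S sc) \<Longrightarrow> t \<in> carrier (Aut_S sc) \<Longrightarrow>
    s \<otimes>\<^bsub>Aut_S sc\<^esub> t = compose S s t"
  by (simp add: in_Aut_iff) (simp add: Aut_S_def BijGroup_def)

lemma compose_in_Aut:
  assumes "s \<in> carrier (Aut_S sc)" "t \<in> carrier (Aut_S sc)"
  shows "compose S s t \<in> carrier (Aut_S sc)"
  unfolding in_Aut_iff
proof (intro conjI ballI allI)
  show "compose S s t \<in> Bij S" using assms by (auto simp: in_Aut_iff compose_Bij)
qed (use assms Aut_closed[OF assms(2)] in \<open>simp_all add: compose_eq S_add S_cmult in_Aut_iff\<close>)

text \<open>Obtained as a subgroup of \<open>BijGroup S\<close>; the content is that the inverse of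
  a linear bijection is linear.\<close>

lemma group_Aut: "group (Aut_S sc :: (('x \<Rightarrow> 'r) \<Rightarrow> 'x \<Rightarrow> 'r) monoid)"
proof -
  let ?C = "carrier (Aut_S sc) :: (('x \<Rightarrow> 'r) \<Rightarrow> 'x \<Rightarrow> 'r) set"
  have CB: "s \<in> Bij S" if "s \<in> ?C" for s using that in_Aut_iff by blast
  have inv: "(\<lambda>\<Phi>\<in>S. inv_into S s \<Phi>) \<in> ?C" if s: "s \<in> ?C" for s
  proof (rule restrict_in_Aut[of _ s])
    have b: "bij_betw s S S" using CB[OF s] by (simp add: Bij_def)
    show 1: "inv_into S s \<Phi> \<in> S" if "\<Phi> \<in> S" for \<Phi> using Bij_inv_into_mem[OF CB[OF s] that] .
    show 2: "s (inv_into S s \<Phi>) = \<Phi>" if "\<Phi> \<in> S" for \<Phi> using bij_betw_inv_into_right[OF b that] .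
    show 3: "inv_into S s (s \<Phi>) = \<Phi>" if "\<Phi> \<in> S" for \<Phi> using bij_betw_inv_into_left[OF b that] .
    show "s \<Phi> \<in> S" if "\<Phi> \<in> S" for \<Phi> using Aut_closed[OF s that] .
    show "inv_into S s (\<lambda>x. \<Phi> x + \<Psi> x) = (\<lambda>x. inv_into S s \<Phi> x + inv_into S s \<Psi> x)"
      if "\<Phi> \<in> S" "\<Psi> \<in> S" for \<Phi> \<Psi>
    proof -
      have "s (\<lambda>x. inv_into S s \<Phi> x + inv_into S s \<Psi> x) = (\<lambda>x. \<Phi> x + \<Psi> x)"
        using s 1 2 that by (simp add: in_Aut_iff)
      then show ?thesis using 3[OF S_add[OF 1[OF that(1)] 1[OF that(2)]]] by simp
    qed
    show "inv_into S s (\<lambda>x. a * \<Phi> x) = (\<lambda>x. a * inv_into S s \<Phi> x)" if "\<Phi> \<in> S" for a \<Phi>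
    proof -
      have "s (\<lambda>x. a * inv_into S s \<Phi> x) = (\<lambda>x. a * \<Phi> x)"
        using s 1 2 that by (simp add: in_Aut_iff)
      then show ?thesis using 3[OF S_cmult[OF 1[OF that]], of a] by simp
    qed
  qed
  interpret BG: group "BijGroup S :: (('x \<Rightarrow> 'r) \<Rightarrow> 'x \<Rightarrow> 'r) monoid" by (rule group_BijGroup)
  have "subgroup ?C (BijGroup S)"
  proof (rule BG.subgroupI)
    show "?C \<subseteq> carrier (BijGroup S)" using CB by (auto simp: BijGroup_def)
    have "restrict id S \<in> ?C" by (rule restrict_in_Aut[of _ id]) simp_all
    then show "?C \<noteq> {}" by blast
    show "inv\<^bsub>BijGroup S\<^esub> s \<in> ?C" if "s \<in> ?C" for s
      using inv[OF that] inv_BijGroup[OF CB[OF that]] by simp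
    show "s \<otimes>\<^bsub>BijGroup S\<^esub> t \<in> ?C" if "s \<in> ?C" "t \<in> ?C" for s t
      using compose_in_Aut[OF that] CB[OF that(1)] CB[OF that(2)] by (simp add: BijGroup_def)
  qed
  from subgroup.subgroup_is_group[OF this BG.is_group] show ?thesis
    by (simp add: Aut_S_def)
qed

lemma U_op_eq: "U_op sc chi ((v, f), t) = restrict (opU v f t) S"
  by (simp add: U_op_def opU_def[abs_def])

lemma U_op_in_Aut:
  assumes "a \<in> A" shows "U_op sc chi a \<in> carrier (Aut_S sc)"
proof -
  obtain v f t where a: "a = ((v, f), t)" by (metis surj_pair)
  then have f: "f \<in> dual sc" and "t dvd 1" using assms by auto
  then obtain u where u: "1 = t * u" by (elim dvdE)
  \<comment> \<open>With this functional, \<open>((- v, g), u * chi (f v))\<close> is the inverse of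
    \<open>a\<close> in the Heisenberg group; the factor \<open>chi (f v)\<close> compensates the
    cocycle.\<close>
  define g where "g y = - f y" for y
  have g: "g \<in> dual sc" using f by (simp add: dual_iff g_def)
  have 1: "opU v f t (opU (- v) g (u * chi (f v)) \<Phi>) = \<Phi>" for \<Phi>
  proof -
    have "t * (u * chi (f v)) * chi (g v) = (t * u) * (chi (f v) * chi (- f v))"
      by (simp add: g_def mult_ac)
    then have "t * (u * chi (f v)) * chi (g v) = 1" by (simp add: chi_minus flip: u)
    then show ?thesis unfolding opU_opU[OF f g] by (simp add: opU_def[abs_def] g_def)
  qed
  have 2: "opU (- v) g (u * chi (f v)) (opU v f t \<Phi>) = \<Phi>" for \<Phi>
  proof -
    have "u * chi (f v) * t * chi (f (- v)) = (t * u) * (chi (f v) * chi (- f v))"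
      by (simp add: dual_minus[OF f] mult_ac)
    then have "u * chi (f v) * t * chi (f (- v)) = 1" by (simp add: chi_minus flip: u)
    then show ?thesis unfolding opU_opU[OF g f] by (simp add: opU_def[abs_def] g_def)
  qed
  show ?thesis
    unfolding a U_op_eq
    by (rule restrict_in_Aut[of _ "opU (- v) g (u * chi (f v))"])
      (simp_all add: opU_S f g 1 2, simp_all add: opU_def[abs_def] algebra_simps)
qed

lemma U_op_inj: "inj_on (U_op sc chi) A"
proof (rule inj_onI)
  fix a a' assume *: "a \<in> A" "a' \<in> A" "U_op sc chi a = U_op sc chi a'"
  obtain v f t where a: "a = ((v, f), t)" by (metis surj_pair)
  obtain w g s where a': "a' = ((w, g), s)" by (metis surj_pair)
  have f: "f \<in> dual sc" and g: "g \<in> dual sc" and t: "t \<noteq> 0" using *(1,2) by (auto simp: a a')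
  have "v = w \<and> f = g \<and> t = s"
  proof (rule opU_inj[OF f g t])
    fix \<Phi> assume "\<Phi> \<in> S"
    then show "opU v f t \<Phi> = opU w g s \<Phi>"
      using fun_cong[OF *(3), of \<Phi>] unfolding a a' U_op_eq by simp
  qed
  then show "a = a'" by (simp add: a a')
qed

section \<open>The action \<open>mu\<close> and lifts of symplectic automorphisms\<close>

lemma mu_apply: "(w, t) \<in> A \<Longrightarrow> mu sc chi \<sigma> (w, t) = (\<sigma> w, chi (f_sp \<sigma> w) * t)"
  by (simp add: mu_def)

lemma mu_in_A:
  assumes "\<sigma> \<in> carrier (Sp sc)" "a \<in> A" shows "mu sc chi \<sigma> a \<in> A"
proof -
  obtain w t where a: "a = (w, t)" by (metis surj_pair)
  have "chi (f_sp \<sigma> w) * t dvd 1"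
    using mult_dvd_mono[OF chi_unit, of t 1] assms(2) a by simp
  then show ?thesis using assms Sp_closed unfolding a by (simp add: mu_apply)
qed

lemma mu_surj:
  assumes "\<sigma> \<in> carrier (Sp sc)" shows "mu sc chi \<sigma> ` A = A"
proof (intro equalityI subsetI)
  fix a assume "a \<in> mu sc chi \<sigma> ` A" then show "a \<in> A" using mu_in_A[OF assms] by blast
next
  fix a assume aA: "a \<in> A"
  obtain w t where a: "a = (w, t)" by (metis surj_pair)
  then have "w \<in> W" using aA by simp
  then obtain w' where w': "w' \<in> W" "\<sigma> w' = w" using Sp_surj[OF assms] by blast
  let ?t = "chi (- f_sp \<sigma> w') * t"
  have "?t dvd 1" using mult_dvd_mono[OF chi_unit, of t 1] aA a by simp
  then have A': "(w', ?t) \<in> A" using w' by simp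
  have "chi (f_sp \<sigma> w') * ?t = t" using chi_minus[of "f_sp \<sigma> w'"] by (simp flip: mult.assoc)
  then have "mu sc chi \<sigma> (w', ?t) = a" using w' a by (simp add: mu_apply[OF A'])
  then show "a \<in> mu sc chi \<sigma> ` A" using A' by blast
qed

text \<open>Consequently the symplectic component of a point of \<open>Mp\<close> is determined by
  its operator.\<close>

lemma mu_inj:
  assumes "\<sigma> \<in> carrier (Sp sc)" "\<tau> \<in> carrier (Sp sc)" "mu sc chi \<sigma> = mu sc chi \<tau>"
  shows "\<sigma> = \<tau>"
proof (rule extensionalityI[of _ W])
  show "\<sigma> \<in> extensional W" "\<tau> \<in> extensional W"
    using assms(1,2) Bij_imp_extensional unfolding in_Sp_iff by blast+
  fix w assume w: "w \<in> W"
  then have "(w, 1) \<in> A" by simp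
  then show "\<sigma> w = \<tau> w" using fun_cong[OF assms(3), of "(w, 1)"] by (simp add: mu_apply)
qed

text \<open>The condition defining \<open>Mp\<close>, rewritten as an intertwining relation, free of
  inverses and of \<open>inv_into\<close>.\<close>

definition lifts where
  "lifts \<sigma> s \<longleftrightarrow> \<sigma> \<in> carrier (Sp sc) \<and> s \<in> carrier (Aut_S sc) \<and>
    (\<forall>a\<in>A. \<forall>\<Phi>\<in>S. s (U_op sc chi a \<Phi>) = U_op sc chi (mu sc chi \<sigma> a) (s \<Phi>))"

text \<open>Conjugation by \<open>s\<close> acts on the Heisenberg operators as \<open>mu\<close> of
  \<sigma>. Since \<open>mu\<close> permutes the Heisenberg group, \<open>s\<close> normalizes them;
  since \<open>U_op\<close> is injective, \<open>pi0\<close> recovers \<open>mu\<close>.\<close>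

lemma lifts_in_Mp:
  assumes "lifts \<sigma> s" shows "(\<sigma>, s) \<in> carrier (Mp sc chi)"
proof -
  have \<sigma>: "\<sigma> \<in> carrier (Sp sc)" and s: "s \<in> carrier (Aut_S sc)"
    and eq: "\<And>a \<Phi>. a \<in> A \<Longrightarrow> \<Phi> \<in> S \<Longrightarrow> s (U_op sc chi a \<Phi>) = U_op sc chi (mu sc chi \<sigma> a) (s \<Phi>)"
    using assms unfolding lifts_def by blast+
  let ?G = "Aut_S sc :: (('x \<Rightarrow> 'r) \<Rightarrow> 'x \<Rightarrow> 'r) monoid"
  interpret G: group ?G by (rule group_Aut)
  have conj: "s \<otimes>\<^bsub>?G\<^esub> U_op sc chi a \<otimes>\<^bsub>?G\<^esub> inv\<^bsub>?G\<^esub> s = U_op sc chi (mu sc chi \<sigma> a)"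
    if a: "a \<in> A" for a
  proof -
    note Ua = U_op_in_Aut[OF a] and Ub = U_op_in_Aut[OF mu_in_A[OF \<sigma> a]]
    have "s \<otimes>\<^bsub>?G\<^esub> U_op sc chi a = U_op sc chi (mu sc chi \<sigma> a) \<otimes>\<^bsub>?G\<^esub> s"
      unfolding Aut_mult[OF s Ua] Aut_mult[OF Ub s]
      using eq[OF a] by (intro ext) (simp add: compose_def)
    then show ?thesis using Ua Ub s by (simp add: G.m_assoc)
  qed
  let ?H = "U_op sc chi ` A"
  have HG: "?H \<subseteq> carrier ?G" using U_op_in_Aut by blast
  have "s <#\<^bsub>?G\<^esub> ?H #>\<^bsub>?G\<^esub> inv\<^bsub>?G\<^esub> s = (\<lambda>a. s \<otimes>\<^bsub>?G\<^esub> U_op sc chi a \<otimes>\<^bsub>?G\<^esub> inv\<^bsub>?G\<^esub> s) ` A"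
    by (auto simp: l_coset_def r_coset_def)
  also have "\<dots> = U_op sc chi ` mu sc chi \<sigma> ` A"
    unfolding image_image by (rule image_cong[OF refl conj])
  also have "\<dots> = ?H" unfolding mu_surj[OF \<sigma>] ..
  finally have "s \<in> normalizer ?G ?H"
    unfolding normalizer_def stabilizer_def using s HG by simp
  moreover have "mu sc chi \<sigma> = pi0 sc chi s"
  proof
    fix a
    show "mu sc chi \<sigma> a = pi0 sc chi s a"
    proof (cases "a \<in> A")
      case True
      then show ?thesis
        by (simp add: pi0_def conj inv_into_f_f[OF U_op_inj mu_in_A[OF \<sigma> True]])
    next
      case False
      then show ?thesis by (simp add: pi0_def mu_def)
    qed
  qed
  ultimately show ?thesis using \<sigma> by (simp add: Mp_def BB0_group_def)
qed

lemma lifts_compose: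
  assumes "lifts \<sigma> s" "lifts \<tau> t"
  shows "lifts (compose W \<sigma> \<tau>) (compose S s t)"
proof -
  have \<sigma>: "\<sigma> \<in> carrier (Sp sc)" and s: "s \<in> carrier (Aut_S sc)"
    and eq: "\<And>a \<Phi>. a \<in> A \<Longrightarrow> \<Phi> \<in> S \<Longrightarrow> s (U_op sc chi a \<Phi>) = U_op sc chi (mu sc chi \<sigma> a) (s \<Phi>)"
    using assms(1) unfolding lifts_def by blast+
  have \<tau>: "\<tau> \<in> carrier (Sp sc)" and t: "t \<in> carrier (Aut_S sc)"
    and eq': "\<And>a \<Phi>. a \<in> A \<Longrightarrow> \<Phi> \<in> S \<Longrightarrow> t (U_op sc chi a \<Phi>) = U_op sc chi (mu sc chi \<tau> a) (t \<Phi>)"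
    using assms(2) unfolding lifts_def by blast+
  \<comment> \<open>The cocycle rule: \<open>f_sp\<close> of a composite at \<open>w\<close> is
    \<open>f_sp \<sigma> (\<tau> w) + f_sp \<tau> w\<close>, the intermediate values
    cancelling.\<close>
  have mu: "mu sc chi \<sigma> (mu sc chi \<tau> a) = mu sc chi (compose W \<sigma> \<tau>) a" if a: "a \<in> A" for a
  proof -
    obtain w u where wu: "a = (w, u)" by (metis surj_pair)
    have w: "w \<in> W" using a wu by simp
    have "f_sp (compose W \<sigma> \<tau>) w = f_sp \<sigma> (\<tau> w) + f_sp \<tau> w"
      using w by (simp add: f_sp_def compose_eq flip: add_divide_distrib)
    then show ?thesis
      using a mu_in_A[OF \<tau> a] w unfolding wu by (simp add: mu_apply compose_eq chi_add mult.assoc)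
  qed
  show ?thesis
    unfolding lifts_def
  proof (intro conjI ballI)
    fix a \<Phi> assume a: "a \<in> A" and \<Phi>: "\<Phi> \<in> S"
    have "s (t (U_op sc chi a \<Phi>)) = U_op sc chi (mu sc chi \<sigma> (mu sc chi \<tau> a)) (s (t \<Phi>))"
      using eq[OF mu_in_A[OF \<tau> a] Aut_closed[OF t \<Phi>]] eq'[OF a \<Phi>] by simp
    then show "compose S s t (U_op sc chi a \<Phi>)
        = U_op sc chi (mu sc chi (compose W \<sigma> \<tau>) a) (compose S s t \<Phi>)"
      using Aut_closed[OF U_op_in_Aut[OF a] \<Phi>] \<Phi> by (simp add: compose_eq mu[OF a])
  qed (use \<sigma> \<tau> s t compose_in_Sp compose_in_Aut in auto)
qed

definition liftable where "liftable s \<longleftrightarrow> (\<exists>\<sigma>. lifts \<sigma> s)"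

lemma liftable_compose: "liftable s \<Longrightarrow> liftable t \<Longrightarrow> liftable (compose S s t)"
  unfolding liftable_def using lifts_compose by blast

lemma Mp_mult:
  assumes "lifts \<sigma> s" "lifts \<tau> t"
  shows "(\<sigma>, s) \<otimes>\<^bsub>Mp sc chi\<^esub> (\<tau>, t) = (compose W \<sigma> \<tau>, compose S s t)"
proof -
  have "\<sigma> \<in> Bij W" "\<tau> \<in> Bij W" "s \<in> Bij S" "t \<in> Bij S"
    using assms unfolding lifts_def in_Sp_iff in_Aut_iff by blast+
  then show ?thesis
    by (simp add: Mp_def DirProd_def Sp_def BB0_group_def Aut_S_def BijGroup_def)
qed

text \<open>As the operator determines its symplectic part, \<psi> can be read as a function of
  operators alone, and relations need only be proved between operators.\<close>

lemma ex_operator_character: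
  assumes \<psi>: "\<psi> \<in> hom (Mp sc chi) (units_group :: 'r monoid)"
    and scalar: "\<And>t. t dvd 1 \<Longrightarrow> \<psi> (Mp_scalar sc t) = t"
  shows "\<exists>P. (\<forall>s t. liftable s \<longrightarrow> liftable t \<longrightarrow> P (compose S s t) = P s * P t) \<and>
    (\<forall>s. liftable s \<longrightarrow> P s \<noteq> 0) \<and>
    (\<forall>t. t dvd 1 \<longrightarrow> liftable (restrict (opZ t) S) \<and> P (restrict (opZ t) S) = t)"
proof -
  define P where "P s = \<psi> (SOME \<sigma>. lifts \<sigma> s, s)" for s
  have P: "P s = \<psi> (\<sigma>, s)" if "lifts \<sigma> s" for \<sigma> s
  proof -
    have "lifts (SOME \<sigma>. lifts \<sigma> s) s" using someI[of "\<lambda>\<sigma>. lifts \<sigma> s" \<sigma>] that by simp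
    from lifts_in_Mp[OF this] lifts_in_Mp[OF that]
    have "mu sc chi (SOME \<sigma>. lifts \<sigma> s) = mu sc chi \<sigma>" by (simp add: Mp_def)
    moreover have "\<sigma> \<in> carrier (Sp sc)" "(SOME \<sigma>. lifts \<sigma> s) \<in> carrier (Sp sc)"
      using that \<open>lifts (SOME \<sigma>. lifts \<sigma> s) s\<close> unfolding lifts_def by blast+
    ultimately have "(SOME \<sigma>. lifts \<sigma> s) = \<sigma>" by (intro mu_inj)
    then show ?thesis by (simp add: P_def)
  qed
  have mult: "P (compose S s t) = P s * P t" if st: "liftable s" "liftable t" for s t
  proof -
    obtain \<sigma> \<tau> where *: "lifts \<sigma> s" "lifts \<tau> t" using st unfolding liftable_def by blast
    have "\<psi> ((\<sigma>, s) \<otimes>\<^bsub>Mp sc chi\<^esub> (\<tau>, t)) = \<psi> (\<sigma>, s) \<otimes>\<^bsub>units_group\<^esub> \<psi> (\<tau>, t)"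
      by (rule hom_mult[OF \<psi>]) (use * lifts_in_Mp in blast)+
    then show ?thesis using Mp_mult[OF *] P[OF *(1)] P[OF *(2)] P[OF lifts_compose[OF *]]
      by (simp add: units_group_def)
  qed
  have nz: "P s \<noteq> 0" if s: "liftable s" for s
  proof -
    obtain \<sigma> where *: "lifts \<sigma> s" using s unfolding liftable_def by blast
    have "\<psi> (\<sigma>, s) \<in> carrier units_group"
      using hom_in_carrier[OF \<psi> lifts_in_Mp[OF *]] .
    then show ?thesis using P[OF *] by (auto simp: units_group_def)
  qed
  have sca: "liftable (restrict (opZ t) S) \<and> P (restrict (opZ t) S) = t" if t: "t dvd 1" for t
  proof -
    obtain u where u: "1 = t * u" using t by (elim dvdE)
    have tu: "t * (u * z) = z" "u * (t * z) = z" for z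
      using u by (metis mult.assoc mult.commute mult_1)+
    have id: "restrict (\<lambda>w. w) W \<in> carrier (Sp sc)"
      by (rule restrict_in_Sp[of _ "\<lambda>w. w"]) simp_all
    have "restrict (opZ t) S \<in> carrier (Aut_S sc)"
      by (rule restrict_in_Aut[of _ "opZ u"])
        (simp_all add: opZ_S, simp_all add: opZ_def[abs_def] tu algebra_simps)
    moreover have "restrict (opZ t) S (U_op sc chi a \<Phi>)
        = U_op sc chi (mu sc chi (restrict (\<lambda>w. w) W) a) (restrict (opZ t) S \<Phi>)"
      if "a \<in> A" "\<Phi> \<in> S" for a \<Phi>
    proof -
      obtain v f z where a: "a = ((v, f), z)" by (metis surj_pair)
      have mu: "mu sc chi (restrict (\<lambda>w. w) W) ((v, f), z) = ((v, f), z)"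
        using that(1) unfolding a by (simp add: mu_apply f_sp_def)
      have "opZ t (opU v f z \<Phi>) = opU v f z (opZ t \<Phi>)"
        by (simp add: opZ_def[abs_def] opU_def[abs_def] mult_ac)
      then show ?thesis using that opZ_S opU_S unfolding a mu U_op_eq by simp
    qed
    ultimately have *: "lifts (restrict (\<lambda>w. w) W) (restrict (opZ t) S)"
      using id unfolding lifts_def by blast
    have "Mp_scalar sc t = (restrict (\<lambda>w. w) W, restrict (opZ t) S)"
      by (simp add: Mp_scalar_def opZ_def[abs_def])
    then have "P (restrict (opZ t) S) = t" using scalar[OF t] P[OF *] by simp
    then show ?thesis using * unfolding liftable_def by blast
  qed
  show ?thesis using mult nz sca by blast
qed

section \<open>Lifts of the symplectic generators\<close>

lemma lifts_restrictI:
  assumes "restrict \<sigma> W \<in> carrier (Sp sc)" "restrict s S \<in> carrier (Aut_S sc)"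
    and eq: "\<And>v f t \<Phi>. f \<in> dual sc \<Longrightarrow> \<Phi> \<in> S \<Longrightarrow>
      s (opU v f t \<Phi>) = opU (fst (\<sigma> (v, f))) (snd (\<sigma> (v, f))) (chi (f_sp \<sigma> (v, f)) * t) (s \<Phi>)"
  shows "lifts (restrict \<sigma> W) (restrict s S)"
  unfolding lifts_def
proof (intro conjI ballI)
  fix a \<Phi> assume a: "a \<in> A" and \<Phi>: "\<Phi> \<in> S"
  obtain v f t where vft: "a = ((v, f), t)" by (metis surj_pair)
  have f: "f \<in> dual sc" using a vft by simp
  have "mu sc chi (restrict \<sigma> W) ((v, f), t) = (\<sigma> (v, f), chi (f_sp \<sigma> (v, f)) * t)"
    using a unfolding vft by (simp add: mu_apply f_sp_def)
  also have "\<dots> = ((fst (\<sigma> (v, f)), snd (\<sigma> (v, f))), chi (f_sp \<sigma> (v, f)) * t)" by simp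
  finally have mu: "mu sc chi (restrict \<sigma> W) ((v, f), t) = \<dots>" .
  have "s \<Phi> \<in> S" using Aut_closed[OF assms(2) \<Phi>] \<Phi> by simp
  then show "restrict s S (U_op sc chi a \<Phi>) = U_op sc chi (mu sc chi (restrict \<sigma> W) a) (restrict s S \<Phi>)"
    unfolding vft mu U_op_eq using eq[OF f \<Phi>] \<Phi> opU_S[OF f \<Phi>] by simp
qed (fact assms)+

text \<open>The symplectic maps are read off from \<open>opN_opU\<close>, \<open>opM_opU\<close> and
  \<open>opF_opU\<close>; \<open>spF'\<close> is the inverse of \<open>spF\<close>.\<close>

definition spN :: "'f \<Rightarrow> 'x \<times> ('x \<Rightarrow> 'f) \<Rightarrow> 'x \<times> ('x \<Rightarrow> 'f)" where
  "spN b = (\<lambda>(v, f). (v, \<lambda>x. f x - 2 * b * eps v * eps x))"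

definition spM :: "'f \<Rightarrow> 'x \<times> ('x \<Rightarrow> 'f) \<Rightarrow> 'x \<times> ('x \<Rightarrow> 'f)" where
  "spM a = (\<lambda>(v, f). (pt v (eps v / a), \<lambda>x. f (pt x (a * eps x))))"

definition spF :: "'x \<times> ('x \<Rightarrow> 'f) \<Rightarrow> 'x \<times> ('x \<Rightarrow> 'f)" where
  "spF = (\<lambda>(v, f). (pt v (f e0), \<lambda>x. f (pt x 0) - eps v * eps x))"

definition spF' :: "'x \<times> ('x \<Rightarrow> 'f) \<Rightarrow> 'x \<times> ('x \<Rightarrow> 'f)" where
  "spF' = (\<lambda>(v, f). (pt v (- f e0), \<lambda>x. f (pt x 0) + eps v * eps x))"

lemma dual_comb: "f \<in> dual sc \<Longrightarrow> (\<lambda>x. f x + a * eps x) \<in> dual sc"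
  by (intro dual_sum dual_cmult) simp_all

lemma spN_in_Sp: "restrict (spN b) W \<in> carrier (Sp sc)"
proof (rule restrict_in_Sp[of _ "spN (- b)"])
  have W: "spN b w \<in> W" if "w \<in> W" for b w
    using that dual_comb[of "snd w" "- (2 * b * eps (fst w))"] by (cases w) (simp add: spN_def)
  show "spN b w \<in> W" "spN (- b) w \<in> W" if "w \<in> W" for w using W[OF that] by blast+
  show "spN (- b) (spN b w) = w" "spN b (spN (- b) w) = w" for w
    by (cases w; simp add: spN_def)+
  show "spN b (W_add w w') = W_add (spN b w) (spN b w')" for w w'
    by (cases w, cases w') (simp add: spN_def algebra_simps)
  show "spN b (W_scale sc a w) = W_scale sc a (spN b w)" for a w
    by (cases w) (simp add: spN_def algebra_simps)
  show "bform (spN b w) (spN b w') - bform (spN b w') (spN b w) = bform w w' - bform w' w" for w w'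
    by (cases w, cases w') (simp add: spN_def mult_ac)
qed

lemma spM_in_Sp:
  assumes a: "a \<noteq> 0" shows "restrict (spM a) W \<in> carrier (Sp sc)"
proof (rule restrict_in_Sp[of _ "spM (1 / a)"])
  have W: "spM a w \<in> W" if "w \<in> W" for a w
  proof -
    obtain v f where w: "w = (v, f)" by fastforce
    have f: "f \<in> dual sc" using that w by simp
    have "(\<lambda>x. f (pt x (a * eps x))) = (\<lambda>x. f x + ((a - 1) * f e0) * eps x)"
      by (simp add: dual_pt[OF f] algebra_simps)
    then show ?thesis using dual_comb[OF f] by (simp add: w spM_def)
  qed
  show "spM a w \<in> W" "spM (1 / a) w \<in> W" if "w \<in> W" for w using W[OF that] by blast+
  show "spM (1 / a) (spM a w) = w" "spM a (spM (1 / a) w) = w" for w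
    using a by (cases w; simp add: spM_def)+
  show "spM a (W_add w w') = W_add (spM a w) (spM a w')" if "w \<in> W" "w' \<in> W" for w w'
    by (cases w, cases w') (simp add: spM_def add_divide_distrib pt_add)
  show "spM a (W_scale sc k w) = W_scale sc k (spM a w)" for k w
    using pt_scale[of k "fst w" "eps (fst w) / a"] by (cases w) (simp add: spM_def)
  show "bform (spM a w) (spM a w') - bform (spM a w') (spM a w) = bform w w' - bform w' w" for w w'
    using a by (cases w, cases w') (simp add: spM_def)
qed

lemma spF_in_Sp: "restrict spF W \<in> carrier (Sp sc)"
proof (rule restrict_in_Sp[of _ spF'])
  have pt0: "f (pt x 0) = f x - f e0 * eps x" if "f \<in> dual sc" for f x
    by (simp add: dual_pt[OF that] algebra_simps)
  have e0: "f (pt e0 0) = 0" if "f \<in> dual sc" for f by (simp add: pt0[OF that])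
  show "spF w \<in> W" if "w \<in> W" for w
  proof -
    obtain v f where w: "w = (v, f)" by fastforce
    have f: "f \<in> dual sc" using that w by simp
    have "(\<lambda>x. f (pt x 0) - eps v * eps x) = (\<lambda>x. f x + (- f e0 - eps v) * eps x)"
      by (simp add: pt0[OF f] algebra_simps)
    then show ?thesis using dual_comb[OF f] by (simp add: w spF_def)
  qed
  show "spF' w \<in> W" if "w \<in> W" for w
  proof -
    obtain v f where w: "w = (v, f)" by fastforce
    have f: "f \<in> dual sc" using that w by simp
    have "(\<lambda>x. f (pt x 0) + eps v * eps x) = (\<lambda>x. f x + (- f e0 + eps v) * eps x)"
      by (simp add: pt0[OF f] algebra_simps)
    then show ?thesis using dual_comb[OF f] by (simp add: w spF'_def)
  qed
  show "spF' (spF w) = w" if "w \<in> W" for w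
  proof -
    obtain v f where w: "w = (v, f)" by fastforce
    have f: "f \<in> dual sc" using that w by simp
    show ?thesis by (simp add: w spF_def spF'_def e0[OF f] pt0[OF f] algebra_simps)
  qed
  show "spF (spF' w) = w" if "w \<in> W" for w
  proof -
    obtain v f where w: "w = (v, f)" by fastforce
    have f: "f \<in> dual sc" using that w by simp
    show ?thesis by (simp add: w spF_def spF'_def e0[OF f] pt0[OF f] algebra_simps)
  qed
  show "spF (W_add w w') = W_add (spF w) (spF w')" if "w \<in> W" "w' \<in> W" for w w'
    by (cases w, cases w') (simp add: spF_def pt_add algebra_simps)
  show "spF (W_scale sc k w) = W_scale sc k (spF w)" for k w
    by (cases w) (simp add: spF_def pt_scale algebra_simps)
  show "bform (spF w) (spF w') - bform (spF w') (spF w) = bform w w' - bform w' w"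
    if "w \<in> W" "w' \<in> W" for w w'
  proof -
    obtain v f v' f' where w: "w = (v, f)" "w' = (v', f')" by fastforce
    have f: "f \<in> dual sc" "f' \<in> dual sc" using that w by simp_all
    show ?thesis by (simp add: w spF_def dual_pt[OF f(1)] dual_pt[OF f(2)] algebra_simps)
  qed
qed

section \<open>The operators as lifts\<close>

lemma opN_in_Aut: "restrict (opN b) S \<in> carrier (Aut_S sc)"
  by (rule restrict_in_Aut[of _ "opN (- b)"])
    (simp_all add: opN_S opN_opN opN_0, simp_all add: opN_def[abs_def] algebra_simps)

lemma opM_in_Aut: "a \<noteq> 0 \<Longrightarrow> restrict (opM a) S \<in> carrier (Aut_S sc)"
  by (rule restrict_in_Aut[of _ "opM (1 / a)"])
    (simp_all add: opM_S opM_opM opM_1, simp_all add: opM_def[abs_def])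

text \<open>By \<open>opF_opF\<close> the inverse transform is the transform followed by a
  reflection and division by \<open>vol c\<close>.\<close>

lemma opF_in_Aut: "restrict opF S \<in> carrier (Aut_S sc)"
proof (rule restrict_in_Aut[of _ "\<lambda>\<Phi>. opZ (vol (- c)) (opM (- 1) (opF \<Phi>))"])
  fix \<Phi> assume \<Phi>: "\<Phi> \<in> S"
  have vv: "vol (- c) * (vol c * z) = z" "vol c * (vol (- c) * z) = z" for z
    using vol_uminus[of c] vol_uminus[of "- c"] by (simp_all flip: mult.assoc)
  show "opF \<Phi> \<in> S" "opZ (vol (- c)) (opM (- 1) (opF \<Phi>)) \<in> S"
    using \<Phi> by (simp_all add: opF_S opM_S opZ_S)
  show "opZ (vol (- c)) (opM (- 1) (opF (opF \<Phi>))) = \<Phi>"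
    unfolding opF_opF[OF \<Phi>] by (simp add: opZ_def[abs_def] opM_def[abs_def] vv)
  have "opF (opZ (vol (- c)) (opM (- 1) (opF \<Phi>))) = opZ (vol (- c)) (opF (opM (- 1) (opF \<Phi>)))"
    unfolding opZ_def[abs_def] by (rule opF_cmult) (simp add: opM_S opF_S \<Phi>)
  also have "opF (opM (- 1) (opF \<Phi>)) = opZ (vol (- 0)) (opM (1 / - 1) (opF (opF \<Phi>)))"
    by (rule opF_opM) (simp_all add: opF_S \<Phi>)
  also have "opZ (vol (- c)) \<dots> = \<Phi>"
    unfolding opF_opF[OF \<Phi>] by (simp add: opZ_def[abs_def] opM_def[abs_def] vv)
  finally show "opF (opZ (vol (- c)) (opM (- 1) (opF \<Phi>))) = \<Phi>" .
qed (fact opF_add opF_cmult)+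

lemma lifts_N: "lifts (restrict (spN b) W) (restrict (opN b) S)"
proof (rule lifts_restrictI[OF spN_in_Sp opN_in_Aut])
  fix v f t \<Phi> assume f: "f \<in> dual sc"
  have "f_sp (spN b) (v, f) = - b * (eps v)\<^sup>2"
    by (simp add: f_sp_def spN_def power2_eq_square)
  then show "opN b (opU v f t \<Phi>) = opU (fst (spN b (v, f))) (snd (spN b (v, f)))
      (chi (f_sp (spN b) (v, f)) * t) (opN b \<Phi>)"
    unfolding opN_opU[OF f] by (simp add: spN_def)
qed

lemma lifts_M: "a \<noteq> 0 \<Longrightarrow> lifts (restrict (spM a) W) (restrict (opM a) S)"
proof (rule lifts_restrictI[OF spM_in_Sp opM_in_Aut])
  fix v f t \<Phi> assume a: "a \<noteq> 0"
  have "f_sp (spM a) (v, f) = 0" using a by (simp add: f_sp_def spM_def)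
  then show "opM a (opU v f t \<Phi>) = opU (fst (spM a (v, f))) (snd (spM a (v, f)))
      (chi (f_sp (spM a) (v, f)) * t) (opM a \<Phi>)"
    unfolding opM_opU[OF a] by (simp add: spM_def)
qed

lemma lifts_F: "lifts (restrict spF W) (restrict opF S)"
proof (rule lifts_restrictI[OF spF_in_Sp opF_in_Aut])
  fix v f t \<Phi> assume f: "f \<in> dual sc" and \<Phi>: "\<Phi> \<in> S"
  have "f_sp spF (v, f) = - eps v * f e0"
    by (simp add: f_sp_def spF_def dual_pt[OF f] algebra_simps)
  then show "opF (opU v f t \<Phi>) = opU (fst (spF (v, f))) (snd (spF (v, f)))
      (chi (f_sp spF (v, f)) * t) (opF \<Phi>)"
    unfolding opF_opU[OF f \<Phi>] by (simp add: spF_def)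
qed

text \<open>The composite on the left of \<open>opF_opN_opF\<close> is onto, so it attains the
  indicator of \<open>L 0\<close>. Evaluation at 0 then writes 1 as a multiple of
  \<open>G e\<close>, which makes the scalar operator \<open>opZ (G e)\<close> admissible.\<close>

lemma G_unit:
  assumes "e \<noteq> 0" shows "G e dvd 1"
proof -
  let ?\<delta> = "\<lambda>x. if x \<in> L 0 then 1 else 0 :: 'r"
  have "SX 0 0 ?\<delta>" unfolding SX_def using L_add_iff by (metis diff_add_cancel add.commute order_refl)
  then have "?\<delta> \<in> S" using S_space_iff by blast
  then obtain \<Phi>1 where 1: "\<Phi>1 \<in> S" "opF \<Phi>1 = ?\<delta>" using Aut_surj[OF opF_in_Aut] by force
  then obtain \<Phi>2 where 2: "\<Phi>2 \<in> S" "opN e \<Phi>2 = \<Phi>1" using Aut_surj[OF opN_in_Aut] by force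
  then obtain \<Phi>3 where 3: "\<Phi>3 \<in> S" "opF \<Phi>3 = \<Phi>2" using Aut_surj[OF opF_in_Aut] by force
  have "1 = opF (opN e (opF \<Phi>3)) 0" using 1 2 3 by simp
  then show ?thesis unfolding opF_opN_opF[OF assms 3(1)] opZ_def by (rule dvdI)
qed

theorem no_character:
  assumes n2: "(2 :: 'r) \<noteq> 0"
    and \<psi>: "\<psi> \<in> hom (Mp sc chi) (units_group :: 'r monoid)"
    and scalar: "\<And>t. t dvd 1 \<Longrightarrow> \<psi> (Mp_scalar sc t) = t"
  shows False
proof -
  obtain P where P_mult: "\<And>s t. liftable s \<Longrightarrow> liftable t \<Longrightarrow> P (compose S s t) = P s * P t"
    and P_nz: "\<And>s. liftable s \<Longrightarrow> P s \<noteq> 0"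
    and Z: "\<And>t. t dvd 1 \<Longrightarrow> liftable (restrict (opZ t) S)" "\<And>t. t dvd 1 \<Longrightarrow> P (restrict (opZ t) S) = t"
    using ex_operator_character[OF \<psi> scalar] by metis
  \<comment> \<open>The group consists of operators restricted to \<open>S\<close>. Stability of
    \<open>S\<close> lets unrestricted operators be composed and restricted once at the end.\<close>
  define ok where "ok s \<longleftrightarrow> liftable (restrict s S) \<and> (\<forall>\<Phi>\<in>S. s \<Phi> \<in> S)" for s
  define p where "p s = P (restrict s S)" for s
  have comp: "compose S (restrict s S) (restrict t S) = restrict (\<lambda>\<Phi>. s (t \<Phi>)) S" if "ok t" for s t
    using that by (auto simp: compose_def ok_def restrict_def)
  have ok_comp: "ok (\<lambda>\<Phi>. s (t \<Phi>))" and p_comp: "p (\<lambda>\<Phi>. s (t \<Phi>)) = p s * p t" if "ok s" "ok t" for s t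
  proof -
    note c = comp[OF that(2), of s, symmetric]
    show "ok (\<lambda>\<Phi>. s (t \<Phi>))" unfolding ok_def c using that liftable_compose by (simp add: ok_def)
    show "p (\<lambda>\<Phi>. s (t \<Phi>)) = p s * p t" unfolding p_def c using that P_mult by (simp add: ok_def)
  qed
  have cong: "p s = p t" if "\<And>\<Phi>. \<Phi> \<in> S \<Longrightarrow> s \<Phi> = t \<Phi>" for s t
  proof -
    have "restrict s S = restrict t S" using that by (auto simp: restrict_def)
    then show ?thesis by (simp add: p_def)
  qed
  have p_nz: "p s \<noteq> 0" if "ok s" for s using that P_nz by (simp add: ok_def p_def)
  have okN: "ok (opN b)" for b using lifts_N opN_S by (auto simp: ok_def liftable_def)
  have okM: "ok (opM a)" if "a \<noteq> 0" for a using lifts_M that opM_S by (auto simp: ok_def liftable_def)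
  have okF: "ok opF" using lifts_F opF_S by (auto simp: ok_def liftable_def)
  have okZ: "ok (opZ t)" and pZ: "p (opZ t) = t" if "t dvd 1" for t
    using Z[OF that] opZ_S by (simp_all add: ok_def p_def)
  define \<eta> where "\<eta> a = p (opM a)" for a
  have \<eta>_mult: "\<eta> (x * y) = \<eta> x * \<eta> y" if "x \<noteq> 0" "y \<noteq> 0" for x y
    using p_comp[OF okM[OF that(1)] okM[OF that(2)]] by (simp add: opM_opM \<eta>_def)
  have \<eta>_nz: "\<eta> x \<noteq> 0" if "x \<noteq> 0" for x using p_nz[OF okM[OF that]] by (simp add: \<eta>_def)
  have \<eta>1: "\<eta> 1 = 1" using \<eta>_mult[of 1 1] \<eta>_nz[of 1] by simp
  have N1: "p (opN b) = 1" for b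
  proof -
    have "absv (\<pi>\<^sup>2) < 1" using pi_lt pi_pos by (simp add: absv_power power_less_one_iff)
    then have pi2: "\<pi>\<^sup>2 \<noteq> 1" by auto
    \<comment> \<open>Solves \<open>d * \<pi>^2 = b + d\<close>. Conjugation by the dilation then
      identifies the values at \<open>d\<close> and at \<open>b + d\<close>, so the value at
      \<open>b\<close> is 1; \<open>\<pi>^2\<close> differs from 1 by its absolute value.\<close>
    define d where "d = b / (\<pi>\<^sup>2 - 1)"
    have "\<eta> \<pi> * p (opN d) = p (\<lambda>\<Phi>. opM \<pi> (opN d \<Phi>))" by (simp add: p_comp okM okN \<eta>_def)
    also have "\<dots> = p (\<lambda>\<Phi>. opN (d * \<pi>\<^sup>2) (opM \<pi> \<Phi>))" by (simp only: opM_opN)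
    also have "\<dots> = p (opN (d * \<pi>\<^sup>2)) * \<eta> \<pi>" by (simp add: p_comp okM okN \<eta>_def)
    finally have "p (opN d) = p (opN (d * \<pi>\<^sup>2))" using \<eta>_nz[OF pi_nz] by (simp add: mult.commute)
    also have "d * \<pi>\<^sup>2 = b + d" using pi2 by (simp add: d_def field_simps)
    also have "p (opN (b + d)) = p (opN b) * p (opN d)" using p_comp[OF okN okN] by (simp add: opN_opN)
    finally show ?thesis using p_nz[OF okN[of d]] by simp
  qed
  \<comment> \<open>The factor \<open>\<eta> (- 2)\<close> turns the argument
    \<open>-1 / (2 * e)\<close> of the dilation in \<open>opF_opN_opF\<close> into the inverse of
    \<open>e\<close>.\<close>
  define g where "g = p opF * \<eta> (- 2)"
  show False
  proof (rule gauss_not_multiplicative[where g = g and \<eta> = \<eta>])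
    show "\<eta> x * \<eta> x = vol (- k)" if "absv x = absv \<pi> powi k" for x k
    proof -
      have x0: "x \<noteq> 0" using that pi_pos by (auto dest: sym)
      have "p opF * \<eta> x = p (\<lambda>\<Phi>. opF (opM x \<Phi>))" by (simp add: p_comp okM x0 okF \<eta>_def)
      also have "\<dots> = p (\<lambda>\<Phi>. opZ (vol (- k)) (opM (1 / x) (opF \<Phi>)))"
        by (rule cong) (rule opF_opM[OF _ that])
      also have "\<dots> = vol (- k) * (\<eta> (1 / x) * p opF)"
      proof -
        have M: "ok (opM (1 / x))" using x0 by (intro okM) simp
        show ?thesis
          unfolding \<eta>_def p_comp[OF okZ[OF vol_unit] ok_comp[OF M okF]] p_comp[OF M okF] pZ[OF vol_unit] ..
      qed
      finally have "\<eta> x = vol (- k) * \<eta> (1 / x)" using p_nz[OF okF] by simp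
      then have "\<eta> x * \<eta> x = vol (- k) * (\<eta> (1 / x) * \<eta> x)" by simp
      also have "\<eta> (1 / x) * \<eta> x = 1" using \<eta>_mult[of "1 / x" x] x0 \<eta>1 by simp
      finally show ?thesis by simp
    qed
    show "\<exists>M0. \<forall>M\<le>M0. gauss M e = g * \<eta> e" if e: "e \<noteq> 0" for e
    proof -
      let ?h = "- 1 / (4 * e)" and ?k = "- 1 / (2 * e)"
      have k0: "?k \<noteq> 0" using e by simp
      have "p opF * (p (opN e) * p opF) = p (\<lambda>\<Phi>. opF (opN e (opF \<Phi>)))"
        unfolding p_comp[OF okF ok_comp[OF okN okF]] p_comp[OF okN okF] ..
      also have "\<dots> = p (\<lambda>\<Phi>. opZ (G e) (opN ?h (opM ?k (opF (opN ?h \<Phi>)))))"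
        by (rule cong) (rule opF_opN_opF[OF e])
      also have "\<dots> = G e * (p (opN ?h) * (\<eta> ?k * (p opF * p (opN ?h))))"
      proof -
        have M: "ok (opM ?k)" using k0 by (rule okM)
        note FN = ok_comp[OF okF okN[of ?h]]
        note MFN = ok_comp[OF M FN]
        note NMFN = ok_comp[OF okN[of ?h] MFN]
        show ?thesis
          unfolding \<eta>_def p_comp[OF okZ[OF G_unit[OF e]] NMFN] p_comp[OF okN MFN] p_comp[OF M FN]
            p_comp[OF okF okN] pZ[OF G_unit[OF e]] ..
      qed
      \<comment> \<open>One of the two transforms on the left cancels against the one on the right,
        and the unipotent factors are 1 by \<open>N1\<close>.\<close>
      finally have "p opF = G e * \<eta> ?k" using p_nz[OF okF] by (simp add: N1 mult.assoc)
      then have "g * \<eta> e = G e * (\<eta> ?k * \<eta> (- 2) * \<eta> e)" by (simp add: g_def mult_ac)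
      also have "\<eta> ?k * \<eta> (- 2) * \<eta> e = \<eta> (?k * (- 2) * e)"
      proof -
        have n2: "- 2 \<noteq> (0 :: 'f)" by simp
        have kn: "?k * (- 2) \<noteq> 0" by (rule no_zero_divisors[OF k0 n2])
        show ?thesis unfolding \<eta>_mult[OF kn e] \<eta>_mult[OF k0 n2] ..
      qed
      also have "?k * (- 2) * e = 1" using e by simp
      finally have "g * \<eta> e = G e" by (simp add: \<eta>1)
      then show ?thesis using gauss_eventually_G[OF two_neq_0 e] by simp
    qed
  qed (fact two_neq_0 n2 \<eta>_mult)+
qed

end

lemma two_neq_0_if_CHAR: "CHAR('a::idom) \<noteq> 2 \<Longrightarrow> (2 :: 'a) \<noteq> 0"
proof
  assume "CHAR('a) \<noteq> 2" "(2 :: 'a) = 0"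
  then have "of_nat 2 = (0 :: 'a)" by simp
  then have "CHAR('a) dvd 2" by (simp only: of_nat_eq_0_iff_char_dvd)
  then have "CHAR('a) = 1 \<or> CHAR('a) = 2" using two_is_prime_nat unfolding prime_nat_iff by blast
  then show False using \<open>CHAR('a) \<noteq> 2\<close> by simp
qed

theorem theorem5p4:
  fixes absv :: "'f::{field,metric_space} \<Rightarrow> real"
    and chi :: "'f \<Rightarrow> 'r::idom"
    and sc :: "'f \<Rightarrow> 'x::ab_group_add \<Rightarrow> 'x"
    and Basis :: "'x set"
    and p q :: nat
  assumes "nonarch_local_field absv"
    and "CHAR('f) \<noteq> 2"
    and "p = ring_char (residue_field absv)"
    and "q = card (carrier (residue_field absv))"
    and "(of_nat p :: 'r) dvd 1"
    and "\<exists>s::'r. s ^ 2 = of_nat q"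
    and "smooth_character chi"
    and "\<exists>x. chi x \<noteq> 1"
    and "finite_dimensional_vector_space sc Basis"
    and "\<exists>x::'x. x \<noteq> 0"
    and "CHAR('r) \<noteq> 2"
  shows "\<not> (\<exists>\<psi> \<in> hom (Mp sc chi) (units_group :: 'r monoid).
               \<forall>t::'r. t dvd 1 \<longrightarrow> \<psi> (Mp_scalar sc t) = t)"
proof
  assume "\<exists>\<psi> \<in> hom (Mp sc chi) (units_group :: 'r monoid). \<forall>t::'r. t dvd 1 \<longrightarrow> \<psi> (Mp_scalar sc t) = t"
  then obtain \<psi> where \<psi>: "\<psi> \<in> hom (Mp sc chi) (units_group :: 'r monoid)"
    "\<And>t::'r. t dvd 1 \<Longrightarrow> \<psi> (Mp_scalar sc t) = t" by blast
  interpret nonarch_local_field absv by fact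
  obtain \<pi> where \<pi>: "\<pi> \<noteq> 0" "absv \<pi> < 1" "\<forall>x. absv x < 1 \<longrightarrow> absv x \<le> absv \<pi>"
    using ex_uniformizer by blast
  interpret U: uniformized absv \<pi>
    by unfold_locales (use \<pi> in auto)
  obtain c where c: "\<forall>x\<in>U.B c. chi x = 1" "\<exists>x\<in>U.B (c - 1). chi x \<noteq> 1"
    using U.ex_conductor[OF assms(7,8)] by blast
  have "(of_nat U.q :: 'r) dvd 1" using U.q_unit assms(3,5) by simp
  then obtain qi :: 'r where "1 = of_nat U.q * qi" by (elim dvdE)
  then have qi: "qi * of_nat U.q = 1" by (simp add: mult.commute)
  interpret V: finite_dimensional_vector_space sc Basis by fact
  \<comment> \<open>A nonzero vector forces a basis element, which serves as the direction
    \<open>e0\<close> of all operators.\<close>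
  have "Basis \<noteq> {}"
  proof
    assume "Basis = {}"
    then have "(UNIV :: 'x set) = {0}" using V.span_Basis V.span_empty by simp
    then show False using assms(10) by blast
  qed
  then obtain e0 where e0: "e0 \<in> Basis" by blast
  have chi_add: "chi (x + y) = chi x * chi y" for x y
    using assms(7) by (auto simp: smooth_character_def hom_def additive_group_def units_group_def)
  interpret weil_space absv \<pi> chi c qi sc Basis e0
    by unfold_locales (use chi_add c qi e0 two_neq_0_if_CHAR[OF assms(2)] in auto)
  show False by (rule no_character[OF two_neq_0_if_CHAR[OF assms(11)] \<psi>])
qed

end
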